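(* Let $A$ be a uniform algebra on a compact Hausdorff space $\Omega$. The set $\mathcal{R}(\Omega)$ is a unital semigroup (under pointwise multiplication). Indeed, if $f_1\in\mathcal{R}(\Omega)$ and $f_2\in C(\Omega)$ is nonnegative, then $\overline{Af_1}\otimes_{hA}\overline{Af_2}\cong\overline{Af_1f_2}$ completely $A$-isometrically (closures taken in $C(\Omega)$). If $f_1\in\mathcal{R}_{E_1}(\Omega)$ and $f_2\in\mathcal{R}_{E_2}(\Omega)$, then $f_1f_2\in\mathcal{R}_{E_1\cup E_2}(\Omega)$.
   Context: A uniform algebra on a compact Hausdorff space $\Omega$ is a closed subalgebra of $C(\Omega)$ (complex continuous functions) which contains the constants and separates points. Subspaces of $C(\Omega)$ carry the operator space structure inherited from $C(\Omega)$. For operator $A$-modules $X$ (right) and $Y$ (left), the module Haagerup tensor product $X\otimes_{hA}Y$ is the quotient of the Haagerup tensor product $X\otimes_hY$ by the closed subspace spanned by the elements $xa\otimes y-x\otimes ay$ ($x\in X,y\in Y,a\in A$); the modules $\overline{Af}$ are symmetric ($xa=ax$). "Completely $A$-isometrically" means via a surjective completely isometric $A$-module isomorphism. An $A$-tuple is an element of $A^{(n)}$ for some $n$, regarded as a function $\Omega\to\mathbb{C}^n$; $H\cdot K=\sum_ih_ik_i$ for $A$-tuples of equal length, and $\|\cdot\|_2$ is the Euclidean norm. For a closed subset $E\subset\Omega$, $\mathcal{R}_E(\Omega)$ is the set of $f\in C(\Omega)$ which vanish exactly on $E$ and for which there are two sequences $H_n,K_n$ of $A$-tuples ($H_n$,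 $K_n$ of the same length) such that (i) $\|K_n(w)\|_2\le f(w)\le\|H_n(w)\|_2^{-1}$ for all $w\in\Omega$ (with $\frac10=\infty$), and (ii) $H_n(w)\cdot K_n(w)\to1$ uniformly on compact subsets of $\Omega\setminus E$. $\mathcal{R}(\Omega)$ is the union of all the $\mathcal{R}_E(\Omega)$. *)

theory Defs
  imports "HOL-Analysis.Analysis" "HOL-Library.Poly_Mapping" "HOL-Algebra.Group"
begin

section \<open>The algebra of continuous functions on a compact space\<close>

text \<open>On a compact space the type of bounded continuous complex functions is \<open>C(\<Omega>)\<close>, with its
  supremum norm. We equip it with its pointwise ring structure.\<close>

instantiation bcontfun :: (topological_space, real_normed_field) comm_ring_1
begin

definition one_bcontfun :: "'a \<Rightarrow>\<^sub>C 'b" where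
  "1 = const_bcontfun 1"

definition times_bcontfun :: "('a \<Rightarrow>\<^sub>C 'b) \<Rightarrow> ('a \<Rightarrow>\<^sub>C 'b) \<Rightarrow> 'a \<Rightarrow>\<^sub>C 'b" where
  "times_bcontfun f g = Bcontfun (\<lambda>w. f w * g w)"

lemma apply_bcontfun_times: "apply_bcontfun (f * g) w = f w * g w" for f g :: "'a \<Rightarrow>\<^sub>C 'b"
proof -
  obtain B C where B: "\<And>w. norm (f w) \<le> B" and C: "\<And>w. norm (g w) \<le> C"
    using bounded_apply_bcontfun[of f] bounded_apply_bcontfun[of g]
    unfolding bounded_iff by auto
  have "norm (f w * g w) \<le> B * C" for w
    unfolding norm_mult by (meson B C mult_mono norm_ge_zero order_trans)
  then have "(\<lambda>w. f w * g w) \<in> bcontfun"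
    by (intro bcontfun_normI continuous_intros) auto
  then show ?thesis
    by (simp add: times_bcontfun_def Bcontfun_inverse)
qed

lemma apply_bcontfun_one: "apply_bcontfun (1 :: 'a \<Rightarrow>\<^sub>C 'b) w = 1"
  by (simp add: one_bcontfun_def const_bcontfun.rep_eq)

instance
proof
  fix f g h :: "'a \<Rightarrow>\<^sub>C 'b"
  show "(f * g) * h = f * (g * h)" "f * g = g * f" "1 * f = f" "(f + g) * h = f * h + g * h"
    by (rule bcontfun_eqI, simp add: apply_bcontfun_times apply_bcontfun_one algebra_simps
        plus_bcontfun.rep_eq)+
  show "(0 :: 'a \<Rightarrow>\<^sub>C 'b) \<noteq> 1"
  proof
    assume "(0 :: 'a \<Rightarrow>\<^sub>C 'b) = 1"
    then have "apply_bcontfun (0 :: 'a \<Rightarrow>\<^sub>C 'b) undefined = apply_bcontfun (1 :: 'a \<Rightarrow>\<^sub>C 'b) undefined"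
      by simp
    then show False
      by (simp add: apply_bcontfun_one zero_bcontfun.rep_eq)
  qed
qed

end

declare apply_bcontfun_times [simp] apply_bcontfun_one [simp]

text \<open>Closure under scalar multiplication follows from containing the constants.\<close>

definition uniform_algebra :: "('w::topological_space \<Rightarrow>\<^sub>C complex) set \<Rightarrow> bool" where
  "uniform_algebra A \<longleftrightarrow>
     closed A
   \<and> (\<forall>c. const_bcontfun c \<in> A)
   \<and> (\<forall>f\<in>A. \<forall>g\<in>A. f + g \<in> A \<and> f * g \<in> A)
   \<and> (\<forall>v w. v \<noteq> w \<longrightarrow> (\<exists>f\<in>A. apply_bcontfun f v \<noteq> apply_bcontfun f w))"


section \<open>The sets \<open>\<R>\<^sub>E(\<Omega>)\<close> and \<open>\<R>(\<Omega>)\<close>\<close>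

text \<open>An \<open>A\<close>-tuple is a nonempty list with entries in \<open>A\<close>.\<close>

definition is_tuple :: "('w::topological_space \<Rightarrow>\<^sub>C complex) set \<Rightarrow> ('w \<Rightarrow>\<^sub>C complex) list \<Rightarrow> bool" where
  "is_tuple A H \<longleftrightarrow> H \<noteq> [] \<and> set H \<subseteq> A"

definition tuple_norm :: "('w::topological_space \<Rightarrow>\<^sub>C complex) list \<Rightarrow> 'w \<Rightarrow> real" where
  "tuple_norm H w = L2_set (\<lambda>i. cmod ((H ! i) w)) {..<length H}"

definition tuple_dot ::
  "('w::topological_space \<Rightarrow>\<^sub>C complex) list \<Rightarrow> ('w \<Rightarrow>\<^sub>C complex) list \<Rightarrow> 'w \<Rightarrow> complex" where
  "tuple_dot H K w = (\<Sum>i<length H. (H ! i) w * (K ! i) w)"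

text \<open>The inequalities between \<open>f(w)\<close> and real numbers mean in particular that \<open>f(w)\<close> is real.
  In the extended reals \<open>inverse 0 = \<infinity>\<close>.\<close>

definition R_at :: "('w::topological_space \<Rightarrow>\<^sub>C complex) set \<Rightarrow> 'w set \<Rightarrow> ('w \<Rightarrow>\<^sub>C complex) set" where
  "R_at A E = {f :: 'w \<Rightarrow>\<^sub>C complex. {w. f w = 0} = E \<and>
     (\<exists>H K :: nat \<Rightarrow> ('w \<Rightarrow>\<^sub>C complex) list.
        (\<forall>n. is_tuple A (H n) \<and> is_tuple A (K n) \<and> length (H n) = length (K n))
      \<and> (\<forall>n w. f w \<in> \<real>
            \<and> tuple_norm (K n) w \<le> Re (f w)
            \<and> ereal (Re (f w)) \<le> inverse (ereal (tuple_norm (H n) w)))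
      \<and> (\<forall>C. compact C \<and> C \<subseteq> - E \<longrightarrow>
            uniform_limit C (\<lambda>n. tuple_dot (H n) (K n)) (\<lambda>_. 1) sequentially))}"

definition R_all :: "('w::topological_space \<Rightarrow>\<^sub>C complex) set \<Rightarrow> ('w \<Rightarrow>\<^sub>C complex) set" where
  "R_all A = (\<Union>E\<in>{E. closed E}. R_at A E)"


section \<open>Matrix normed modules\<close>

text \<open>The data of an operator space that is a (symmetric) module over an algebra with elements of
  type \<open>'b\<close>. A matrix is a function \<open>M :: nat \<Rightarrow> nat \<Rightarrow> 'v\<close>, and \<open>mnorm V p q M\<close> is the norm of the
  \<open>p \<times> q\<close> matrix \<open>(M i j)\<close>, \<open>i < p\<close>, \<open>j < q\<close>; other entries are irrelevant. Since all modules are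
  symmetric, \<open>vact\<close> serves as both the left and the right action.\<close>

record ('b, 'v) op_module =
  pts :: "'v set"
  vzero :: 'v
  vplus :: "'v \<Rightarrow> 'v \<Rightarrow> 'v"
  vscale :: "complex \<Rightarrow> 'v \<Rightarrow> 'v"
  vact :: "'b \<Rightarrow> 'v \<Rightarrow> 'v"
  mnorm :: "nat \<Rightarrow> nat \<Rightarrow> (nat \<Rightarrow> nat \<Rightarrow> 'v) \<Rightarrow> real"

definition vminus :: "('b, 'v) op_module \<Rightarrow> 'v \<Rightarrow> 'v \<Rightarrow> 'v" where
  "vminus V u v = vplus V u (vscale V (-1) v)"

definition vnorm :: "('b, 'v) op_module \<Rightarrow> 'v \<Rightarrow> real" where
  "vnorm V v = mnorm V 1 1 (\<lambda>_ _. v)"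

definition mat_in :: "'v set \<Rightarrow> nat \<Rightarrow> nat \<Rightarrow> (nat \<Rightarrow> nat \<Rightarrow> 'v) \<Rightarrow> bool" where
  "mat_in S p q M \<longleftrightarrow> (\<forall>i<p. \<forall>j<q. M i j \<in> S)"

definition lin_subspace :: "('b, 'v) op_module \<Rightarrow> 'v set \<Rightarrow> bool" where
  "lin_subspace V W \<longleftrightarrow> W \<subseteq> pts V \<and> vzero V \<in> W
     \<and> (\<forall>u\<in>W. \<forall>v\<in>W. vplus V u v \<in> W) \<and> (\<forall>c. \<forall>v\<in>W. vscale V c v \<in> W)"

definition closed_in :: "('b, 'v) op_module \<Rightarrow> 'v set \<Rightarrow> bool" where
  "closed_in V W \<longleftrightarrow> (\<forall>v\<in>pts V. (\<forall>e>0. \<exists>u\<in>W. vnorm V (vminus V v u) < e) \<longrightarrow> v \<in> W)"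

definition lin_span :: "('b, 'v) op_module \<Rightarrow> 'v set \<Rightarrow> 'v set" where
  "lin_span V S = \<Inter>{W. lin_subspace V W \<and> S \<subseteq> W}"

definition closed_lin_span :: "('b, 'v) op_module \<Rightarrow> 'v set \<Rightarrow> 'v set" where
  "closed_lin_span V S = \<Inter>{W. lin_subspace V W \<and> closed_in V W \<and> S \<subseteq> W}"

subsection \<open>Subspaces of the continuous functions\<close>

definition mat_op_norm :: "nat \<Rightarrow> nat \<Rightarrow> (nat \<Rightarrow> nat \<Rightarrow> complex) \<Rightarrow> real" where
  "mat_op_norm p q m =
     Sup {L2_set (\<lambda>i. cmod (\<Sum>j<q. m i j * z j)) {..<p} | z :: nat \<Rightarrow> complex.
            L2_set (\<lambda>j. cmod (z j)) {..<q} \<le> 1}"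

definition fun_module ::
  "('w::topological_space \<Rightarrow>\<^sub>C complex) set \<Rightarrow> ('w \<Rightarrow>\<^sub>C complex, 'w \<Rightarrow>\<^sub>C complex) op_module" where
  "fun_module X = \<lparr>pts = X, vzero = 0, vplus = (+), vscale = (\<lambda>c f. const_bcontfun c * f),
     vact = (*), mnorm = (\<lambda>p q M. SUP w. mat_op_norm p q (\<lambda>i j. (M i j) w))\<rparr>"

subsection \<open>Quotients\<close>

definition vcoset :: "('b, 'v) op_module \<Rightarrow> 'v set \<Rightarrow> 'v \<Rightarrow> 'v set" where
  "vcoset V N v = {u \<in> pts V. vminus V u v \<in> N}"

text \<open>The unions defining the operations are unions of a single coset, independent of the
  representatives (for the action, when \<open>N\<close> is a submodule).\<close>

definition quot_module :: "('b, 'v) op_module \<Rightarrow> 'v set \<Rightarrow> ('b, 'v set) op_module" where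
  "quot_module V N =
     \<lparr>pts = vcoset V N ` pts V,
      vzero = vcoset V N (vzero V),
      vplus = (\<lambda>S T. \<Union>s\<in>S. \<Union>t\<in>T. vcoset V N (vplus V s t)),
      vscale = (\<lambda>c S. \<Union>s\<in>S. vcoset V N (vscale V c s)),
      vact = (\<lambda>a S. \<Union>s\<in>S. vcoset V N (vact V a s)),
      mnorm = (\<lambda>p q M. Inf {mnorm V p q m | m. \<forall>i<p. \<forall>j<q. m i j \<in> M i j})\<rparr>"

subsection \<open>Completions\<close>

definition cauchy_seqs :: "('b, 'v) op_module \<Rightarrow> (nat \<Rightarrow> 'v) set" where
  "cauchy_seqs V = {s. (\<forall>n. s n \<in> pts V)
     \<and> (\<forall>e>0. \<exists>N. \<forall>m\<ge>N. \<forall>n\<ge>N. vnorm V (vminus V (s m) (s n)) < e)}"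

definition cauchy_class :: "('b, 'v) op_module \<Rightarrow> (nat \<Rightarrow> 'v) \<Rightarrow> (nat \<Rightarrow> 'v) set" where
  "cauchy_class V s = {t \<in> cauchy_seqs V. (\<lambda>n. vnorm V (vminus V (t n) (s n))) \<longlonglongrightarrow> 0}"

text \<open>As for quotients, the operations do not depend on the representing Cauchy sequences. The norm
  of a matrix of classes is the limit of the norms of the matrices of \<open>n\<close>-th terms.\<close>

definition completion :: "('b, 'v) op_module \<Rightarrow> ('b, (nat \<Rightarrow> 'v) set) op_module" where
  "completion V =
     \<lparr>pts = cauchy_class V ` cauchy_seqs V,
      vzero = cauchy_class V (\<lambda>_. vzero V),
      vplus = (\<lambda>S T. \<Union>s\<in>S. \<Union>t\<in>T. cauchy_class V (\<lambda>n. vplus V (s n) (t n))),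
      vscale = (\<lambda>c S. \<Union>s\<in>S. cauchy_class V (\<lambda>n. vscale V c (s n))),
      vact = (\<lambda>a S. \<Union>s\<in>S. cauchy_class V (\<lambda>n. vact V a (s n))),
      mnorm = (\<lambda>p q M. THE l. \<forall>m. (\<forall>i<p. \<forall>j<q. m i j \<in> M i j) \<longrightarrow>
                 (\<lambda>n. mnorm V p q (\<lambda>i j. m i j n)) \<longlonglongrightarrow> l)\<rparr>"


section \<open>Haagerup tensor products\<close>

text \<open>The algebraic tensor product is the free complex vector space on \<open>X \<times> Y\<close> modulo the bilinearity
  relations; \<open>single (x, y) 1\<close> represents \<open>x \<otimes> y\<close>. The matrix norms of the free vector space play no
  role and are set to zero. The algebra acts by \<open>a(x \<otimes> y) = (ax) \<otimes> y\<close>.\<close>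

definition free_module ::
  "('b, 'x) op_module \<Rightarrow> ('b, 'y) op_module \<Rightarrow> ('b, ('x \<times> 'y) \<Rightarrow>\<^sub>0 complex) op_module" where
  "free_module X Y =
     \<lparr>pts = {u. Poly_Mapping.keys u \<subseteq> pts X \<times> pts Y},
      vzero = 0,
      vplus = (+),
      vscale = (\<lambda>c u. Poly_Mapping.map (\<lambda>z. c * z) u),
      vact = (\<lambda>a u. \<Sum>k\<in>Poly_Mapping.keys u.
                Poly_Mapping.single (vact X a (fst k), snd k) (Poly_Mapping.lookup u k)),
      mnorm = (\<lambda>_ _ _. 0)\<rparr>"

definition bilinear_relations ::
  "('b, 'x) op_module \<Rightarrow> ('b, 'y) op_module \<Rightarrow> (('x \<times> 'y) \<Rightarrow>\<^sub>0 complex) set" where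
  "bilinear_relations X Y =
     {Poly_Mapping.single (vplus X x x', y) 1 - Poly_Mapping.single (x, y) 1
        - Poly_Mapping.single (x', y) 1 | x x' y. x \<in> pts X \<and> x' \<in> pts X \<and> y \<in> pts Y}
   \<union> {Poly_Mapping.single (x, vplus Y y y') 1 - Poly_Mapping.single (x, y) 1
        - Poly_Mapping.single (x, y') 1 | x y y'. x \<in> pts X \<and> y \<in> pts Y \<and> y' \<in> pts Y}
   \<union> {Poly_Mapping.single (vscale X c x, y) 1 - Poly_Mapping.single (x, y) c
        | c x y. x \<in> pts X \<and> y \<in> pts Y}
   \<union> {Poly_Mapping.single (x, vscale Y c y) 1 - Poly_Mapping.single (x, y) c
        | c x y. x \<in> pts X \<and> y \<in> pts Y}"

definition tensor_class ::
  "('b, 'x) op_module \<Rightarrow> ('b, 'y) op_module \<Rightarrow> (('x \<times> 'y) \<Rightarrow>\<^sub>0 complex)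
     \<Rightarrow> (('x \<times> 'y) \<Rightarrow>\<^sub>0 complex) set" where
  "tensor_class X Y =
     vcoset (free_module X Y) (lin_span (free_module X Y) (bilinear_relations X Y))"

text \<open>The Haagerup norm of \<open>U \<in> M\<^sub>p\<^sub>q(X \<otimes> Y)\<close> is the infimum of \<open>\<parallel>x\<parallel>\<parallel>y\<parallel>\<close> over all factorisations
  \<open>U = x \<odot> y\<close>, that is \<open>U i j = (\<Sum>k<r. x i k \<otimes> y k j)\<close>, with \<open>x \<in> M\<^sub>p\<^sub>r(X)\<close> and \<open>y \<in> M\<^sub>r\<^sub>q(Y)\<close>.\<close>

definition haagerup_norm ::
  "('b, 'x) op_module \<Rightarrow> ('b, 'y) op_module \<Rightarrow> nat \<Rightarrow> nat
     \<Rightarrow> (nat \<Rightarrow> nat \<Rightarrow> (('x \<times> 'y) \<Rightarrow>\<^sub>0 complex) set) \<Rightarrow> real" where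
  "haagerup_norm X Y p q U =
     Inf {mnorm X p r x * mnorm Y r q y | r x y.
            mat_in (pts X) p r x \<and> mat_in (pts Y) r q y
          \<and> (\<forall>i<p. \<forall>j<q. U i j =
                tensor_class X Y (\<Sum>k<r. Poly_Mapping.single (x i k, y k j) 1))}"

definition alg_haagerup ::
  "('b, 'x) op_module \<Rightarrow> ('b, 'y) op_module
     \<Rightarrow> ('b, (('x \<times> 'y) \<Rightarrow>\<^sub>0 complex) set) op_module" where
  "alg_haagerup X Y =
     (quot_module (free_module X Y) (lin_span (free_module X Y) (bilinear_relations X Y)))
       \<lparr>mnorm := haagerup_norm X Y\<rparr>"

definition haagerup ::
  "('b, 'x) op_module \<Rightarrow> ('b, 'y) op_module
     \<Rightarrow> ('b, (nat \<Rightarrow> (('x \<times> 'y) \<Rightarrow>\<^sub>0 complex) set) set) op_module" where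
  "haagerup X Y = completion (alg_haagerup X Y)"

definition elem_tensor ::
  "('b, 'x) op_module \<Rightarrow> ('b, 'y) op_module \<Rightarrow> 'x \<Rightarrow> 'y
     \<Rightarrow> (nat \<Rightarrow> (('x \<times> 'y) \<Rightarrow>\<^sub>0 complex) set) set" where
  "elem_tensor X Y x y =
     cauchy_class (alg_haagerup X Y) (\<lambda>_. tensor_class X Y (Poly_Mapping.single (x, y) 1))"

definition module_haagerup ::
  "'b set \<Rightarrow> ('b, 'x) op_module \<Rightarrow> ('b, 'y) op_module
     \<Rightarrow> ('b, (nat \<Rightarrow> (('x \<times> 'y) \<Rightarrow>\<^sub>0 complex) set) set set) op_module" where
  "module_haagerup A X Y =
     quot_module (haagerup X Y)
       (closed_lin_span (haagerup X Y)
          {vminus (haagerup X Y) (elem_tensor X Y (vact X a x) y) (elem_tensor X Y x (vact Y a y))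
             | a x y. a \<in> A \<and> x \<in> pts X \<and> y \<in> pts Y})"


section \<open>Complete isometric isomorphism of modules\<close>

definition completely_isometric_iso ::
  "'b set \<Rightarrow> ('b, 'v) op_module \<Rightarrow> ('b, 'u) op_module \<Rightarrow> bool" where
  "completely_isometric_iso A V W \<longleftrightarrow>
     (\<exists>T. bij_betw T (pts V) (pts W)
        \<and> (\<forall>u\<in>pts V. \<forall>v\<in>pts V. T (vplus V u v) = vplus W (T u) (T v))
        \<and> (\<forall>c. \<forall>v\<in>pts V. T (vscale V c v) = vscale W c (T v))
        \<and> (\<forall>a\<in>A. \<forall>v\<in>pts V. T (vact V a v) = vact W a (T v))
        \<and> (\<forall>n M. n > 0 \<and> mat_in (pts V) n n M \<longrightarrow>
              mnorm W n n (\<lambda>i j. T (M i j)) = mnorm V n n M))"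

definition principal_closure ::
  "('w::topological_space \<Rightarrow>\<^sub>C complex) set \<Rightarrow> ('w \<Rightarrow>\<^sub>C complex)
     \<Rightarrow> ('w \<Rightarrow>\<^sub>C complex, 'w \<Rightarrow>\<^sub>C complex) op_module" where
  "principal_closure A f = fun_module (closure ((\<lambda>a. a * f) ` A))"

end

theory Submission
  imports Defs "HOL-Library.Function_Algebras"
begin

text \<open>
  The multiplication map \<open>x \<otimes> y \<mapsto> xy\<close> is completely contractive and vanishes on the
  relations \<open>xa \<otimes> y - x \<otimes> ay\<close>. Conversely, modulo these relations every tensor is close to
  some \<open>f\<^sub>1 \<otimes> c f\<^sub>2\<close> with \<open>c\<close> in \<open>A\<close>. The bounds
  \<open>\<parallel>K\<^sub>n\<parallel>\<^sub>2 \<le> f\<^sub>1 \<le> \<parallel>H\<^sub>n\<parallel>\<^sub>2\<^sup>-\<^sup>1\<close> give \<open>\<bar>H\<^sub>n \<cdot> K\<^sub>n\<bar> \<le> 1\<close> everywhere, hence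
  \<open>f\<^sub>1 (H\<^sub>n \<cdot> K\<^sub>n) \<rightarrow> f\<^sub>1\<close> in norm, and so \<open>f\<^sub>1 \<otimes> c f\<^sub>2\<close> is close to
  \<open>\<Sum> f\<^sub>1 h\<^sub>l \<otimes> k\<^sub>l c f\<^sub>2\<close>. In this factorisation the row has norm at most \<open>1\<close>, and the
  column has norm at most \<open>\<parallel>c f\<^sub>1 f\<^sub>2\<parallel>\<close>, the norm of the product, because
  \<open>\<parallel>K\<^sub>n\<parallel>\<^sub>2 \<le> f\<^sub>1\<close>. The same computation with matrices \<open>c\<close> lifts every matrix over
  \<open>A f\<^sub>1 f\<^sub>2\<close> almost isometrically up to a small error, and summing successive errors makes the
  lift exact. For the semigroup statement, tuples for a product are the Kronecker products of the
  tuples for its factors.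
\<close>

section \<open>Matrices of continuous functions\<close>

text \<open>The obstacle is that the estimates are approximate while the module tensor product is
  exact: it is a quotient by a closed span inside a completion, and the norm of a matrix over it is
  an infimum over representatives taken from prescribed cosets. Two statements bridge the gap. The
  closed span is shown to be the whole kernel of the multiplication map, so that a coset is
  precisely the set of classes with a given product; this rests on the fact that the distance of a
  tensor to any additive set containing the relations is at most the norm of its product, up to an
  arbitrarily small error. And matrices must be lifted exactly, since an approximate lift does not
  belong to the required cosets. Both statements use the same block estimate
  \<open>hnorm_block_le\<close>, at size \<open>n\<close> for the lift and at size \<open>1\<close>
  for the kernel.\<close>

abbreviation l2norm :: "nat \<Rightarrow> (nat \<Rightarrow> complex) \<Rightarrow> real" where
  "l2norm n z \<equiv> L2_set (\<lambda>i. cmod (z i)) {..<n}"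

abbreviation mat_vec :: "nat \<Rightarrow> (nat \<Rightarrow> nat \<Rightarrow> complex) \<Rightarrow> (nat \<Rightarrow> complex) \<Rightarrow> nat \<Rightarrow> complex" where
  "mat_vec q m z \<equiv> \<lambda>i. \<Sum>j<q. m i j * z j"

lemma l2norm_power2: "(l2norm n z)\<^sup>2 = (\<Sum>i<n. (cmod (z i))\<^sup>2)"
  by (simp add: L2_set_def sum_nonneg)

lemma l2norm_triangle: "l2norm n (\<lambda>i. x i + y i) \<le> l2norm n x + l2norm n y"
proof -
  have "l2norm n (\<lambda>i. x i + y i) \<le> L2_set (\<lambda>i. cmod (x i) + cmod (y i)) {..<n}"
    by (intro L2_set_mono norm_triangle_ineq) auto
  also have "\<dots> \<le> l2norm n x + l2norm n y"
    by (rule L2_set_triangle_ineq)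
  finally show ?thesis .
qed

lemma l2norm_scale: "l2norm n (\<lambda>i. c * x i) = cmod c * l2norm n x"
  by (simp add: norm_mult L2_set_right_distrib)

lemma L2_set_0 [simp]: "L2_set (\<lambda>i. 0) A = 0"
  by (simp add: L2_set_def)

lemma l2norm_single: "l2norm n (\<lambda>i. if i = k then x else 0) = (if k < n then cmod x else 0)"
proof -
  have "(\<Sum>i<n. (cmod (if i = k then x else 0))\<^sup>2) = (\<Sum>i<n. if i = k then (cmod x)\<^sup>2 else 0)"
    by (intro sum.cong) auto
  then show ?thesis by (simp add: L2_set_def)
qed

lemma l2norm_Suc_0 [simp]: "l2norm (Suc 0) z = cmod (z 0)"
  by (simp add: lessThan_Suc)

lemma l2norm_component: "k < n \<Longrightarrow> cmod (z k) \<le> l2norm n z"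
  by (rule member_le_L2_set) auto

lemma cmod_sum_mult_le: "cmod (\<Sum>j<q. a j * z j) \<le> l2norm q a * l2norm q z"
proof -
  have "cmod (\<Sum>j<q. a j * z j) \<le> (\<Sum>j<q. \<bar>cmod (a j)\<bar> * \<bar>cmod (z j)\<bar>)"
    by (rule order_trans[OF norm_sum]) (simp add: norm_mult)
  also have "\<dots> \<le> l2norm q a * l2norm q z"
    by (rule L2_set_mult_ineq)
  finally show ?thesis .
qed

text \<open>This crude bound shows that the suprema in \<open>mat_op_norm\<close> and
  \<open>sup_norm\<close> run over bounded sets, and later turns entrywise smallness into smallness
  of the matrix norm.\<close>

lemma l2norm_mat_vec_le_sum:
  "l2norm p (mat_vec q m z) \<le> (\<Sum>i<p. \<Sum>j<q. cmod (m i j)) * l2norm q z"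
proof -
  have "l2norm p (mat_vec q m z) \<le> (\<Sum>i<p. cmod (mat_vec q m z i))"
    by (rule L2_set_le_sum) simp
  also have "\<dots> \<le> (\<Sum>i<p. (\<Sum>j<q. cmod (m i j)) * l2norm q z)"
  proof (rule sum_mono)
    fix i
    have "cmod (mat_vec q m z i) \<le> l2norm q (m i) * l2norm q z"
      by (rule cmod_sum_mult_le)
    also have "\<dots> \<le> (\<Sum>j<q. cmod (m i j)) * l2norm q z"
      by (intro mult_right_mono L2_set_le_sum) auto
    finally show "cmod (mat_vec q m z i) \<le> (\<Sum>j<q. cmod (m i j)) * l2norm q z" .
  qed
  finally show ?thesis by (simp add: sum_distrib_right)
qed

lemma mat_op_norm_le:
  assumes "0 \<le> c" and "\<And>z. l2norm p (mat_vec q m z) \<le> c * l2norm q z"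
  shows "mat_op_norm p q m \<le> c"
  unfolding mat_op_norm_def
proof (rule cSup_least)
  show "{l2norm p (mat_vec q m z) | z. l2norm q z \<le> 1} \<noteq> {}"
    by (auto intro!: exI[of _ "\<lambda>_. 0"])
  fix x assume "x \<in> {l2norm p (mat_vec q m z) | z. l2norm q z \<le> 1}"
  then obtain z where "x = l2norm p (mat_vec q m z)" "l2norm q z \<le> 1" by auto
  then show "x \<le> c"
    using assms(2)[of z] mult_left_le[of "l2norm q z" c] assms(1) by linarith
qed

lemma mat_op_norm_bdd: "bdd_above {l2norm p (mat_vec q m z) | z. l2norm q z \<le> 1}"
proof (rule bdd_aboveI)
  fix x assume "x \<in> {l2norm p (mat_vec q m z) | z. l2norm q z \<le> 1}"
  then obtain z where z: "x = l2norm p (mat_vec q m z)" "l2norm q z \<le> 1" by auto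
  have "x \<le> (\<Sum>i<p. \<Sum>j<q. cmod (m i j)) * l2norm q z"
    unfolding z by (rule l2norm_mat_vec_le_sum)
  also have "\<dots> \<le> (\<Sum>i<p. \<Sum>j<q. cmod (m i j))"
    using z by (simp add: mult_left_le sum_nonneg)
  finally show "x \<le> (\<Sum>i<p. \<Sum>j<q. cmod (m i j))" .
qed

lemma mat_op_norm_nonneg: "0 \<le> mat_op_norm p q m"
  unfolding mat_op_norm_def
  by (rule cSup_upper[OF _ mat_op_norm_bdd]) (auto intro!: exI[of _ "\<lambda>_. 0"])

lemma mat_op_norm_apply: "l2norm p (mat_vec q m z) \<le> mat_op_norm p q m * l2norm q z"
proof (cases "l2norm q z = 0")
  case True
  then have "\<forall>j<q. z j = 0" by (simp add: L2_set_eq_0_iff)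
  with True show ?thesis by simp
next
  case False
  define t where "t = l2norm q z"
  have t: "t > 0" using False by (metis L2_set_nonneg less_eq_real_def t_def)
  \<comment> \<open>The supremum only tests vectors of norm at most 1, so \<open>z\<close> is
    normalised.\<close>
  define y where "y j = complex_of_real (1 / t) * z j" for j
  have y: "l2norm q y = 1"
    unfolding y_def using t by (subst l2norm_scale) (simp add: norm_divide flip: t_def)
  have "mat_vec q m y i = complex_of_real (1 / t) * mat_vec q m z i" for i
    by (simp add: y_def sum_distrib_left ac_simps)
  then have "l2norm p (mat_vec q m y) = l2norm p (mat_vec q m z) / t"
    using t l2norm_scale[where n = p and c = "complex_of_real (1 / t)" and x = "mat_vec q m z"]
    by (simp only: norm_of_real) simp
  moreover have "l2norm p (mat_vec q m y) \<le> mat_op_norm p q m"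
    unfolding mat_op_norm_def using y by (intro cSup_upper[OF _ mat_op_norm_bdd]) force
  ultimately show ?thesis
    using t unfolding t_def[symmetric] by (simp only: pos_divide_le_eq)
qed

section \<open>Supremum norms of matrices of functions\<close>

type_synonym 'w cmat = "nat \<Rightarrow> nat \<Rightarrow> 'w \<Rightarrow>\<^sub>C complex"

text \<open>The matrix norm of every \<open>fun_module\<close>; it does not depend on the chosen
  subspace of functions.\<close>

definition sup_norm :: "nat \<Rightarrow> nat \<Rightarrow> 'w::topological_space cmat \<Rightarrow> real" where
  "sup_norm p q M = (SUP w. mat_op_norm p q (\<lambda>i j. apply_bcontfun (M i j) w))"

abbreviation eval_vec ::
  "nat \<Rightarrow> 'w::topological_space cmat \<Rightarrow> 'w \<Rightarrow> (nat \<Rightarrow> complex) \<Rightarrow> nat \<Rightarrow> complex" where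
  "eval_vec q M w \<equiv> mat_vec q (\<lambda>i j. apply_bcontfun (M i j) w)"

lemma mnorm_fun_module [simp]: "mnorm (fun_module X) p q M = sup_norm p q M"
  by (simp add: fun_module_def sup_norm_def)

lemma fun_module_simps [simp]:
  "pts (fun_module X) = X" "vzero (fun_module X) = 0" "vplus (fun_module X) = (+)"
  "vscale (fun_module X) c f = const_bcontfun c * f" "vact (fun_module X) = (*)"
  by (simp_all add: fun_module_def)

text \<open>Together with \<open>sup_norm_apply\<close> this characterises \<open>sup_norm\<close>
  as the least nonnegative constant in the pointwise operator bounds. Most later norm estimates go
  through these two facts instead of the nested suprema.\<close>

lemma sup_norm_le:
  assumes "0 \<le> c" and "\<And>w z. l2norm p (eval_vec q M w z) \<le> c * l2norm q z"
  shows "sup_norm p q M \<le> c"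
  unfolding sup_norm_def by (intro cSUP_least mat_op_norm_le assms) auto

lemma sup_norm_bdd: "bdd_above (range (\<lambda>w. mat_op_norm p q (\<lambda>i j. apply_bcontfun (M i j) w)))"
proof (rule bdd_aboveI)
  fix x assume "x \<in> range (\<lambda>w. mat_op_norm p q (\<lambda>i j. apply_bcontfun (M i j) w))"
  then obtain w where x: "x = mat_op_norm p q (\<lambda>i j. apply_bcontfun (M i j) w)" by auto
  show "x \<le> (\<Sum>i<p. \<Sum>j<q. norm (M i j))"
    unfolding x
  proof (intro mat_op_norm_le order_trans[OF l2norm_mat_vec_le_sum] mult_right_mono sum_mono)
    show "0 \<le> (\<Sum>i<p. \<Sum>j<q. norm (M i j))" by (intro sum_nonneg) simp
  qed (auto intro: norm_bounded)
qed

lemma mat_op_norm_le_sup_norm: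
  "mat_op_norm p q (\<lambda>i j. apply_bcontfun (M i j) w) \<le> sup_norm p q M"
  unfolding sup_norm_def by (rule cSUP_upper[OF _ sup_norm_bdd]) simp

lemma sup_norm_nonneg [simp]: "0 \<le> sup_norm p q M"
  using mat_op_norm_le_sup_norm mat_op_norm_nonneg order_trans by blast

lemma sup_norm_apply: "l2norm p (eval_vec q M w z) \<le> sup_norm p q M * l2norm q z"
  by (rule order_trans[OF mat_op_norm_apply mult_right_mono[OF mat_op_norm_le_sup_norm]]) simp

lemma sup_norm_cong:
  assumes "\<And>i j. i < p \<Longrightarrow> j < q \<Longrightarrow> M i j = N i j"
  shows "sup_norm p q M = sup_norm p q N"
proof -
  have *: "sup_norm p q M \<le> sup_norm p q N"
    if eq: "\<And>i j. i < p \<Longrightarrow> j < q \<Longrightarrow> M i j = N i j" for M N :: "'a cmat"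
  proof (rule sup_norm_le)
    fix w and z :: "nat \<Rightarrow> complex"
    have "l2norm p (eval_vec q M w z) = l2norm p (eval_vec q N w z)"
      by (intro L2_set_cong) (simp_all add: eq)
    then show "l2norm p (eval_vec q M w z) \<le> sup_norm p q N * l2norm q z"
      by (simp add: sup_norm_apply)
  qed simp
  show ?thesis using assms by (intro antisym *) auto
qed

lemma sup_norm_add: "sup_norm p q (\<lambda>i j. M i j + N i j) \<le> sup_norm p q M + sup_norm p q N"
proof (rule sup_norm_le)
  fix w and z :: "nat \<Rightarrow> complex"
  have "l2norm p (eval_vec q (\<lambda>i j. M i j + N i j) w z)
      = l2norm p (\<lambda>i. eval_vec q M w z i + eval_vec q N w z i)"
    by (simp add: distrib_right sum.distrib)
  also have "\<dots> \<le> sup_norm p q M * l2norm q z + sup_norm p q N * l2norm q z"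
    by (intro order_trans[OF l2norm_triangle] add_mono sup_norm_apply)
  finally show "l2norm p (eval_vec q (\<lambda>i j. M i j + N i j) w z)
      \<le> (sup_norm p q M + sup_norm p q N) * l2norm q z"
    by (simp add: distrib_right)
qed simp

lemma sup_norm_le_sum: "sup_norm p q M \<le> (\<Sum>i<p. \<Sum>j<q. norm (M i j))"
proof (intro sup_norm_le order_trans[OF l2norm_mat_vec_le_sum] mult_right_mono sum_mono)
  show "0 \<le> (\<Sum>i<p. \<Sum>j<q. norm (M i j))" by (intro sum_nonneg) simp
qed (auto intro: norm_bounded)

lemma norm_le_sup_norm:
  assumes "i < p" "j < q"
  shows "norm (M i j) \<le> sup_norm p q M"
proof (rule norm_bound)
  fix w
  \<comment> \<open>The standard basis vector \<open>j\<close> extracts column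
    \<open>j\<close>.\<close>
  let ?z = "\<lambda>k. if k = j then 1 else 0 :: complex"
  have "eval_vec q M w ?z i = M i j w"
    using assms by (simp add: if_distrib[of "\<lambda>c. _ * c"] cong: if_cong)
  then have "cmod (M i j w) \<le> l2norm p (eval_vec q M w ?z)"
    using l2norm_component[OF assms(1), of "eval_vec q M w ?z"] by simp
  also have "\<dots> \<le> sup_norm p q M"
    using sup_norm_apply[where p = p and q = q and M = M and w = w and z = ?z] assms by (simp add: l2norm_single)
  finally show "cmod (M i j w) \<le> sup_norm p q M" .
qed

lemma sup_norm_1_1: "sup_norm 1 1 M = norm (M 0 0)"
  using sup_norm_le_sum[where p = 1 and q = 1 and M = M] norm_le_sup_norm[where p = 1 and q = 1 and M = M and i = 0 and j = 0] by simp

lemma norm_times_bcontfun_le: "norm (f * g) \<le> norm f * norm g"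
  for f g :: "'w::topological_space \<Rightarrow>\<^sub>C complex"
  by (rule norm_bound) (auto simp: norm_mult intro!: mult_mono norm_bounded)

lemma sup_norm_times: "sup_norm p q (\<lambda>i j. a * M i j) \<le> norm a * sup_norm p q M"
proof (rule sup_norm_le)
  fix w and z :: "nat \<Rightarrow> complex"
  have "l2norm p (eval_vec q (\<lambda>i j. a * M i j) w z) = l2norm p (\<lambda>i. a w * eval_vec q M w z i)"
    by (simp add: sum_distrib_left ac_simps)
  also have "\<dots> = cmod (a w) * l2norm p (eval_vec q M w z)"
    by (rule l2norm_scale)
  also have "\<dots> \<le> norm a * (sup_norm p q M * l2norm q z)"
    by (intro mult_mono sup_norm_apply norm_bounded) auto
  finally show "l2norm p (eval_vec q (\<lambda>i j. a * M i j) w z) \<le> norm a * sup_norm p q M * l2norm q z"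
    by (simp add: ac_simps)
qed simp

text \<open>At each point the product matrix is a composition of operators, so the norms multiply.
  This is the source of the complete contractivity of multiplication for the Haagerup norm.\<close>

lemma sup_norm_mult:
  "sup_norm p q (\<lambda>i j. \<Sum>k<r. x i k * y k j) \<le> sup_norm p r x * sup_norm r q y"
proof (rule sup_norm_le)
  fix w and z :: "nat \<Rightarrow> complex"
  have "eval_vec q (\<lambda>i j. \<Sum>k<r. x i k * y k j) w z i = eval_vec r x w (eval_vec q y w z) i" for i
  proof -
    have "apply_bcontfun (\<Sum>k<r. x i k * y k j) w = (\<Sum>k<r. x i k w * y k j w)" for j
      by (induction r) auto
    then show ?thesis
      by (simp add: sum_distrib_left sum_distrib_right mult.assoc sum.swap[of _ "{..<q}" "{..<r}"])
  qed
  then have "l2norm p (eval_vec q (\<lambda>i j. \<Sum>k<r. x i k * y k j) w z)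
      = l2norm p (eval_vec r x w (eval_vec q y w z))" by simp
  also have "\<dots> \<le> sup_norm p r x * (sup_norm r q y * l2norm q z)"
    by (rule order_trans[OF sup_norm_apply]) (intro mult_left_mono sup_norm_apply, simp)
  finally show "l2norm p (eval_vec q (\<lambda>i j. \<Sum>k<r. x i k * y k j) w z)
      \<le> sup_norm p r x * sup_norm r q y * l2norm q z" by (simp add: ac_simps)
qed simp

section \<open>Block rows, block columns and single entries\<close>

lemma sum_lessThan_split: "(\<Sum>k<r + s. h k) = (\<Sum>k<r. h k) + (\<Sum>k<s. h (r + k))"
  for h :: "nat \<Rightarrow> 'a::comm_monoid_add"
  by (induction s) (simp_all add: add.assoc)

text \<open>A block row sends a vector with parts \<open>z\<close>, \<open>z'\<close> to the sum of
  the two images, and Cauchy-Schwarz in the plane yields the square root of the sum of squares.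
  Squares are used because they add, which later gives the triangle inequality of the Haagerup
  norm.\<close>

lemma sup_norm_row_concat:
  assumes "(sup_norm p r x)\<^sup>2 \<le> s" and "(sup_norm p r' x')\<^sup>2 \<le> s'"
  shows "(sup_norm p (r + r') (\<lambda>i k. if k < r then x i k else x' i (k - r)))\<^sup>2 \<le> s + s'"
proof -
  let ?a = "sup_norm p r x" and ?b = "sup_norm p r' x'"
  have "sup_norm p (r + r') (\<lambda>i k. if k < r then x i k else x' i (k - r)) \<le> sqrt (?a\<^sup>2 + ?b\<^sup>2)"
  proof (rule sup_norm_le)
    fix w and z :: "nat \<Rightarrow> complex"
    let ?z' = "\<lambda>k. z (r + k)"
    let ?M = "\<lambda>i k. if k < r then x i k else x' i (k - r)"
    have "eval_vec (r + r') ?M w z i = eval_vec r x w z i + eval_vec r' x' w ?z' i" for i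
      by (simp add: sum_lessThan_split cong: sum.cong_simp)
    then have "l2norm p (eval_vec (r + r') ?M w z) \<le> ?a * l2norm r z + ?b * l2norm r' ?z'"
      by (simp only:) (intro order_trans[OF l2norm_triangle] add_mono sup_norm_apply)
    also have "\<dots> \<le> sqrt (?a\<^sup>2 + ?b\<^sup>2) * sqrt ((l2norm r z)\<^sup>2 + (l2norm r' ?z')\<^sup>2)"
    proof -
      \<comment> \<open>The difference of the two sides of Cauchy-Schwarz in the plane is exactly
        this square.\<close>
      have "0 \<le> (?a * l2norm r' ?z' - ?b * l2norm r z)\<^sup>2" by simp
      then have "(?a * l2norm r z + ?b * l2norm r' ?z')\<^sup>2
          \<le> (?a\<^sup>2 + ?b\<^sup>2) * ((l2norm r z)\<^sup>2 + (l2norm r' ?z')\<^sup>2)"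
        by (simp add: power2_eq_square algebra_simps)
      then show ?thesis
        by (simp add: real_le_rsqrt flip: real_sqrt_mult)
    qed
    also have "(l2norm r z)\<^sup>2 + (l2norm r' ?z')\<^sup>2 = (l2norm (r + r') z)\<^sup>2"
      by (simp only: l2norm_power2 sum_lessThan_split)
    finally show "l2norm p (eval_vec (r + r') ?M w z) \<le> sqrt (?a\<^sup>2 + ?b\<^sup>2) * l2norm (r + r') z"
      by simp
  qed simp
  then have "(sup_norm p (r + r') (\<lambda>i k. if k < r then x i k else x' i (k - r)))\<^sup>2
      \<le> (sqrt (?a\<^sup>2 + ?b\<^sup>2))\<^sup>2"
    by (intro power_mono) auto
  with assms show ?thesis by simp
qed

text \<open>The two stacked images are orthogonal, so Pythagoras replaces Cauchy-Schwarz.\<close>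

lemma sup_norm_col_concat:
  assumes "(sup_norm r q y)\<^sup>2 \<le> s" and "(sup_norm r' q y')\<^sup>2 \<le> s'"
  shows "(sup_norm (r + r') q (\<lambda>k j. if k < r then y k j else y' (k - r) j))\<^sup>2 \<le> s + s'"
proof -
  let ?a = "sup_norm r q y" and ?b = "sup_norm r' q y'"
  have "sup_norm (r + r') q (\<lambda>k j. if k < r then y k j else y' (k - r) j) \<le> sqrt (?a\<^sup>2 + ?b\<^sup>2)"
  proof (rule sup_norm_le)
    fix w and z :: "nat \<Rightarrow> complex"
    let ?M = "\<lambda>k j. if k < r then y k j else y' (k - r) j"
    have "(l2norm (r + r') (eval_vec q ?M w z))\<^sup>2
        = (l2norm r (eval_vec q y w z))\<^sup>2 + (l2norm r' (eval_vec q y' w z))\<^sup>2"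
      unfolding l2norm_power2 by (simp add: sum_lessThan_split cong: sum.cong_simp)
    also have "\<dots> \<le> (?a * l2norm q z)\<^sup>2 + (?b * l2norm q z)\<^sup>2"
      by (intro add_mono power_mono sup_norm_apply) auto
    also have "\<dots> = (sqrt (?a\<^sup>2 + ?b\<^sup>2) * l2norm q z)\<^sup>2"
      by (simp add: power_mult_distrib distrib_right)
    finally show "l2norm (r + r') (eval_vec q ?M w z) \<le> sqrt (?a\<^sup>2 + ?b\<^sup>2) * l2norm q z"
      by (rule power2_le_imp_le) simp
  qed simp
  then have "(sup_norm (r + r') q (\<lambda>k j. if k < r then y k j else y' (k - r) j))\<^sup>2
      \<le> (sqrt (?a\<^sup>2 + ?b\<^sup>2))\<^sup>2"
    by (intro power_mono) auto
  with assms show ?thesis by simp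
qed

text \<open>With \<open>sup_norm_pad_col\<close>, this turns a factorisation of a single tensor into
  one of a matrix with one nonzero entry.\<close>

lemma sup_norm_pad_row:
  "sup_norm p r (\<lambda>i k. if i = i0 then x 0 k else 0) \<le> sup_norm 1 r x"
proof (rule sup_norm_le)
  fix w and z :: "nat \<Rightarrow> complex"
  have "eval_vec r (\<lambda>i k. if i = i0 then x 0 k else 0) w z i
      = (if i = i0 then eval_vec r x w z 0 else 0)" for i
    by simp
  then have "l2norm p (eval_vec r (\<lambda>i k. if i = i0 then x 0 k else 0) w z)
      \<le> l2norm 1 (eval_vec r x w z)"
    by (simp only: l2norm_single) simp
  then show "l2norm p (eval_vec r (\<lambda>i k. if i = i0 then x 0 k else 0) w z)
      \<le> sup_norm 1 r x * l2norm r z"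
    using sup_norm_apply order_trans by blast
qed simp

lemma sup_norm_pad_col:
  "sup_norm r q (\<lambda>k j. if j = j0 then y k 0 else 0) \<le> sup_norm r 1 y"
proof (rule sup_norm_le)
  fix w and z :: "nat \<Rightarrow> complex"
  \<comment> \<open>If \<open>j0\<close> is not among the first \<open>q\<close> columns, the padded
    matrix acts as zero, hence the default \<open>0\<close>.\<close>
  let ?z = "\<lambda>_::nat. if j0 < q then z j0 else 0"
  have "eval_vec q (\<lambda>k j. if j = j0 then y k 0 else 0) w z k = eval_vec 1 y w ?z k" for k
    by (simp add: if_distrib[of "\<lambda>f. apply_bcontfun f w"] if_distrib[of "\<lambda>c. c * _"] cong: if_cong)
  then have "l2norm r (eval_vec q (\<lambda>k j. if j = j0 then y k 0 else 0) w z)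
      \<le> sup_norm r 1 y * l2norm 1 ?z"
    by (simp only: sup_norm_apply)
  also have "\<dots> \<le> sup_norm r 1 y * l2norm q z"
    using l2norm_component[of j0 q z] by (intro mult_left_mono) (auto simp: L2_set_def sum_nonneg)
  finally show "l2norm r (eval_vec q (\<lambda>k j. if j = j0 then y k 0 else 0) w z)
      \<le> sup_norm r 1 y * l2norm q z" .
qed simp

text \<open>Row \<open>i\<close> of the left factor and column \<open>j\<close> of the right factor
  form a factorisation of entry \<open>(i, j)\<close>; with \<open>sup_norm_col\<close> this bounds
  an entry by its matrix in \<open>hnorm_entry\<close>.\<close>

lemma sup_norm_row:
  assumes "i < p"
  shows "sup_norm 1 r (\<lambda>_. x i) \<le> sup_norm p r x"
proof (rule sup_norm_le)
  fix w and z :: "nat \<Rightarrow> complex"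
  have "l2norm 1 (eval_vec r (\<lambda>_. x i) w z) = cmod (eval_vec r x w z i)"
    by simp
  also have "\<dots> \<le> l2norm p (eval_vec r x w z)"
    using assms by (rule l2norm_component)
  also have "\<dots> \<le> sup_norm p r x * l2norm r z" by (rule sup_norm_apply)
  finally show "l2norm 1 (eval_vec r (\<lambda>_. x i) w z) \<le> sup_norm p r x * l2norm r z" .
qed simp

lemma sup_norm_col:
  assumes "j < q"
  shows "sup_norm r 1 (\<lambda>k _. y k j) \<le> sup_norm r q y"
proof (rule sup_norm_le)
  fix w and z :: "nat \<Rightarrow> complex"
  let ?z = "\<lambda>k. if k = j then z 0 else 0 :: complex"
  have "eval_vec 1 (\<lambda>k _. y k j) w z k = eval_vec q y w ?z k" for k
    using assms by (simp add: if_distrib[of "\<lambda>c. _ * c"] cong: if_cong)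
  then have "l2norm r (eval_vec 1 (\<lambda>k _. y k j) w z) \<le> sup_norm r q y * l2norm q ?z"
    by (simp only: sup_norm_apply)
  also have "l2norm q ?z = l2norm 1 z"
    using assms by (simp add: l2norm_single)
  finally show "l2norm r (eval_vec 1 (\<lambda>k _. y k j) w z) \<le> sup_norm r q y * l2norm 1 z" .
qed simp

lemma tendsto_times_bcontfun:
  fixes a :: "'w::topological_space \<Rightarrow>\<^sub>C complex"
  assumes "s \<longlonglongrightarrow> g"
  shows "(\<lambda>n. a * s n) \<longlonglongrightarrow> a * g"
proof -
  have "(\<lambda>n. norm a * norm (s n - g)) \<longlonglongrightarrow> 0"
    using assms by (intro tendsto_mult_right_zero tendsto_norm_zero LIM_zero)
  then have "(\<lambda>n. a * s n - a * g) \<longlonglongrightarrow> 0"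
  proof (rule Lim_null_comparison[OF always_eventually, rotated])
    show "\<forall>n. norm (a * s n - a * g) \<le> norm a * norm (s n - g)"
      by (metis norm_times_bcontfun_le right_diff_distrib)
  qed
  then show ?thesis by (simp add: LIM_zero_iff)
qed

text \<open>The library proves completeness of this type only over metric spaces.\<close>

lemma Cauchy_bcontfun_convergent:
  fixes s :: "nat \<Rightarrow> 'w::topological_space \<Rightarrow>\<^sub>C complex"
  assumes "Cauchy s"
  shows "convergent s"
proof -
  have "uniformly_Cauchy_on UNIV (\<lambda>n. apply_bcontfun (s n))"
    unfolding uniformly_Cauchy_on_def
  proof (intro allI impI)
    fix e :: real assume "e > 0"
    then obtain N where "\<And>m n. m \<ge> N \<Longrightarrow> n \<ge> N \<Longrightarrow> dist (s m) (s n) < e"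
      using assms unfolding Cauchy_def by blast
    then show "\<exists>M. \<forall>x\<in>UNIV. \<forall>m\<ge>M. \<forall>n\<ge>M. dist (s m x) (s n x) < e"
      by (meson dist_fun_lt_imp_dist_val_lt)
  qed
  then obtain l where "uniform_limit UNIV (\<lambda>n. apply_bcontfun (s n)) l sequentially"
    using Cauchy_uniformly_convergent uniformly_convergent_on_def by blast
  then obtain g where "uniform_limit UNIV (\<lambda>n. apply_bcontfun (s n)) (apply_bcontfun g) sequentially"
    using uniform_limit_bcontfunE[of s l sequentially] by auto
  then show ?thesis
    using uniform_limit_tendsto_bcontfun convergentI by blast
qed

text \<open>The encoding \<open>k = i * n + j\<close> identifies the indices below
  \<open>m * n\<close> with pairs. Block factorisations and products of tuples both use it.\<close>

lemma sum_lessThan_mult: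
  "(\<Sum>k<m * n. g (k div n) (k mod n)) = (\<Sum>i<m. \<Sum>j<n. g i j)"
  for g :: "nat \<Rightarrow> nat \<Rightarrow> 'a::comm_monoid_add"
proof (induction m)
  case (Suc m)
  have "(\<Sum>k<m * n + n. g (k div n) (k mod n))
      = (\<Sum>k<m * n. g (k div n) (k mod n)) + (\<Sum>j<n. g m j)"
    by (simp add: sum_lessThan_split cong: sum.cong_simp)
  with Suc show ?case by (simp add: add.commute)
qed simp

section \<open>Modules presented by a group of representatives\<close>

text \<open>The points of the successive quotients and completions are nested sets. Each of these modules
  is handled through representatives in an ordinary abelian group, along a surjection \<open>\<pi>\<close> that
  is compatible with the operations.\<close>

locale presented =
  fixes A :: "'b set" and V :: "('b, 'v) op_module" and F :: "'f::ab_group_add set"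
    and sc :: "complex \<Rightarrow> 'f \<Rightarrow> 'f" and ac :: "'b \<Rightarrow> 'f \<Rightarrow> 'f" and \<pi> :: "'f \<Rightarrow> 'v"
  assumes pts_eq: "pts V = \<pi> ` F"
    and zero_in: "0 \<in> F" and zero_eq: "vzero V = \<pi> 0"
    and plus_in: "u \<in> F \<Longrightarrow> v \<in> F \<Longrightarrow> u + v \<in> F"
    and plus_eq: "u \<in> F \<Longrightarrow> v \<in> F \<Longrightarrow> vplus V (\<pi> u) (\<pi> v) = \<pi> (u + v)"
    and scale_in: "u \<in> F \<Longrightarrow> sc c u \<in> F"
    and scale_eq: "u \<in> F \<Longrightarrow> vscale V c (\<pi> u) = \<pi> (sc c u)"
    and scale_minus: "u \<in> F \<Longrightarrow> sc (-1) u = - u"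
    and scale_diff: "u \<in> F \<Longrightarrow> v \<in> F \<Longrightarrow> sc c (u - v) = sc c u - sc c v"
    and act_in: "a \<in> A \<Longrightarrow> u \<in> F \<Longrightarrow> ac a u \<in> F"
    and act_eq: "a \<in> A \<Longrightarrow> u \<in> F \<Longrightarrow> vact V a (\<pi> u) = \<pi> (ac a u)"
    and act_diff: "a \<in> A \<Longrightarrow> u \<in> F \<Longrightarrow> v \<in> F \<Longrightarrow> ac a (u - v) = ac a u - ac a v"
begin

lemma minus_in: "u \<in> F \<Longrightarrow> - u \<in> F"
  using scale_in[of u "-1"] by (simp add: scale_minus)

lemma diff_in: "u \<in> F \<Longrightarrow> v \<in> F \<Longrightarrow> u - v \<in> F"
  using plus_in[of u "- v"] minus_in[of v] by simp

lemma vminus_eq: "u \<in> F \<Longrightarrow> v \<in> F \<Longrightarrow> vminus V (\<pi> u) (\<pi> v) = \<pi> (u - v)"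
  by (simp add: vminus_def scale_eq scale_minus plus_eq minus_in)

lemma lin_subspace_0: "lin_subspace V N \<Longrightarrow> \<pi> 0 \<in> N"
  by (auto simp: lin_subspace_def zero_eq)

lemma lin_subspace_add:
  "lin_subspace V N \<Longrightarrow> u \<in> F \<Longrightarrow> v \<in> F \<Longrightarrow> \<pi> u \<in> N \<Longrightarrow> \<pi> v \<in> N \<Longrightarrow> \<pi> (u + v) \<in> N"
  unfolding lin_subspace_def by (metis plus_eq)

lemma lin_subspace_scale: "lin_subspace V N \<Longrightarrow> u \<in> F \<Longrightarrow> \<pi> u \<in> N \<Longrightarrow> \<pi> (sc c u) \<in> N"
  unfolding lin_subspace_def by (metis scale_eq)

lemma lin_subspace_minus: "lin_subspace V N \<Longrightarrow> u \<in> F \<Longrightarrow> \<pi> u \<in> N \<Longrightarrow> \<pi> (- u) \<in> N"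
  using lin_subspace_scale[of N u "-1"] by (simp add: scale_minus)

lemma vcoset_eq:
  assumes "u \<in> F"
  shows "vcoset V N (\<pi> u) = \<pi> ` {v \<in> F. \<pi> (v - u) \<in> N}"
  using assms by (auto simp: vcoset_def pts_eq vminus_eq)

lemma vcoset_eq_iff:
  assumes N: "lin_subspace V N" and u: "u \<in> F" and v: "v \<in> F"
  shows "vcoset V N (\<pi> u) = vcoset V N (\<pi> v) \<longleftrightarrow> \<pi> (u - v) \<in> N"
proof
  assume "vcoset V N (\<pi> u) = vcoset V N (\<pi> v)"
  moreover have "\<pi> u \<in> vcoset V N (\<pi> u)"
    using u lin_subspace_0[OF N] by (auto simp: vcoset_eq)
  ultimately have "\<pi> u \<in> vcoset V N (\<pi> v)" by simp
  then show "\<pi> (u - v) \<in> N"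
    using u v by (simp add: vcoset_def vminus_eq)
next
  have *: "vcoset V N (\<pi> u) \<subseteq> vcoset V N (\<pi> v)"
    if "\<pi> (u - v) \<in> N" and u: "u \<in> F" and v: "v \<in> F" for u v
  proof -
    have "\<pi> (x - v) \<in> N" if "x \<in> F" "\<pi> (x - u) \<in> N" for x
      using lin_subspace_add[OF N, of "x - u" "u - v"] that \<open>\<pi> (u - v) \<in> N\<close> u v
      by (simp add: diff_in)
    then show ?thesis using u v by (auto simp: vcoset_eq)
  qed
  assume 1: "\<pi> (u - v) \<in> N"
  then have "\<pi> (v - u) \<in> N"
    using lin_subspace_minus[OF N, of "u - v"] u v by (simp add: diff_in)
  with 1 show "vcoset V N (\<pi> u) = vcoset V N (\<pi> v)"
    using u v by (intro equalityI *)
qed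

text \<open>Each union in \<open>quot_module\<close> runs over a nonempty family whose members are
  all the same coset, because \<open>N\<close> is a subspace stable under the action. The unions
  therefore collapse, and the same group \<open>F\<close> presents the quotient.\<close>

lemma presented_quot:
  assumes N: "lin_subspace V N"
    and act: "\<And>a u. a \<in> A \<Longrightarrow> u \<in> F \<Longrightarrow> \<pi> u \<in> N \<Longrightarrow> \<pi> (ac a u) \<in> N"
  shows "presented A (quot_module V N) F sc ac (\<lambda>u. vcoset V N (\<pi> u))"
proof
  show "pts (quot_module V N) = (\<lambda>u. vcoset V N (\<pi> u)) ` F"
    by (auto simp: quot_module_def pts_eq)
  show "vzero (quot_module V N) = vcoset V N (\<pi> 0)"
    by (simp add: quot_module_def zero_eq)
  have self: "{v \<in> F. \<pi> (v - u) \<in> N} \<noteq> {}" if "u \<in> F" for u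
    using that lin_subspace_0[OF N] by auto
  note iff = vcoset_eq_iff[OF N]
  show "vplus (quot_module V N) (vcoset V N (\<pi> u)) (vcoset V N (\<pi> v)) = vcoset V N (\<pi> (u + v))"
    if u: "u \<in> F" and v: "v \<in> F" for u v
  proof -
    have "vcoset V N (vplus V (\<pi> s) (\<pi> t)) = vcoset V N (\<pi> (u + v))"
      if "s \<in> F" "\<pi> (s - u) \<in> N" "t \<in> F" "\<pi> (t - v) \<in> N" for s t
      using lin_subspace_add[OF N, of "s - u" "t - v"] that u v
      by (simp add: plus_eq iff plus_in diff_in add_diff_add)
    then show ?thesis
      using self[OF u] self[OF v] u v
      by (simp add: quot_module_def vcoset_eq[OF u] vcoset_eq[OF v] SUP_eq_const) blast
  qed
  show "vscale (quot_module V N) c (vcoset V N (\<pi> u)) = vcoset V N (\<pi> (sc c u))"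
    if u: "u \<in> F" for c u
  proof -
    have "vcoset V N (vscale V c (\<pi> s)) = vcoset V N (\<pi> (sc c u))"
      if "s \<in> F" "\<pi> (s - u) \<in> N" for s
      using lin_subspace_scale[OF N, of "s - u" c] that u
      by (simp add: scale_eq iff scale_in diff_in scale_diff)
    then show ?thesis
      using self[OF u] u by (simp add: quot_module_def vcoset_eq[OF u] SUP_eq_const) blast
  qed
  show "vact (quot_module V N) a (vcoset V N (\<pi> u)) = vcoset V N (\<pi> (ac a u))"
    if a: "a \<in> A" and u: "u \<in> F" for a u
  proof -
    have "vcoset V N (vact V a (\<pi> s)) = vcoset V N (\<pi> (ac a u))"
      if "s \<in> F" "\<pi> (s - u) \<in> N" for s
      using act[OF a, of "s - u"] that u a
      by (simp add: act_eq iff act_in diff_in act_diff)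
    then show ?thesis
      using self[OF u] u by (simp add: quot_module_def vcoset_eq[OF u] SUP_eq_const) blast
  qed
qed (auto intro: zero_in plus_in scale_in scale_minus scale_diff act_in act_diff)

text \<open>The isomorphism is \<open>E\<close> on representatives: that \<open>E\<close> and
  \<open>\<pi>\<close> identify the same representatives gives both well-definedness and
  injectivity.\<close>

lemma completely_isometric_isoI:
  fixes E :: "'f \<Rightarrow> 'u" and W :: "('b, 'u) op_module"
  assumes "\<And>u v. u \<in> F \<Longrightarrow> v \<in> F \<Longrightarrow> E (u + v) = vplus W (E u) (E v)"
    and "\<And>c u. u \<in> F \<Longrightarrow> E (sc c u) = vscale W c (E u)"
    and "\<And>a u. a \<in> A \<Longrightarrow> u \<in> F \<Longrightarrow> E (ac a u) = vact W a (E u)"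
    and iff: "\<And>u v. u \<in> F \<Longrightarrow> v \<in> F \<Longrightarrow> \<pi> u = \<pi> v \<longleftrightarrow> E u = E v"
    and onto: "E ` F = pts W"
    and norm: "\<And>n M. mat_in F n n M \<Longrightarrow>
      mnorm W n n (\<lambda>i j. E (M i j)) = mnorm V n n (\<lambda>i j. \<pi> (M i j))"
    and local_V: "\<And>p q M M'. (\<And>i j. i < p \<Longrightarrow> j < q \<Longrightarrow> M i j = M' i j) \<Longrightarrow>
      mnorm V p q M = mnorm V p q M'"
    and local_W: "\<And>p q M M'. (\<And>i j. i < p \<Longrightarrow> j < q \<Longrightarrow> M i j = M' i j) \<Longrightarrow>
      mnorm W p q M = mnorm W p q M'"
  shows "completely_isometric_iso A V W"
proof -
  define r where "r = inv_into F \<pi>"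
  define T where "T x = E (r x)" for x
  have r: "r x \<in> F" "\<pi> (r x) = x" if "x \<in> pts V" for x
    using that unfolding r_def pts_eq by (auto intro: inv_into_into f_inv_into_f)
  have T: "T (\<pi> u) = E u" if "u \<in> F" for u
    unfolding T_def using r[of "\<pi> u"] that iff[of "r (\<pi> u)" u] by (simp add: pts_eq)
  show ?thesis
    unfolding completely_isometric_iso_def
  proof (intro exI conjI ballI allI impI)
    show "bij_betw T (pts V) (pts W)"
      unfolding bij_betw_def pts_eq inj_on_def by (auto simp: T iff image_image simp flip: onto)
    fix n M assume nM: "0 < n \<and> mat_in (pts V) n n M"
    have "mnorm W n n (\<lambda>i j. T (M i j)) = mnorm W n n (\<lambda>i j. E (r (M i j)))"
      by (simp add: T_def)
    also have "\<dots> = mnorm V n n (\<lambda>i j. \<pi> (r (M i j)))"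
      using nM r by (intro norm) (auto simp: mat_in_def)
    \<comment> \<open>Outside the \<open>n\<close> by \<open>n\<close> block the entries of
      \<open>M\<close> need not lie in \<open>pts V\<close>, where \<open>r\<close> need not invert
      \<open>\<pi>\<close>; only locality of the norm closes this gap.\<close>
    also have "\<dots> = mnorm V n n M"
      using nM r by (intro local_V) (auto simp: mat_in_def)
    finally show "mnorm W n n (\<lambda>i j. T (M i j)) = mnorm V n n M" .
  qed (auto simp: pts_eq T plus_eq plus_in scale_eq scale_in act_eq act_in assms(1-3))
qed

end

text \<open>These properties make the completion well behaved: subadditivity and domination by the
  entries make the matrix norms converge along Cauchy sequences, and the bounds on scaling and
  action let both pass to Cauchy classes.\<close>

locale seminormed_presented = presented A V F sc ac \<pi>
  for A :: "'b set" and V :: "('b, 'v) op_module" and F :: "'f::ab_group_add set" and sc ac \<pi> +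
  assumes mnorm_local: "(\<And>i j. i < p \<Longrightarrow> j < q \<Longrightarrow> m i j = m' i j) \<Longrightarrow> mnorm V p q m = mnorm V p q m'"
    and mnorm_add: "mat_in F p q M \<Longrightarrow> mat_in F p q M' \<Longrightarrow>
      mnorm V p q (\<lambda>i j. \<pi> (M i j + M' i j))
        \<le> mnorm V p q (\<lambda>i j. \<pi> (M i j)) + mnorm V p q (\<lambda>i j. \<pi> (M' i j))"
    and mnorm_le_sum: "mat_in F p q M \<Longrightarrow>
      mnorm V p q (\<lambda>i j. \<pi> (M i j)) \<le> (\<Sum>i<p. \<Sum>j<q. vnorm V (\<pi> (M i j)))"
    and vnorm_0: "vnorm V (\<pi> 0) = 0"
    and vnorm_scale: "u \<in> F \<Longrightarrow> vnorm V (\<pi> (sc c u)) \<le> cmod c * vnorm V (\<pi> u)"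
    and vnorm_act: "a \<in> A \<Longrightarrow> \<exists>C. \<forall>u\<in>F. vnorm V (\<pi> (ac a u)) \<le> C * vnorm V (\<pi> u)"
begin

abbreviation "nv u \<equiv> vnorm V (\<pi> u)"
abbreviation "nm p q M \<equiv> mnorm V p q (\<lambda>i j. \<pi> (M i j))"

lemma nv_add: "u \<in> F \<Longrightarrow> v \<in> F \<Longrightarrow> nv (u + v) \<le> nv u + nv v"
  using mnorm_add[of 1 1 "\<lambda>_ _. u" "\<lambda>_ _. v"] by (simp add: vnorm_def mat_in_def)

lemma nv_minus: assumes u: "u \<in> F" shows "nv (- u) = nv u"
proof (rule antisym)
  show "nv (- u) \<le> nv u"
    using vnorm_scale[OF u, of "-1"] u by (simp add: scale_minus)
  show "nv u \<le> nv (- u)"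
    using vnorm_scale[OF minus_in[OF u], of "-1"] u by (simp add: scale_minus minus_in)
qed

lemma nv_diff: "u \<in> F \<Longrightarrow> v \<in> F \<Longrightarrow> nv (u - v) \<le> nv u + nv v"
  using nv_add[of u "- v"] by (simp add: nv_minus minus_in)

lemma nv_minus_commute: "u \<in> F \<Longrightarrow> v \<in> F \<Longrightarrow> nv (u - v) = nv (v - u)"
  using nv_minus[of "u - v"] by (simp add: diff_in)

text \<open>Nonnegativity is not among the axioms of the locale; it comes from
  \<open>0 = nv (u - u)\<close> being at most twice \<open>nv u\<close>.\<close>

lemma nv_nonneg: "u \<in> F \<Longrightarrow> 0 \<le> nv u"
  using nv_diff[of u u] vnorm_0 by simp

text \<open>Lipschitz dependence on the entries is what carries entrywise convergence over to matrix
  norms.\<close>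

lemma nm_diff:
  assumes M: "mat_in F p q M" and M': "mat_in F p q M'"
  shows "\<bar>nm p q M - nm p q M'\<bar> \<le> (\<Sum>i<p. \<Sum>j<q. nv (M i j - M' i j))"
proof -
  have le: "nm p q M \<le> nm p q M' + (\<Sum>i<p. \<Sum>j<q. nv (M i j - M' i j))"
    if M: "mat_in F p q M" and M': "mat_in F p q M'" for M M'
  proof -
    have D: "mat_in F p q (\<lambda>i j. M i j - M' i j)"
      using M M' by (auto simp: mat_in_def diff_in)
    show ?thesis
      using mnorm_add[OF M' D] mnorm_le_sum[OF D] by simp
  qed
  have "(\<Sum>i<p. \<Sum>j<q. nv (M' i j - M i j)) = (\<Sum>i<p. \<Sum>j<q. nv (M i j - M' i j))"
    using M M' by (intro sum.cong) (auto simp: mat_in_def nv_minus_commute)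
  then show ?thesis
    using le[OF M M'] le[OF M' M] by linarith
qed

section \<open>Completions through Cauchy sequences of representatives\<close>

definition Cauchy_reps :: "(nat \<Rightarrow> 'f) set" where
  "Cauchy_reps = {s. (\<forall>n. s n \<in> F) \<and> (\<forall>e>0. \<exists>N. \<forall>m\<ge>N. \<forall>n\<ge>N. nv (s m - s n) < e)}"

definition lim_class :: "(nat \<Rightarrow> 'f) \<Rightarrow> (nat \<Rightarrow> 'v) set" where
  "lim_class s = cauchy_class V (\<lambda>n. \<pi> (s n))"

lemma Cauchy_reps_in: "s \<in> Cauchy_reps \<Longrightarrow> s n \<in> F"
  by (simp add: Cauchy_reps_def)

lemma Cauchy_reps_lipschitz:
  assumes s: "s \<in> Cauchy_reps" and t: "\<And>n. t n \<in> F" and "C \<ge> 0"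
    and le: "\<And>m n. nv (t m - t n) \<le> C * nv (s m - s n)"
  shows "t \<in> Cauchy_reps"
  unfolding Cauchy_reps_def
proof (intro CollectI conjI allI impI t)
  fix e :: real assume "e > 0"
  \<comment> \<open>Dividing by \<open>C + 1\<close> covers the case \<open>C = 0\<close>.\<close>
  then have "e / (C + 1) > 0" using \<open>C \<ge> 0\<close> by simp
  then obtain N where N: "\<And>m n. m \<ge> N \<Longrightarrow> n \<ge> N \<Longrightarrow> nv (s m - s n) < e / (C + 1)"
    using s unfolding Cauchy_reps_def by blast
  have "nv (t m - t n) < e" if "m \<ge> N" "n \<ge> N" for m n
  proof -
    have "nv (t m - t n) \<le> (C + 1) * nv (s m - s n)"
      using le[of m n] nv_nonneg[of "s m - s n"] s by (simp add: distrib_right Cauchy_reps_in diff_in)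
    also have "\<dots> < (C + 1) * (e / (C + 1))"
      using N[OF that] \<open>C \<ge> 0\<close> by (intro mult_strict_left_mono) auto
    finally show ?thesis using \<open>C \<ge> 0\<close> by simp
  qed
  then show "\<exists>N. \<forall>m\<ge>N. \<forall>n\<ge>N. nv (t m - t n) < e" by blast
qed

lemma Cauchy_reps_add:
  assumes s: "s \<in> Cauchy_reps" and t: "t \<in> Cauchy_reps"
  shows "(\<lambda>n. s n + t n) \<in> Cauchy_reps"
  unfolding Cauchy_reps_def
proof (intro CollectI conjI allI impI)
  show "s n + t n \<in> F" for n using s t by (simp add: Cauchy_reps_in plus_in)
  fix e :: real assume "e > 0"
  then have e2: "e / 2 > 0" by simp
  obtain N where N: "\<And>m n. m \<ge> N \<Longrightarrow> n \<ge> N \<Longrightarrow> nv (s m - s n) < e / 2"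
    using s e2 unfolding Cauchy_reps_def by blast
  obtain N' where N': "\<And>m n. m \<ge> N' \<Longrightarrow> n \<ge> N' \<Longrightarrow> nv (t m - t n) < e / 2"
    using t e2 unfolding Cauchy_reps_def by blast
  have "nv ((s m + t m) - (s n + t n)) < e" if "m \<ge> max N N'" "n \<ge> max N N'" for m n
    using nv_add[of "s m - s n" "t m - t n"] N[of m n] N'[of m n] that s t
    by (simp add: Cauchy_reps_in diff_in add_diff_add)
  then show "\<exists>N. \<forall>m\<ge>N. \<forall>n\<ge>N. nv ((s m + t m) - (s n + t n)) < e" by blast
qed

lemma Cauchy_reps_const: "u \<in> F \<Longrightarrow> (\<lambda>_. u) \<in> Cauchy_reps"
  by (simp add: Cauchy_reps_def vnorm_0)

lemma Cauchy_reps_scale: "s \<in> Cauchy_reps \<Longrightarrow> (\<lambda>n. sc c (s n)) \<in> Cauchy_reps"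
  by (rule Cauchy_reps_lipschitz[where C = "cmod c" and s = s])
    (auto simp: Cauchy_reps_in scale_in diff_in intro: vnorm_scale simp flip: scale_diff)

lemma vnorm_act_nonneg:
  assumes "a \<in> A"
  obtains C where "C \<ge> 0" and "\<And>u. u \<in> F \<Longrightarrow> nv (ac a u) \<le> C * nv u"
proof -
  obtain C where C: "\<And>u. u \<in> F \<Longrightarrow> nv (ac a u) \<le> C * nv u"
    using vnorm_act[OF assms] by blast
  have "nv (ac a u) \<le> \<bar>C\<bar> * nv u" if "u \<in> F" for u
    using C[OF that] mult_right_mono[OF abs_ge_self nv_nonneg[OF that], of C] by linarith
  then show ?thesis using that[of "\<bar>C\<bar>"] by auto
qed

lemma Cauchy_reps_act:
  assumes s: "s \<in> Cauchy_reps" and a: "a \<in> A" shows "(\<lambda>n. ac a (s n)) \<in> Cauchy_reps"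
proof -
  obtain C where C: "C \<ge> 0" "\<And>u. u \<in> F \<Longrightarrow> nv (ac a u) \<le> C * nv u"
    using vnorm_act_nonneg[OF a] by blast
  show ?thesis
    by (rule Cauchy_reps_lipschitz[OF s _ C(1)])
      (auto simp: Cauchy_reps_in[OF s] act_in a diff_in C simp flip: act_diff)
qed

lemma cauchy_seqs_eq: "cauchy_seqs V = (\<lambda>s n. \<pi> (s n)) ` Cauchy_reps"
proof (intro equalityI subsetI)
  fix x assume x: "x \<in> cauchy_seqs V"
  then have "\<forall>n. \<exists>u. u \<in> F \<and> x n = \<pi> u" by (auto simp: cauchy_seqs_def pts_eq)
  then obtain s where s: "\<And>n. s n \<in> F" "\<And>n. x n = \<pi> (s n)" by metis
  then have "x = (\<lambda>n. \<pi> (s n))" by auto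
  moreover have "s \<in> Cauchy_reps"
    using x s by (simp add: cauchy_seqs_def Cauchy_reps_def vminus_eq)
  ultimately show "x \<in> (\<lambda>s n. \<pi> (s n)) ` Cauchy_reps" by blast
qed (auto simp: cauchy_seqs_def Cauchy_reps_def vminus_eq pts_eq)

lemma lim_class_eq:
  assumes "s \<in> Cauchy_reps"
  shows "lim_class s = (\<lambda>t n. \<pi> (t n)) ` {t \<in> Cauchy_reps. (\<lambda>n. nv (t n - s n)) \<longlonglongrightarrow> 0}"
  using assms by (auto simp: lim_class_def cauchy_class_def cauchy_seqs_eq vminus_eq Cauchy_reps_in)

lemma nv_tendsto_0_le:
  assumes "f \<longlonglongrightarrow> 0" and "\<And>n. u n \<in> F" and "\<And>n. nv (u n) \<le> f n"
  shows "(\<lambda>n. nv (u n)) \<longlonglongrightarrow> 0"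
  using assms(1) by (rule Lim_null_comparison[rotated]) (auto simp: assms nv_nonneg)

lemma lim_class_eq_iff:
  assumes s: "s \<in> Cauchy_reps" and t: "t \<in> Cauchy_reps"
  shows "lim_class s = lim_class t \<longleftrightarrow> (\<lambda>n. nv (s n - t n)) \<longlonglongrightarrow> 0"
proof
  assume "lim_class s = lim_class t"
  moreover have "(\<lambda>n. \<pi> (s n)) \<in> lim_class s"
    using s by (auto simp: lim_class_eq vnorm_0)
  ultimately have "(\<lambda>n. \<pi> (s n)) \<in> lim_class t" by simp
  then show "(\<lambda>n. nv (s n - t n)) \<longlonglongrightarrow> 0"
    using s t by (simp add: lim_class_def cauchy_class_def vminus_eq Cauchy_reps_in)
next
  have *: "lim_class s \<subseteq> lim_class t"
    if s: "s \<in> Cauchy_reps" and t: "t \<in> Cauchy_reps" and st: "(\<lambda>n. nv (s n - t n)) \<longlonglongrightarrow> 0" for s t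
  proof -
    have "(\<lambda>n. nv (x n - t n)) \<longlonglongrightarrow> 0" if x: "x \<in> Cauchy_reps" and xs: "(\<lambda>n. nv (x n - s n)) \<longlonglongrightarrow> 0" for x
    proof (rule nv_tendsto_0_le)
      show "(\<lambda>n. nv (x n - s n) + nv (s n - t n)) \<longlonglongrightarrow> 0"
        using tendsto_add[OF xs st] by simp
      show "nv (x n - t n) \<le> nv (x n - s n) + nv (s n - t n)" for n
        using nv_add[of "x n - s n" "s n - t n"] x s t by (simp add: Cauchy_reps_in diff_in)
    qed (use x t in \<open>auto simp: Cauchy_reps_in diff_in\<close>)
    then show ?thesis using s t by (auto simp: lim_class_eq)
  qed
  assume 1: "(\<lambda>n. nv (s n - t n)) \<longlonglongrightarrow> 0"
  then have "(\<lambda>n. nv (t n - s n)) \<longlonglongrightarrow> 0"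
    using s t by (simp add: nv_minus_commute Cauchy_reps_in)
  with 1 show "lim_class s = lim_class t"
    using s t by (intro equalityI *)
qed

text \<open>As for quotients, the unions in \<open>completion\<close> collapse: changing a
  representing sequence by a null sequence changes sums, multiples and actions by null
  sequences.\<close>

lemma presented_completion:
  "presented A (completion V) Cauchy_reps (\<lambda>c s n. sc c (s n)) (\<lambda>a s n. ac a (s n)) lim_class"
proof
  show "pts (completion V) = lim_class ` Cauchy_reps"
    by (simp add: completion_def cauchy_seqs_eq image_image lim_class_def)
  show "0 \<in> Cauchy_reps"
    using Cauchy_reps_const[OF zero_in] by (simp add: zero_fun_def)
  show "vzero (completion V) = lim_class 0"
    by (simp add: completion_def lim_class_def zero_eq zero_fun_def)
  have ne: "{t \<in> Cauchy_reps. (\<lambda>n. nv (t n - s n)) \<longlonglongrightarrow> 0} \<noteq> {}" if "s \<in> Cauchy_reps" for s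
    using that vnorm_0 by auto
  show "vplus (completion V) (lim_class s) (lim_class t) = lim_class (s + t)"
    if s: "s \<in> Cauchy_reps" and t: "t \<in> Cauchy_reps" for s t
  proof -
    have "cauchy_class V (\<lambda>n. vplus V (\<pi> (x n)) (\<pi> (y n))) = lim_class (\<lambda>n. s n + t n)"
      if x: "x \<in> Cauchy_reps" "(\<lambda>n. nv (x n - s n)) \<longlonglongrightarrow> 0"
        and y: "y \<in> Cauchy_reps" "(\<lambda>n. nv (y n - t n)) \<longlonglongrightarrow> 0" for x y
    proof -
      have "cauchy_class V (\<lambda>n. vplus V (\<pi> (x n)) (\<pi> (y n))) = lim_class (\<lambda>n. x n + y n)"
        using x y by (simp add: lim_class_def plus_eq Cauchy_reps_in)
      also have "\<dots> = lim_class (\<lambda>n. s n + t n)"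
      proof (subst lim_class_eq_iff)
        show "(\<lambda>n. nv (x n + y n - (s n + t n))) \<longlonglongrightarrow> 0"
        proof (rule nv_tendsto_0_le)
          show "(\<lambda>n. nv (x n - s n) + nv (y n - t n)) \<longlonglongrightarrow> 0"
            using tendsto_add[OF x(2) y(2)] by simp
          show "nv (x n + y n - (s n + t n)) \<le> nv (x n - s n) + nv (y n - t n)" for n
            using nv_add[of "x n - s n" "y n - t n"] x y s t
            by (simp add: Cauchy_reps_in diff_in add_diff_add)
        qed (use x y s t in \<open>auto simp: Cauchy_reps_in diff_in plus_in\<close>)
      qed (use x y s t in \<open>auto intro: Cauchy_reps_add\<close>)
      finally show ?thesis .
    qed
    then show ?thesis
      using ne[OF s] ne[OF t] s t
      by (simp add: completion_def lim_class_eq[OF s] lim_class_eq[OF t] SUP_eq_const plus_fun_def) blast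
  qed
  show "vscale (completion V) c (lim_class s) = lim_class (\<lambda>n. sc c (s n))"
    if s: "s \<in> Cauchy_reps" for c s
  proof -
    have "cauchy_class V (\<lambda>n. vscale V c (\<pi> (x n))) = lim_class (\<lambda>n. sc c (s n))"
      if x: "x \<in> Cauchy_reps" "(\<lambda>n. nv (x n - s n)) \<longlonglongrightarrow> 0" for x
    proof -
      have "cauchy_class V (\<lambda>n. vscale V c (\<pi> (x n))) = lim_class (\<lambda>n. sc c (x n))"
        using x by (simp add: lim_class_def scale_eq Cauchy_reps_in)
      also have "\<dots> = lim_class (\<lambda>n. sc c (s n))"
      proof (subst lim_class_eq_iff)
        show "(\<lambda>n. nv (sc c (x n) - sc c (s n))) \<longlonglongrightarrow> 0"
        proof (rule nv_tendsto_0_le)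
          show "(\<lambda>n. cmod c * nv (x n - s n)) \<longlonglongrightarrow> 0"
            using x(2) by (rule tendsto_mult_right_zero)
        qed (use x s in \<open>auto simp: Cauchy_reps_in diff_in scale_in vnorm_scale simp flip: scale_diff\<close>)
      qed (use x s in \<open>auto intro: Cauchy_reps_scale\<close>)
      finally show ?thesis .
    qed
    then show ?thesis
      using ne[OF s] s by (simp add: completion_def lim_class_eq[OF s] SUP_eq_const) blast
  qed
  show "vact (completion V) a (lim_class s) = lim_class (\<lambda>n. ac a (s n))"
    if a: "a \<in> A" and s: "s \<in> Cauchy_reps" for a s
  proof -
    obtain C where C: "C \<ge> 0" "\<And>u. u \<in> F \<Longrightarrow> nv (ac a u) \<le> C * nv u"
      using vnorm_act_nonneg[OF a] by blast
    have "cauchy_class V (\<lambda>n. vact V a (\<pi> (x n))) = lim_class (\<lambda>n. ac a (s n))"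
      if x: "x \<in> Cauchy_reps" "(\<lambda>n. nv (x n - s n)) \<longlonglongrightarrow> 0" for x
    proof -
      have "cauchy_class V (\<lambda>n. vact V a (\<pi> (x n))) = lim_class (\<lambda>n. ac a (x n))"
        using x a by (simp add: lim_class_def act_eq Cauchy_reps_in)
      also have "\<dots> = lim_class (\<lambda>n. ac a (s n))"
      proof (subst lim_class_eq_iff)
        show "(\<lambda>n. nv (ac a (x n) - ac a (s n))) \<longlonglongrightarrow> 0"
        proof (rule nv_tendsto_0_le)
          show "(\<lambda>n. C * nv (x n - s n)) \<longlonglongrightarrow> 0"
            using x(2) by (rule tendsto_mult_right_zero)
        qed (use x s a in \<open>auto simp: Cauchy_reps_in diff_in act_in C simp flip: act_diff\<close>)
      qed (use x s a in \<open>auto intro: Cauchy_reps_act\<close>)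
      finally show ?thesis .
    qed
    then show ?thesis
      using ne[OF s] s by (simp add: completion_def lim_class_eq[OF s] SUP_eq_const) blast
  qed
  show "s + t \<in> Cauchy_reps" if "s \<in> Cauchy_reps" "t \<in> Cauchy_reps" for s t
    using Cauchy_reps_add[OF that] by (simp add: plus_fun_def)
qed (auto simp: Cauchy_reps_scale Cauchy_reps_act Cauchy_reps_in scale_minus fun_eq_iff
    scale_diff act_diff)

text \<open>This justifies the \<open>THE\<close> in \<open>completion\<close>. By
  \<open>nm_diff\<close> the norms of the terms form a Cauchy sequence, and other representing
  sequences change them by a null sequence only, so that all choices share one limit.\<close>

lemma mnorm_completion_tendsto:
  assumes M: "mat_in Cauchy_reps p q M"
  shows "(\<lambda>n. nm p q (\<lambda>i j. M i j n)) \<longlonglongrightarrow> mnorm (completion V) p q (\<lambda>i j. lim_class (M i j))"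
proof -
  have MF: "mat_in F p q (\<lambda>i j. M i j n)" for n
    using M by (auto simp: mat_in_def Cauchy_reps_in)
  have "Cauchy (\<lambda>n. nm p q (\<lambda>i j. M i j n))"
  proof (rule metric_CauchyI)
    fix e :: real assume "e > 0"
    \<comment> \<open>The summand 1 keeps the denominator positive when \<open>p\<close> or
      \<open>q\<close> is zero.\<close>
    define d where "d = e / (real p * real q + 1)"
    have "d > 0" unfolding d_def using \<open>e > 0\<close> by (simp add: add_nonneg_pos)
    then have "\<forall>i j. \<exists>N. i < p \<longrightarrow> j < q \<longrightarrow> (\<forall>m\<ge>N. \<forall>n\<ge>N. nv (M i j m - M i j n) < d)"
      using M unfolding mat_in_def Cauchy_reps_def by blast
    then obtain N where N: "\<And>i j m n. i < p \<Longrightarrow> j < q \<Longrightarrow> m \<ge> N i j \<Longrightarrow> n \<ge> N i j \<Longrightarrow>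
        nv (M i j m - M i j n) < d"
      by metis
    \<comment> \<open>A sum of natural thresholds dominates each of them, also for an empty index
      range.\<close>
    define K where "K = (\<Sum>i<p. \<Sum>j<q. N i j)"
    have K: "N i j \<le> K" if "i < p" "j < q" for i j
    proof -
      have "N i j \<le> (\<Sum>j<q. N i j)" using that by (intro member_le_sum) auto
      also have "\<dots> \<le> K" unfolding K_def using that by (intro member_le_sum[of i]) auto
      finally show ?thesis .
    qed
    have "dist (nm p q (\<lambda>i j. M i j m)) (nm p q (\<lambda>i j. M i j n)) < e" if "m \<ge> K" "n \<ge> K" for m n
    proof -
      have "dist (nm p q (\<lambda>i j. M i j m)) (nm p q (\<lambda>i j. M i j n))
          \<le> (\<Sum>i<p. \<Sum>j<q. nv (M i j m - M i j n))"
        unfolding dist_real_def by (rule nm_diff[OF MF MF])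
      also have "\<dots> \<le> (\<Sum>i<p. \<Sum>j<q. d)"
        using that N K by (intro sum_mono less_imp_le) (meson lessThan_iff order_trans)
      also have "\<dots> < (real p * real q + 1) * d"
        using \<open>d > 0\<close> by (simp add: algebra_simps)
      also have "\<dots> = e"
        by (simp add: d_def add_nonneg_eq_0_iff)
      finally show ?thesis .
    qed
    then show "\<exists>N. \<forall>m\<ge>N. \<forall>n\<ge>N. dist (nm p q (\<lambda>i j. M i j m)) (nm p q (\<lambda>i j. M i j n)) < e"
      by blast
  qed
  then obtain L where L: "(\<lambda>n. nm p q (\<lambda>i j. M i j n)) \<longlonglongrightarrow> L"
    using Cauchy_convergent convergent_def by blast
  have *: "(\<lambda>n. mnorm V p q (\<lambda>i j. m i j n)) \<longlonglongrightarrow> L"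
    if m: "\<forall>i<p. \<forall>j<q. m i j \<in> lim_class (M i j)" for m
  proof -
    have "\<forall>i j. \<exists>t. i < p \<longrightarrow> j < q \<longrightarrow> t \<in> Cauchy_reps \<and> m i j = (\<lambda>n. \<pi> (t n))
        \<and> (\<lambda>n. nv (t n - M i j n)) \<longlonglongrightarrow> 0"
      using m M by (fastforce simp: mat_in_def lim_class_eq)
    then have "\<exists>t. \<forall>i j. i < p \<longrightarrow> j < q \<longrightarrow> t i j \<in> Cauchy_reps
        \<and> m i j = (\<lambda>n. \<pi> (t i j n)) \<and> (\<lambda>n. nv (t i j n - M i j n)) \<longlonglongrightarrow> 0"
      by (simp only: choice_iff)
    then obtain t where t': "\<forall>i j. i < p \<longrightarrow> j < q \<longrightarrow> t i j \<in> Cauchy_reps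
        \<and> m i j = (\<lambda>n. \<pi> (t i j n)) \<and> (\<lambda>n. nv (t i j n - M i j n)) \<longlonglongrightarrow> 0" ..
    then have t: "t i j \<in> Cauchy_reps" "m i j = (\<lambda>n. \<pi> (t i j n))"
        "(\<lambda>n. nv (t i j n - M i j n)) \<longlonglongrightarrow> 0" if "i < p" "j < q" for i j
      using that by simp_all
    have tF: "mat_in F p q (\<lambda>i j. t i j n)" for n
      using t by (auto simp: mat_in_def Cauchy_reps_in)
    have "(\<lambda>n. \<Sum>i<p. \<Sum>j<q. nv (t i j n - M i j n)) \<longlonglongrightarrow> (\<Sum>i<p. \<Sum>j<q. 0)"
      using t by (intro tendsto_sum) auto
    then have "(\<lambda>n. \<Sum>i<p. \<Sum>j<q. nv (t i j n - M i j n)) \<longlonglongrightarrow> 0" by simp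
    then have "(\<lambda>n. nm p q (\<lambda>i j. t i j n) - nm p q (\<lambda>i j. M i j n)) \<longlonglongrightarrow> 0"
      by (rule Lim_null_comparison[rotated]) (simp add: nm_diff[OF tF MF])
    then have "(\<lambda>n. nm p q (\<lambda>i j. t i j n)) \<longlonglongrightarrow> L"
      by (rule Lim_transform[OF L])
    moreover have "mnorm V p q (\<lambda>i j. m i j n) = nm p q (\<lambda>i j. t i j n)" for n
      using t by (intro mnorm_local) simp
    ultimately show ?thesis by simp
  qed
  have "mnorm (completion V) p q (\<lambda>i j. lim_class (M i j)) = L"
    unfolding completion_def op_module.simps
  proof (rule the_equality)
    show "\<forall>m. (\<forall>i<p. \<forall>j<q. m i j \<in> lim_class (M i j)) \<longrightarrow>
        (\<lambda>n. mnorm V p q (\<lambda>i j. m i j n)) \<longlonglongrightarrow> L"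
      using * by blast
    fix l assume l: "\<forall>m. (\<forall>i<p. \<forall>j<q. m i j \<in> lim_class (M i j)) \<longrightarrow>
        (\<lambda>n. mnorm V p q (\<lambda>i j. m i j n)) \<longlonglongrightarrow> l"
    \<comment> \<open>Testing a competing limit on the given representatives suffices for
      uniqueness.\<close>
    have "\<forall>i<p. \<forall>j<q. (\<lambda>n. \<pi> (M i j n)) \<in> lim_class (M i j)"
      using M by (auto simp: mat_in_def lim_class_eq vnorm_0)
    then have "(\<lambda>n. nm p q (\<lambda>i j. M i j n)) \<longlonglongrightarrow> l"
      using l[rule_format, of "\<lambda>i j n. \<pi> (M i j n)"] by blast
    then show "l = L" using L LIMSEQ_unique by blast
  qed
  with L show ?thesis by simp
qed

lemma mnorm_completion_local:
  assumes "\<And>i j. i < p \<Longrightarrow> j < q \<Longrightarrow> M i j = M' i j"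
  shows "mnorm (completion V) p q M = mnorm (completion V) p q M'"
proof -
  have "(\<forall>i<p. \<forall>j<q. m i j \<in> M i j) \<longleftrightarrow> (\<forall>i<p. \<forall>j<q. m i j \<in> M' i j)" for m
    using assms by auto
  then show ?thesis by (simp add: completion_def)
qed

end

text \<open>Serves \<open>exact_lift\<close>, where the successive corrections shrink
  geometrically.\<close>

lemma (in seminormed_presented) Cauchy_reps_geometric:
  assumes F: "\<And>n. s n \<in> F" and step: "\<And>n. vnorm V (\<pi> (s (Suc n) - s n)) \<le> C / 2 ^ n"
  shows "s \<in> Cauchy_reps"
proof -
  \<comment> \<open>The subtracted term is the remaining tail of the geometric series; keeping it
    makes the induction close exactly.\<close>
  have le: "nv (s (n + k) - s n) \<le> 2 * C / 2 ^ n - 2 * C / 2 ^ (n + k)" for n k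
  proof (induction k)
    case (Suc k)
    have "nv (s (n + Suc k) - s n) \<le> nv (s (Suc (n + k)) - s (n + k)) + nv (s (n + k) - s n)"
      using nv_add[of "s (Suc (n + k)) - s (n + k)" "s (n + k) - s n"] F by (simp add: diff_in)
    also have "\<dots> \<le> C / 2 ^ (n + k) + (2 * C / 2 ^ n - 2 * C / 2 ^ (n + k))"
      by (intro add_mono step Suc)
    also have "\<dots> = 2 * C / 2 ^ n - 2 * C / 2 ^ (n + Suc k)"
      by (simp add: field_simps)
    finally show ?case .
  qed (simp add: vnorm_0)
  have C: "0 \<le> C"
    using step[of 0] nv_nonneg[of "s 1 - s 0"] F by (simp add: diff_in)
  have le': "nv (s m - s n) \<le> 2 * C / 2 ^ n" if "m \<ge> n" for m n
  proof -
    have "0 \<le> 2 * C / 2 ^ m" using C by simp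
    then show ?thesis using le[of n "m - n"] that by simp
  qed
  show ?thesis
    unfolding Cauchy_reps_def
  proof (intro CollectI conjI allI impI F)
    fix e :: real assume "e > 0"
    \<comment> \<open>Both terms are compared with \<open>s N\<close>, at a cost of
      \<open>2 * C / 2 ^ N\<close> each.\<close>
    have "(\<lambda>n. 4 * C / 2 ^ n) \<longlonglongrightarrow> 0"
      by (rule LIMSEQ_divide_realpow_zero) simp
    then obtain N where N: "4 * C / 2 ^ N < e"
      using order_tendstoD(2)[OF _ \<open>e > 0\<close>] by (fastforce simp: eventually_sequentially)
    have "nv (s m - s n) < e" if "m \<ge> N" "n \<ge> N" for m n
      using nv_diff[of "s m - s N" "s n - s N"] le'[OF that(1)] le'[OF that(2)] N F
      by (simp add: diff_in)
    then show "\<exists>N. \<forall>m\<ge>N. \<forall>n\<ge>N. nv (s m - s n) < e" by blast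
  qed
qed

section \<open>The Haagerup tensor product of two function modules\<close>

lemma presented_mnorm_update:
  "presented A V F sc ac \<pi> \<Longrightarrow> presented A (V\<lparr>mnorm := f\<rparr>) F sc ac \<pi>"
  by (simp add: presented_def)

section \<open>Additive maps on the free vector space\<close>

definition pm_scale :: "complex \<Rightarrow> ('k \<Rightarrow>\<^sub>0 complex) \<Rightarrow> ('k \<Rightarrow>\<^sub>0 complex)" where
  "pm_scale c u = Poly_Mapping.map (\<lambda>z. c * z) u"

lemma lookup_pm_scale [simp]: "Poly_Mapping.lookup (pm_scale c u) k = c * Poly_Mapping.lookup u k"
  by (simp add: pm_scale_def Poly_Mapping.map.rep_eq when_def)

lemma pm_scale_single [simp]: "pm_scale c (Poly_Mapping.single k z) = Poly_Mapping.single k (c * z)"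
  by (rule poly_mapping_eqI) (simp add: lookup_single when_def)

lemma pm_scale_add: "pm_scale c (u + v) = pm_scale c u + pm_scale c v"
  by (rule poly_mapping_eqI) (simp add: lookup_add distrib_left)

lemma pm_scale_diff: "pm_scale c (u - v) = pm_scale c u - pm_scale c v"
  by (rule poly_mapping_eqI) (simp add: lookup_minus right_diff_distrib)

lemma pm_scale_minus_1: "pm_scale (-1) u = - u"
  by (rule poly_mapping_eqI) simp

lemma pm_scale_0 [simp]: "pm_scale c 0 = 0"
  by (rule poly_mapping_eqI) simp

lemma keys_pm_scale: "Poly_Mapping.keys (pm_scale c u) \<subseteq> Poly_Mapping.keys u"
  by (auto simp: in_keys_iff)

text \<open>The target is only an abelian group, so the coefficient is passed to \<open>h\<close>
  along with the generator. Both the action and the multiplication map are instances.\<close>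

definition lin_ext :: "('k \<Rightarrow> complex \<Rightarrow> 'c::ab_group_add) \<Rightarrow> ('k \<Rightarrow>\<^sub>0 complex) \<Rightarrow> 'c" where
  "lin_ext h u = (\<Sum>k\<in>Poly_Mapping.keys u. h k (Poly_Mapping.lookup u k))"

lemma lin_ext_add:
  assumes "\<And>k. h k 0 = 0" and "\<And>k z z'. h k (z + z') = h k z + h k z'"
  shows "lin_ext h (u + v) = lin_ext h u + lin_ext h v"
  unfolding lin_ext_def by (rule setsum_keys_plus_distrib) (use assms in auto)

lemma lin_ext_diff:
  assumes "\<And>k. h k 0 = 0" and "\<And>k z z'. h k (z + z') = h k z + h k z'"
  shows "lin_ext h (u - v) = lin_ext h u - lin_ext h v"
  using lin_ext_add[of h "u - v" v] assms by (simp add: algebra_simps)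

lemma lin_ext_single: "h k 0 = 0 \<Longrightarrow> lin_ext h (Poly_Mapping.single k z) = h k z"
  by (simp add: lin_ext_def)

lemma lin_ext_0 [simp]: "lin_ext h 0 = 0"
  by (simp add: lin_ext_def)

abbreviation pure :: "'x \<Rightarrow> 'y \<Rightarrow> ('x \<times> 'y \<Rightarrow>\<^sub>0 complex)" where
  "pure x y \<equiv> Poly_Mapping.single (x, y) 1"

type_synonym 'w tens = "(('w \<Rightarrow>\<^sub>C complex) \<times> ('w \<Rightarrow>\<^sub>C complex)) \<Rightarrow>\<^sub>0 complex"

definition left_act :: "('w::topological_space \<Rightarrow>\<^sub>C complex) \<Rightarrow> 'w tens \<Rightarrow> 'w tens" where
  "left_act a = lin_ext (\<lambda>k z. Poly_Mapping.single (a * fst k, snd k) z)"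

definition mult_map :: "'w::topological_space tens \<Rightarrow> 'w \<Rightarrow>\<^sub>C complex" where
  "mult_map = lin_ext (\<lambda>k z. const_bcontfun z * (fst k * snd k))"

lemma left_act_add: "left_act a (u + v) = left_act a u + left_act a v"
  unfolding left_act_def by (intro lin_ext_add) (auto simp: single_add)

lemma left_act_diff: "left_act a (u - v) = left_act a u - left_act a v"
  unfolding left_act_def by (intro lin_ext_diff) (auto simp: single_add)

lemma left_act_single [simp]:
  "left_act a (Poly_Mapping.single (x, y) z) = Poly_Mapping.single (a * x, y) z"
  by (simp add: left_act_def lin_ext_single)

lemma left_act_0 [simp]: "left_act a 0 = 0"
  by (simp add: left_act_def)

lemma const_bcontfun_add: "const_bcontfun (z + z') = const_bcontfun z + const_bcontfun z'"
  for z z' :: complex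
  by (rule bcontfun_eqI) simp

lemma const_bcontfun_mult: "const_bcontfun (z * z') = const_bcontfun z * const_bcontfun z'"
  for z z' :: complex
  by (rule bcontfun_eqI) simp

lemma const_bcontfun_1 [simp]: "const_bcontfun (1::complex) = 1"
  by (rule bcontfun_eqI) simp

lemma const_bcontfun_minus_1 [simp]: "const_bcontfun (- 1 :: complex) = - 1"
  by (rule bcontfun_eqI) simp

lemma norm_const_bcontfun: "norm (const_bcontfun c) \<le> cmod c"
  by (rule norm_bound) simp

lemma sup_norm_const_times:
  "sup_norm p q (\<lambda>i j. const_bcontfun c * M i j) \<le> cmod c * sup_norm p q M"
  by (rule order_trans[OF sup_norm_times mult_right_mono[OF norm_const_bcontfun]]) simp

lemma mult_map_add: "mult_map (u + v) = mult_map u + mult_map v"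
  unfolding mult_map_def by (intro lin_ext_add) (auto simp: const_bcontfun_add distrib_right)

lemma mult_map_diff: "mult_map (u - v) = mult_map u - mult_map v"
  unfolding mult_map_def by (intro lin_ext_diff) (auto simp: const_bcontfun_add distrib_right)

lemma mult_map_single [simp]: "mult_map (Poly_Mapping.single (x, y) z) = const_bcontfun z * (x * y)"
  by (simp add: mult_map_def lin_ext_single)

lemma mult_map_0 [simp]: "mult_map 0 = 0"
  by (simp add: mult_map_def)

lemma mult_map_sum: "mult_map (\<Sum>k\<in>K. f k) = (\<Sum>k\<in>K. mult_map (f k))"
  by (induction K rule: infinite_finite_induct) (simp_all add: mult_map_add)

lemma left_act_sum: "left_act a (\<Sum>k\<in>K. f k) = (\<Sum>k\<in>K. left_act a (f k))"
  by (induction K rule: infinite_finite_induct) (simp_all add: left_act_add)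

text \<open>A formal sum is the sum of its monomials. Tracking the keys of the partial sums keeps
  the induction inside the free space over \<open>S\<close>.\<close>

lemma poly_mapping_keys_induct [consumes 1, case_names zero single add]:
  fixes u :: "'k \<Rightarrow>\<^sub>0 complex"
  assumes "Poly_Mapping.keys u \<subseteq> S"
    and zero: "P 0"
    and single: "\<And>k z. k \<in> S \<Longrightarrow> P (Poly_Mapping.single k z)"
    and add: "\<And>u v. Poly_Mapping.keys u \<subseteq> S \<Longrightarrow> Poly_Mapping.keys v \<subseteq> S \<Longrightarrow>
      P u \<Longrightarrow> P v \<Longrightarrow> P (u + v)"
  shows "P u"
proof -
  let ?s = "\<lambda>K. \<Sum>k\<in>K. Poly_Mapping.single k (Poly_Mapping.lookup u k)"
  have "Poly_Mapping.keys (?s K) \<subseteq> S \<and> P (?s K)" if "finite K" "K \<subseteq> S" for K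
    using that
  proof (induction K)
    case (insert k K)
    have "Poly_Mapping.keys (Poly_Mapping.single k (Poly_Mapping.lookup u k)) \<subseteq> S"
      using insert.prems by simp
    moreover from this have "Poly_Mapping.keys (?s (insert k K)) \<subseteq> S"
      using insert keys_add[of "Poly_Mapping.single k (Poly_Mapping.lookup u k)" "?s K"]
      by (auto simp del: keys_single)
    moreover have "P (Poly_Mapping.single k (Poly_Mapping.lookup u k) + ?s K)"
      using insert calculation by (intro add single) auto
    ultimately show ?case using insert by simp
  qed (simp add: zero)
  moreover have "?s (Poly_Mapping.keys u) = u"
    by (rule poly_mapping_eqI)
      (simp add: lookup_sum lookup_single when_def in_keys_iff if_distrib cong: if_cong)
  ultimately show ?thesis
    using assms(1) finite_keys by metis
qed

section \<open>The algebraic tensor product of two function modules\<close>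

locale two_modules =
  fixes A X Y :: "('w::topological_space \<Rightarrow>\<^sub>C complex) set"
  assumes const_in: "const_bcontfun c \<in> A"
    and X_0: "0 \<in> X" and X_add: "x \<in> X \<Longrightarrow> x' \<in> X \<Longrightarrow> x + x' \<in> X"
    and X_mult: "a \<in> A \<Longrightarrow> x \<in> X \<Longrightarrow> a * x \<in> X"
    and Y_0: "0 \<in> Y" and Y_add: "y \<in> Y \<Longrightarrow> y' \<in> Y \<Longrightarrow> y + y' \<in> Y"
    and Y_mult: "a \<in> A \<Longrightarrow> y \<in> Y \<Longrightarrow> a * y \<in> Y"
begin

abbreviation "FM \<equiv> free_module (fun_module X) (fun_module Y) ::
  ('w \<Rightarrow>\<^sub>C complex, 'w tens) op_module"
abbreviation "TM \<equiv> alg_haagerup (fun_module X) (fun_module Y) ::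
  ('w \<Rightarrow>\<^sub>C complex, 'w tens set) op_module"
abbreviation "rels \<equiv> bilinear_relations (fun_module X) (fun_module Y)"
abbreviation "null \<equiv> lin_span FM rels"
abbreviation "cls \<equiv> tensor_class (fun_module X) (fun_module Y)"

definition reps :: "'w tens set" where
  "reps = {u. Poly_Mapping.keys u \<subseteq> X \<times> Y}"

lemma single_in_reps: "x \<in> X \<Longrightarrow> y \<in> Y \<Longrightarrow> Poly_Mapping.single (x, y) z \<in> reps"
  by (simp add: reps_def)

lemma add_in_reps: "u \<in> reps \<Longrightarrow> v \<in> reps \<Longrightarrow> u + v \<in> reps"
  unfolding reps_def using keys_add[of u v] by auto

lemma diff_in_reps: "u \<in> reps \<Longrightarrow> v \<in> reps \<Longrightarrow> u - v \<in> reps"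
  unfolding reps_def using keys_diff[of u v] by auto

lemma zero_in_reps: "0 \<in> reps"
  by (simp add: reps_def)

lemma scale_in_reps: "u \<in> reps \<Longrightarrow> pm_scale c u \<in> reps"
  unfolding reps_def using keys_pm_scale[of c u] by auto

lemma sum_in_reps: "(\<And>k. k \<in> K \<Longrightarrow> f k \<in> reps) \<Longrightarrow> (\<Sum>k\<in>K. f k) \<in> reps"
  by (induction K rule: infinite_finite_induct) (auto intro: zero_in_reps add_in_reps)

lemma reps_induct [consumes 1, case_names zero single add]:
  assumes "u \<in> reps" and "P 0"
    and "\<And>x y z. x \<in> X \<Longrightarrow> y \<in> Y \<Longrightarrow> P (Poly_Mapping.single (x, y) z)"
    and "\<And>u v. u \<in> reps \<Longrightarrow> v \<in> reps \<Longrightarrow> P u \<Longrightarrow> P v \<Longrightarrow> P (u + v)"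
  shows "P u"
proof -
  have "Poly_Mapping.keys u \<subseteq> X \<times> Y" using assms(1) by (simp add: reps_def)
  then show ?thesis
    by (induction rule: poly_mapping_keys_induct) (use assms in \<open>auto simp: reps_def\<close>)
qed

lemma left_act_in_reps:
  assumes a: "a \<in> A" and u: "u \<in> reps"
  shows "left_act a u \<in> reps"
  using u
  by (induction rule: reps_induct)
    (use a in \<open>auto simp: left_act_add zero_in_reps add_in_reps single_in_reps X_mult\<close>)

lemma FM_simps [simp]:
  "pts FM = reps" "vzero FM = 0" "vplus FM = (+)" "vscale FM = pm_scale" "vact FM = left_act"
  by (simp_all add: free_module_def reps_def pm_scale_def left_act_def lin_ext_def fun_eq_iff)

lemma presented_FM: "presented A FM reps pm_scale left_act id"
proof
  show "u + v \<in> reps" if "u \<in> reps" "v \<in> reps" for u v using that by (rule add_in_reps)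
  show "left_act a u \<in> reps" if "a \<in> A" "u \<in> reps" for a u using that by (rule left_act_in_reps)
qed (auto simp: zero_in_reps scale_in_reps pm_scale_minus_1 pm_scale_diff left_act_diff)

interpretation FM: presented A FM reps pm_scale left_act id
  by (rule presented_FM)

lemma lin_subspace_FM_iff:
  "lin_subspace FM W \<longleftrightarrow> W \<subseteq> reps \<and> 0 \<in> W \<and> (\<forall>u\<in>W. \<forall>v\<in>W. u + v \<in> W) \<and> (\<forall>c. \<forall>v\<in>W. pm_scale c v \<in> W)"
  by (simp add: lin_subspace_def)

lemma rels_iff:
  "u \<in> rels \<longleftrightarrow>
     (\<exists>x x' y. x \<in> X \<and> x' \<in> X \<and> y \<in> Y \<and> u = pure (x + x') y - pure x y - pure x' y)
   \<or> (\<exists>x y y'. x \<in> X \<and> y \<in> Y \<and> y' \<in> Y \<and> u = pure x (y + y') - pure x y - pure x y')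
   \<or> (\<exists>c x y. x \<in> X \<and> y \<in> Y \<and> u = pure (const_bcontfun c * x) y - Poly_Mapping.single (x, y) c)
   \<or> (\<exists>c x y. x \<in> X \<and> y \<in> Y \<and> u = pure x (const_bcontfun c * y) - Poly_Mapping.single (x, y) c)"
  unfolding bilinear_relations_def by simp blast

lemma rels_subset: "rels \<subseteq> reps"
proof -
  have "const_bcontfun c * x \<in> X" if "x \<in> X" for c x using that const_in X_mult by blast
  moreover have "const_bcontfun c * y \<in> Y" if "y \<in> Y" for c y using that const_in Y_mult by blast
  ultimately show ?thesis
    by (auto simp only: rels_iff X_add Y_add subset_iff intro!: diff_in_reps single_in_reps)
qed

lemma null_subspace: "lin_subspace FM null"
proof -
  have "lin_subspace FM reps"
    by (auto simp: lin_subspace_FM_iff zero_in_reps add_in_reps scale_in_reps)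
  then have "null \<subseteq> reps"
    unfolding lin_span_def using rels_subset by blast
  then show ?thesis
    unfolding lin_subspace_FM_iff by (auto simp: lin_span_def lin_subspace_FM_iff)
qed

lemma rels_null: "rels \<subseteq> null"
  by (auto simp: lin_span_def)

lemma null_minimal: "lin_subspace FM W \<Longrightarrow> rels \<subseteq> W \<Longrightarrow> null \<subseteq> W"
  by (auto simp: lin_span_def)

lemmas null_0 = FM.lin_subspace_0[OF null_subspace, simplified]

lemma null_reps: "u \<in> null \<Longrightarrow> u \<in> reps"
  using null_subspace by (auto simp: lin_subspace_FM_iff)

lemma null_add: "u \<in> null \<Longrightarrow> v \<in> null \<Longrightarrow> u + v \<in> null"
  using null_subspace by (auto simp: lin_subspace_FM_iff)

lemma null_scale: "u \<in> null \<Longrightarrow> pm_scale c u \<in> null"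
  using null_subspace by (auto simp: lin_subspace_FM_iff)

lemma null_minus: "u \<in> null \<Longrightarrow> - u \<in> null"
  using null_scale[of u "-1"] by (simp add: pm_scale_minus_1)

lemma null_diff: "u \<in> null \<Longrightarrow> v \<in> null \<Longrightarrow> u - v \<in> null"
  using null_add[of u "- v"] by (simp add: null_minus)

lemma null_sum: "(\<And>k. k \<in> K \<Longrightarrow> f k \<in> null) \<Longrightarrow> (\<Sum>k\<in>K. f k) \<in> null"
  by (induction K rule: infinite_finite_induct) (auto intro: null_0 null_add)

lemma null_add_left:
  "x \<in> X \<Longrightarrow> x' \<in> X \<Longrightarrow> y \<in> Y \<Longrightarrow> pure (x + x') y - pure x y - pure x' y \<in> null"
  by (rule subsetD[OF rels_null], unfold rels_iff) blast

lemma null_add_right: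
  "x \<in> X \<Longrightarrow> y \<in> Y \<Longrightarrow> y' \<in> Y \<Longrightarrow> pure x (y + y') - pure x y - pure x y' \<in> null"
  by (rule subsetD[OF rels_null], unfold rels_iff) blast

lemma null_scale_left:
  "x \<in> X \<Longrightarrow> y \<in> Y \<Longrightarrow> pure (const_bcontfun c * x) y - Poly_Mapping.single (x, y) c \<in> null"
  by (rule subsetD[OF rels_null], unfold rels_iff) blast

lemma null_scale_right:
  "x \<in> X \<Longrightarrow> y \<in> Y \<Longrightarrow> pure x (const_bcontfun c * y) - Poly_Mapping.single (x, y) c \<in> null"
  by (rule subsetD[OF rels_null], unfold rels_iff) blast

text \<open>The additivity relation at \<open>x = x' = 0\<close> is
  \<open>- pure 0 y\<close>.\<close>

lemma null_zero_left:
  assumes "y \<in> Y" shows "pure 0 y \<in> null"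
  using null_minus[OF null_add_left[OF X_0 X_0 assms]] by simp

lemma null_zero_right:
  assumes "x \<in> X" shows "pure x 0 \<in> null"
  using null_minus[OF null_add_right[OF assms Y_0 Y_0]] by simp

text \<open>The representatives that \<open>left_act a\<close> sends into \<open>null\<close> form a
  subspace, and the action carries each relation to a relation of the same kind; minimality of the
  span does the rest.\<close>

lemma null_act:
  assumes a: "a \<in> A" and u: "u \<in> null"
  shows "left_act a u \<in> null"
proof -
  have scale: "left_act a (pm_scale c u) = pm_scale c (left_act a u)" if "u \<in> reps" for c u
    using that by (induction rule: reps_induct) (simp_all add: left_act_add pm_scale_add)
  have "null \<subseteq> {u \<in> reps. left_act a u \<in> null}"
  proof (rule null_minimal)
    show "lin_subspace FM {u \<in> reps. left_act a u \<in> null}"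
      by (auto simp: lin_subspace_FM_iff zero_in_reps null_0 left_act_add add_in_reps null_add
          scale_in_reps scale null_scale)
    have "left_act a u \<in> null" if "u \<in> rels" for u
      using that unfolding rels_iff
    proof (elim disjE exE conjE)
      fix x x' y assume u: "x \<in> X" "x' \<in> X" "y \<in> Y" "u = pure (x + x') y - pure x y - pure x' y"
      show "left_act a u \<in> null"
        using null_add_left[of "a * x" "a * x'" y] u a
        by (simp add: X_mult left_act_diff distrib_left)
    next
      fix x y y' assume u: "x \<in> X" "y \<in> Y" "y' \<in> Y" "u = pure x (y + y') - pure x y - pure x y'"
      show "left_act a u \<in> null"
        using null_add_right[of "a * x" y y'] u a by (simp add: X_mult left_act_diff)
    next
      fix c x y
      assume u: "x \<in> X" "y \<in> Y" "u = pure (const_bcontfun c * x) y - Poly_Mapping.single (x, y) c"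
      show "left_act a u \<in> null"
        using null_scale_left[of "a * x" y c] u a
        by (simp add: X_mult left_act_diff mult.left_commute)
    next
      fix c x y
      assume u: "x \<in> X" "y \<in> Y" "u = pure x (const_bcontfun c * y) - Poly_Mapping.single (x, y) c"
      show "left_act a u \<in> null"
        using null_scale_right[of "a * x" y c] u a by (simp add: X_mult left_act_diff)
    qed
    then show "rels \<subseteq> {u \<in> reps. left_act a u \<in> null}"
      using rels_subset by blast
  qed
  with u show ?thesis by blast
qed

lemma mult_map_scale: "u \<in> reps \<Longrightarrow> mult_map (pm_scale c u) = const_bcontfun c * mult_map u"
  by (induction rule: reps_induct)
    (simp_all add: pm_scale_add mult_map_add distrib_left const_bcontfun_mult mult.assoc)

lemma mult_map_act: "u \<in> reps \<Longrightarrow> mult_map (left_act a u) = a * mult_map u"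
  by (induction rule: reps_induct)
    (simp_all add: left_act_add mult_map_add distrib_left ac_simps)

lemma mult_map_null: "u \<in> null \<Longrightarrow> mult_map u = 0"
proof -
  have "null \<subseteq> {u \<in> reps. mult_map u = 0}"
  proof (rule null_minimal)
    show "lin_subspace FM {u \<in> reps. mult_map u = 0}"
      by (auto simp: lin_subspace_FM_iff zero_in_reps mult_map_add add_in_reps scale_in_reps
          mult_map_scale)
    have "mult_map u = 0" if "u \<in> rels" for u
      using that unfolding rels_iff
      by (elim disjE exE conjE) (simp_all add: mult_map_diff distrib_left distrib_right ac_simps)
    then show "rels \<subseteq> {u \<in> reps. mult_map u = 0}"
      using rels_subset by blast
  qed
  then show "u \<in> null \<Longrightarrow> mult_map u = 0" by blast
qed

lemma presented_TM: "presented A TM reps pm_scale left_act cls"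
proof -
  have "presented A (quot_module FM null) reps pm_scale left_act (\<lambda>u. vcoset FM null (id u))"
    by (rule FM.presented_quot[OF null_subspace]) (simp add: null_act)
  then show ?thesis
    unfolding alg_haagerup_def tensor_class_def by (intro presented_mnorm_update) simp
qed

lemma cls_eq_iff: "u \<in> reps \<Longrightarrow> v \<in> reps \<Longrightarrow> cls u = cls v \<longleftrightarrow> u - v \<in> null"
  using FM.vcoset_eq_iff[OF null_subspace, of u v] by (simp add: tensor_class_def)

lemma mnorm_TM: "mnorm TM = haagerup_norm (fun_module X) (fun_module Y)"
  by (simp add: alg_haagerup_def)

section \<open>The Haagerup norm on representatives\<close>

definition tprod :: "nat \<Rightarrow> 'w cmat \<Rightarrow> 'w cmat \<Rightarrow> nat \<Rightarrow> nat \<Rightarrow> 'w tens" where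
  "tprod r x y = (\<lambda>i j. \<Sum>k<r. pure (x i k) (y k j))"

text \<open>Equality of tensor classes is expressed by membership in \<open>null\<close>, so that
  factorisations can be manipulated without cosets.\<close>

definition factors :: "nat \<Rightarrow> nat \<Rightarrow> (nat \<Rightarrow> nat \<Rightarrow> 'w tens) \<Rightarrow> nat \<Rightarrow> 'w cmat \<Rightarrow> 'w cmat \<Rightarrow> bool" where
  "factors p q U r x y \<longleftrightarrow> mat_in X p r x \<and> mat_in Y r q y
     \<and> (\<forall>i<p. \<forall>j<q. U i j - tprod r x y i j \<in> null)"

definition hnorm :: "nat \<Rightarrow> nat \<Rightarrow> (nat \<Rightarrow> nat \<Rightarrow> 'w tens) \<Rightarrow> real" where
  "hnorm p q U = mnorm TM p q (\<lambda>i j. cls (U i j))"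

lemma tprod_in_reps:
  "mat_in X p r x \<Longrightarrow> mat_in Y r q y \<Longrightarrow> i < p \<Longrightarrow> j < q \<Longrightarrow> tprod r x y i j \<in> reps"
  unfolding tprod_def mat_in_def by (intro sum_in_reps single_in_reps) auto

lemma hnorm_eq:
  assumes U: "mat_in reps p q U"
  shows "hnorm p q U = Inf {sup_norm p r x * sup_norm r q y | r x y. factors p q U r x y}"
proof -
  have "(\<forall>i<p. \<forall>j<q. cls (U i j) = cls (tprod r x y i j)) \<longleftrightarrow>
      (\<forall>i<p. \<forall>j<q. U i j - tprod r x y i j \<in> null)" if "mat_in X p r x" "mat_in Y r q y" for r x y
    using that U tprod_in_reps[OF that] by (simp add: cls_eq_iff mat_in_def)
  then have "(mat_in X p r x \<and> mat_in Y r q y \<and> (\<forall>i<p. \<forall>j<q. cls (U i j) = cls (tprod r x y i j)))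
      \<longleftrightarrow> factors p q U r x y" for r x y
    unfolding factors_def by blast
  then show ?thesis
    by (simp add: hnorm_def mnorm_TM haagerup_norm_def tprod_def)
qed

lemma factors_bdd: "bdd_below {sup_norm p r x * sup_norm r q y | r x y. factors p q U r x y}"
  by (rule bdd_belowI[of _ 0]) auto

lemma hnorm_le_factors:
  assumes "mat_in reps p q U" and "factors p q U r x y"
  shows "hnorm p q U \<le> sup_norm p r x * sup_norm r q y"
  unfolding hnorm_eq[OF assms(1)] using assms(2) by (intro cInf_lower factors_bdd) auto

text \<open>A balanced factorisation: both squared norms obey the same bound. Concatenation then
  adds the bounds, which proves subadditivity without choosing scalings anew. By
  \<open>hnorm_le_bfact\<close> and \<open>bfact_less\<close>, the infimum of the admissible
  \<open>s\<close> is the Haagerup norm.\<close>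

definition bfact :: "nat \<Rightarrow> nat \<Rightarrow> (nat \<Rightarrow> nat \<Rightarrow> 'w tens) \<Rightarrow> real \<Rightarrow> bool" where
  "bfact p q U s \<longleftrightarrow> (\<exists>r x y. factors p q U r x y \<and> (sup_norm p r x)\<^sup>2 \<le> s \<and> (sup_norm r q y)\<^sup>2 \<le> s)"

lemma bfact_cong:
  assumes "\<And>i j. i < p \<Longrightarrow> j < q \<Longrightarrow> U i j = V i j"
  shows "bfact p q U s \<longleftrightarrow> bfact p q V s"
  using assms by (simp add: bfact_def factors_def)

lemma hnorm_le_bfact:
  assumes "mat_in reps p q U" and "bfact p q U s"
  shows "hnorm p q U \<le> s"
proof -
  obtain r x y where f: "factors p q U r x y" "(sup_norm p r x)\<^sup>2 \<le> s" "(sup_norm r q y)\<^sup>2 \<le> s"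
    using assms(2) by (auto simp: bfact_def)
  have "2 * (sup_norm p r x * sup_norm r q y) \<le> (sup_norm p r x)\<^sup>2 + (sup_norm r q y)\<^sup>2"
    using sum_squares_bound[of "sup_norm p r x" "sup_norm r q y"] by simp
  with f hnorm_le_factors[OF assms(1) f(1)] show ?thesis by linarith
qed

text \<open>A block row times a block column is the sum of the products of the blocks.\<close>

lemma factors_add:
  assumes "factors p q U r x y" and "factors p q V r' x' y'"
  shows "factors p q (\<lambda>i j. U i j + V i j) (r + r')
    (\<lambda>i k. if k < r then x i k else x' i (k - r)) (\<lambda>k j. if k < r then y k j else y' (k - r) j)"
proof -
  have "tprod (r + r') (\<lambda>i k. if k < r then x i k else x' i (k - r))
      (\<lambda>k j. if k < r then y k j else y' (k - r) j) i j = tprod r x y i j + tprod r' x' y' i j" for i j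
    by (simp add: tprod_def sum_lessThan_split cong: sum.cong_simp)
  moreover have "U i j - tprod r x y i j + (V i j - tprod r' x' y' i j) \<in> null" if "i < p" "j < q" for i j
    using assms that by (intro null_add) (auto simp: factors_def)
  ultimately show ?thesis
    using assms by (auto simp: factors_def mat_in_def add_diff_add)
qed

lemma bfact_add: "bfact p q U s \<Longrightarrow> bfact p q V t \<Longrightarrow> bfact p q (\<lambda>i j. U i j + V i j) (s + t)"
  unfolding bfact_def by (blast intro: factors_add sup_norm_row_concat sup_norm_col_concat)

text \<open>The witness has inner size \<open>0\<close>: its product is an empty sum and both
  factors have norm zero.\<close>

lemma bfact_0: "bfact p q (\<lambda>_ _. 0) 0"
proof -
  have "sup_norm p 0 (\<lambda>_ _. 0) = 0" "sup_norm 0 q (\<lambda>_ _. 0) = 0"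
    by (rule antisym[OF sup_norm_le sup_norm_nonneg]; simp)+
  moreover have "factors p q (\<lambda>_ _. 0) 0 (\<lambda>_ _. 0) (\<lambda>_ _. 0)"
    by (simp add: factors_def mat_in_def tprod_def null_0)
  ultimately show ?thesis unfolding bfact_def by fastforce
qed

lemma bfact_entry:
  assumes "bfact 1 1 (\<lambda>_ _. u) s"
  shows "bfact p q (\<lambda>i j. if i = i0 \<and> j = j0 then u else 0) s"
proof -
  obtain r x y where f: "factors 1 1 (\<lambda>_ _. u) r x y"
    and le: "(sup_norm 1 r x)\<^sup>2 \<le> s" "(sup_norm r 1 y)\<^sup>2 \<le> s"
    using assms by (auto simp: bfact_def)
  let ?x = "\<lambda>i k. if i = i0 then x 0 k else 0" and ?y = "\<lambda>k j. if j = j0 then y k 0 else 0"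
  have xy: "x 0 k \<in> X" "y k 0 \<in> Y" if "k < r" for k
    using f that by (auto simp: factors_def mat_in_def)
  have "(if i = i0 \<and> j = j0 then u else 0) - tprod r ?x ?y i j \<in> null" for i j
  proof (cases "i = i0 \<and> j = j0")
    case True
    then show ?thesis using f by (simp add: factors_def tprod_def)
  next
    case False
    \<comment> \<open>Away from the chosen position each summand has a zero factor. Such a formal
      tensor is not zero in the free space, it only lies in \<open>null\<close>.\<close>
    have "tprod r ?x ?y i j \<in> null"
      unfolding tprod_def using False xy X_0 Y_0
      by (intro null_sum) (auto intro: null_zero_left null_zero_right)
    with False show ?thesis by (auto intro: null_minus)
  qed
  then have "factors p q (\<lambda>i j. if i = i0 \<and> j = j0 then u else 0) r ?x ?y"
    using xy by (auto simp: factors_def mat_in_def X_0 Y_0)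
  moreover have "(sup_norm p r ?x)\<^sup>2 \<le> s" "(sup_norm r q ?y)\<^sup>2 \<le> s"
    using order_trans[OF power_mono[OF sup_norm_pad_row sup_norm_nonneg] le(1)]
      order_trans[OF power_mono[OF sup_norm_pad_col sup_norm_nonneg] le(2)] by blast+
  ultimately show ?thesis unfolding bfact_def by blast
qed

text \<open>Filling the matrix one position at a time adds the bounds; \<open>bfact_matrix\<close>
  is the case of all positions.\<close>

lemma bfact_entries:
  assumes "finite S" and "\<And>i j. (i, j) \<in> S \<Longrightarrow> bfact 1 1 (\<lambda>_ _. U i j) (s i j)"
  shows "bfact p q (\<lambda>i j. if (i, j) \<in> S then U i j else 0) (\<Sum>(i, j)\<in>S. s i j)"
  using assms
proof (induction S)
  case empty
  then show ?case by (simp add: bfact_0)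
next
  case (insert z S)
  obtain i0 j0 where z: "z = (i0, j0)" by (cases z)
  have "bfact p q (\<lambda>i j. (if i = i0 \<and> j = j0 then U i0 j0 else 0) + (if (i, j) \<in> S then U i j else 0))
      (s i0 j0 + (\<Sum>(i, j)\<in>S. s i j))"
    using insert z by (intro bfact_add bfact_entry) auto
  moreover have "(if i = i0 \<and> j = j0 then U i0 j0 else 0) + (if (i, j) \<in> S then U i j else 0)
      = (if (i, j) \<in> insert z S then U i j else 0)" for i j
    using insert.hyps z by auto
  ultimately show ?case using insert.hyps z by simp
qed

lemma bfact_matrix:
  assumes "\<And>i j. i < p \<Longrightarrow> j < q \<Longrightarrow> bfact 1 1 (\<lambda>_ _. U i j) (s i j)"
  shows "bfact p q U (\<Sum>i<p. \<Sum>j<q. s i j)"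
proof -
  have "bfact p q (\<lambda>i j. if (i, j) \<in> {..<p} \<times> {..<q} then U i j else 0)
      (\<Sum>(i, j)\<in>{..<p} \<times> {..<q}. s i j)"
    using assms by (intro bfact_entries) auto
  also have "bfact p q (\<lambda>i j. if (i, j) \<in> {..<p} \<times> {..<q} then U i j else 0)
      (\<Sum>(i, j)\<in>{..<p} \<times> {..<q}. s i j) = bfact p q U (\<Sum>(i, j)\<in>{..<p} \<times> {..<q}. s i j)"
    by (rule bfact_cong) simp
  finally show ?thesis by (simp add: sum.cartesian_product)
qed

text \<open>Existence of a factorisation keeps the infimum defining the Haagerup norm from ranging
  over the empty set.\<close>

lemma bfact_exists_1:
  assumes "u \<in> reps" shows "\<exists>s. bfact 1 1 (\<lambda>_ _. u) s"
  using assms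
proof (induction rule: reps_induct)
  case (single x y z)
  have "factors 1 1 (\<lambda>_ _. Poly_Mapping.single (x, y) z) 1 (\<lambda>_ _. const_bcontfun z * x) (\<lambda>_ _. y)"
    using single null_minus[OF null_scale_left[OF single, of z]]
    by (simp add: factors_def mat_in_def X_mult const_in tprod_def)
  then have "bfact 1 1 (\<lambda>_ _. Poly_Mapping.single (x, y) z)
      ((sup_norm 1 1 (\<lambda>_ _. const_bcontfun z * x))\<^sup>2 + (sup_norm 1 1 (\<lambda>_ _. y))\<^sup>2)"
    unfolding bfact_def by (intro exI conjI) auto
  then show ?case by blast
qed (use bfact_0 bfact_add in blast)+

lemma bfact_exists:
  assumes "mat_in reps p q U" shows "\<exists>s. bfact p q U s"
proof -
  have "\<forall>i j. \<exists>s. i < p \<longrightarrow> j < q \<longrightarrow> bfact 1 1 (\<lambda>_ _. U i j) s"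
    using assms bfact_exists_1 by (metis mat_in_def)
  then obtain s where "\<And>i j. i < p \<Longrightarrow> j < q \<Longrightarrow> bfact 1 1 (\<lambda>_ _. U i j) (s i j)"
    by metis
  then show ?thesis using bfact_matrix by blast
qed

lemma factors_nonempty:
  "mat_in reps p q U \<Longrightarrow> {sup_norm p r x * sup_norm r q y | r x y. factors p q U r x y} \<noteq> {}"
  using bfact_exists unfolding bfact_def by blast

lemma hnorm_lessD:
  assumes "mat_in reps p q U" and "hnorm p q U < s"
  shows "\<exists>r x y. factors p q U r x y \<and> sup_norm p r x * sup_norm r q y < s"
  using cInf_lessD[OF factors_nonempty[OF assms(1)] assms(2)[unfolded hnorm_eq[OF assms(1)]]] by blast

lemma hnorm_greatest:
  assumes "mat_in reps p q U"
    and "\<And>r x y. factors p q U r x y \<Longrightarrow> s \<le> sup_norm p r x * sup_norm r q y"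
  shows "s \<le> hnorm p q U"
  unfolding hnorm_eq[OF assms(1)] by (rule cInf_greatest[OF factors_nonempty[OF assms(1)]]) (use assms in auto)

lemma hnorm_nonneg: "mat_in reps p q U \<Longrightarrow> 0 \<le> hnorm p q U"
  by (rule hnorm_greatest) auto

text \<open>Scalars cross the tensor sign, so norm can be moved from one factor to the other;
  \<open>bfact_less\<close> balances a factorisation this way.\<close>

lemma factors_scale:
  assumes f: "factors p q U r x y" and c: "c \<noteq> 0"
  shows "factors p q U r (\<lambda>i k. const_bcontfun c * x i k) (\<lambda>k j. const_bcontfun (1 / c) * y k j)"
proof -
  have bal: "pure (const_bcontfun c * x) (const_bcontfun (1 / c) * y) - pure x y \<in> null"
    if "x \<in> X" "y \<in> Y" for x y
  proof -
    have cy: "const_bcontfun (1 / c) * y \<in> Y" using that by (simp add: Y_mult const_in)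
    have "pure x (const_bcontfun c * (const_bcontfun (1 / c) * y))
        - Poly_Mapping.single (x, const_bcontfun (1 / c) * y) c \<in> null"
      by (rule null_scale_right[OF that(1) cy])
    then have 1: "pure x y - Poly_Mapping.single (x, const_bcontfun (1 / c) * y) c \<in> null"
      using c by (simp flip: mult.assoc const_bcontfun_mult)
    show ?thesis
      using null_diff[OF null_scale_left[OF that(1) cy, of c] 1] by simp
  qed
  have "U i j - tprod r (\<lambda>i k. const_bcontfun c * x i k) (\<lambda>k j. const_bcontfun (1 / c) * y k j) i j
      \<in> null" if "i < p" "j < q" for i j
  proof -
    have "(\<Sum>k<r. pure (const_bcontfun c * x i k) (const_bcontfun (1 / c) * y k j)
        - pure (x i k) (y k j)) \<in> null"
      using f that by (intro null_sum bal) (auto simp: factors_def mat_in_def)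
    then have "tprod r (\<lambda>i k. const_bcontfun c * x i k) (\<lambda>k j. const_bcontfun (1 / c) * y k j) i j
        - tprod r x y i j \<in> null"
      by (simp add: tprod_def sum_subtractf)
    moreover have "U i j - tprod r x y i j \<in> null"
      using f that by (simp add: factors_def)
    ultimately have "U i j - tprod r x y i j - (tprod r (\<lambda>i k. const_bcontfun c * x i k)
        (\<lambda>k j. const_bcontfun (1 / c) * y k j) i j - tprod r x y i j) \<in> null"
      by (rule null_diff[rotated])
    then show ?thesis by simp
  qed
  with f show ?thesis
    by (auto simp: factors_def mat_in_def X_mult Y_mult const_in)
qed

lemma bfact_less:
  assumes U: "mat_in reps p q U" and s: "hnorm p q U < s"
  shows "bfact p q U s"
proof -
  obtain r x y where f: "factors p q U r x y" and less: "sup_norm p r x * sup_norm r q y < s"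
    using hnorm_lessD[OF assms] by blast
  have "s > 0" using hnorm_nonneg[OF U] s by linarith
  define a b where "a = sup_norm p r x" and "b = sup_norm r q y"
  have ab: "a \<ge> 0" "b \<ge> 0" "a * b < s" using less by (simp_all add: a_def b_def)
  \<comment> \<open>The scaling divides by the left norm, which may vanish. It is therefore enlarged
    to a positive \<open>a'\<close> that still keeps the product of the norms below
    \<open>s\<close>.\<close>
  obtain a' where a': "a' > 0" "a \<le> a'" "a' * b \<le> s"
  proof (cases "b = 0")
    case True
    then show ?thesis using that[of "a + 1"] ab \<open>s > 0\<close> by simp
  next
    case False
    then show ?thesis using that[of "s / b"] ab \<open>s > 0\<close> by (simp add: pos_le_divide_eq)
  qed
  \<comment> \<open>This scalar brings the left norm down to at most \<open>sqrt s\<close> and turns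
    the right one into \<open>a' * b / sqrt s\<close>, again at most \<open>sqrt s\<close>.\<close>
  define t where "t = sqrt s / a'"
  have t: "t > 0" using a' \<open>s > 0\<close> by (simp add: t_def)
  let ?c = "complex_of_real t"
  have "sup_norm p r (\<lambda>i k. const_bcontfun ?c * x i k) \<le> t * a"
    using sup_norm_const_times[of p r ?c x] t by (simp add: a_def)
  also have "t * a \<le> t * a'" using t a' by simp
  also have "\<dots> = sqrt s" using a' by (simp add: t_def)
  finally have 1: "sup_norm p r (\<lambda>i k. const_bcontfun ?c * x i k) \<le> sqrt s" .
  have "sup_norm r q (\<lambda>k j. const_bcontfun (1 / ?c) * y k j) \<le> b / t"
    using sup_norm_const_times[of r q "1 / ?c" y] t by (simp add: b_def norm_divide)
  also have "b / t = a' * b / sqrt s" by (simp add: t_def)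
  also have "\<dots> \<le> s / sqrt s" using a' \<open>s > 0\<close> by (intro divide_right_mono) auto
  also have "\<dots> = sqrt s" using \<open>s > 0\<close> by (simp add: real_div_sqrt)
  finally have 2: "sup_norm r q (\<lambda>k j. const_bcontfun (1 / ?c) * y k j) \<le> sqrt s" .
  have "factors p q U r (\<lambda>i k. const_bcontfun ?c * x i k) (\<lambda>k j. const_bcontfun (1 / ?c) * y k j)"
    using t by (intro factors_scale f) simp
  then show ?thesis
    unfolding bfact_def using power_mono[OF 1, of 2] power_mono[OF 2, of 2] \<open>s > 0\<close>
    by (intro exI conjI) auto
qed

lemma hnorm_add:
  assumes U: "mat_in reps p q U" and V: "mat_in reps p q V"
  shows "hnorm p q (\<lambda>i j. U i j + V i j) \<le> hnorm p q U + hnorm p q V"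
proof (rule field_le_epsilon)
  fix e :: real assume "e > 0"
  have "bfact p q (\<lambda>i j. U i j + V i j) ((hnorm p q U + e / 2) + (hnorm p q V + e / 2))"
    using \<open>e > 0\<close> by (intro bfact_add bfact_less U V) auto
  moreover have "mat_in reps p q (\<lambda>i j. U i j + V i j)"
    using U V by (auto simp: mat_in_def add_in_reps)
  ultimately show "hnorm p q (\<lambda>i j. U i j + V i j) \<le> hnorm p q U + hnorm p q V + e"
    using hnorm_le_bfact by fastforce
qed

abbreviation hnorm1 :: "'w tens \<Rightarrow> real" where
  "hnorm1 u \<equiv> hnorm 1 1 (\<lambda>_ _. u)"

lemma hnorm_le_sum:
  assumes U: "mat_in reps p q U"
  shows "hnorm p q U \<le> (\<Sum>i<p. \<Sum>j<q. hnorm1 (U i j))"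
proof (rule field_le_epsilon)
  fix e :: real assume "e > 0"
  define d where "d = e / (real p * real q + 1)"
  have d: "d > 0" unfolding d_def using \<open>e > 0\<close> by (simp add: add_nonneg_pos)
  have "bfact p q U (\<Sum>i<p. \<Sum>j<q. hnorm1 (U i j) + d)"
    using d U by (intro bfact_matrix bfact_less) (auto simp: mat_in_def)
  then have "hnorm p q U \<le> (\<Sum>i<p. \<Sum>j<q. hnorm1 (U i j) + d)"
    by (rule hnorm_le_bfact[OF U])
  also have "\<dots> = (\<Sum>i<p. \<Sum>j<q. hnorm1 (U i j)) + real p * real q * d"
    by (simp add: sum.distrib)
  also have "real p * real q * d \<le> (real p * real q + 1) * d"
    using d by (intro mult_right_mono) auto
  also have "\<dots> = e" by (simp add: d_def add_nonneg_eq_0_iff)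
  finally show "hnorm p q U \<le> (\<Sum>i<p. \<Sum>j<q. hnorm1 (U i j)) + e" by simp
qed

lemma hnorm_entry:
  assumes U: "mat_in reps p q U" and ij: "i < p" "j < q"
  shows "hnorm1 (U i j) \<le> hnorm p q U"
proof (rule hnorm_greatest[OF U])
  fix r x y assume f: "factors p q U r x y"
  then have "factors 1 1 (\<lambda>_ _. U i j) r (\<lambda>_. x i) (\<lambda>k _. y k j)"
    using ij by (auto simp: factors_def mat_in_def tprod_def)
  then have "hnorm1 (U i j) \<le> sup_norm 1 r (\<lambda>_. x i) * sup_norm r 1 (\<lambda>k _. y k j)"
    using U ij by (intro hnorm_le_factors) (auto simp: mat_in_def)
  also have "\<dots> \<le> sup_norm p r x * sup_norm r q y"
    using ij by (intro mult_mono sup_norm_row sup_norm_col) auto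
  finally show "hnorm1 (U i j) \<le> sup_norm p r x * sup_norm r q y" .
qed

lemma hnorm1_0: "hnorm1 0 = 0"
  using hnorm_le_bfact[OF _ bfact_0[of 1 1]] hnorm_nonneg[of 1 1 "\<lambda>_ _. 0"]
  by (fastforce simp: mat_in_def zero_in_reps)

lemma hnorm_eq_null:
  assumes "mat_in reps p q U" "mat_in reps p q V"
    and "\<And>i j. i < p \<Longrightarrow> j < q \<Longrightarrow> U i j - V i j \<in> null"
  shows "hnorm p q U = hnorm p q V"
proof -
  have "cls (U i j) = cls (V i j)" if "i < p" "j < q" for i j
    using assms that by (simp add: cls_eq_iff mat_in_def)
  then show ?thesis
    by (simp add: hnorm_def mnorm_TM haagerup_norm_def)
qed

text \<open>The action can be absorbed into the row of any factorisation, where it costs at most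
  \<open>norm a\<close>.\<close>

lemma hnorm1_act:
  assumes a: "a \<in> A" and u: "u \<in> reps"
  shows "hnorm1 (left_act a u) \<le> norm a * hnorm1 u"
proof (rule field_le_epsilon)
  fix e :: real assume "e > 0"
  have u': "mat_in reps 1 1 (\<lambda>_ _. u)" using u by (simp add: mat_in_def)
  have pos: "norm a + 1 > 0" by (simp add: add_nonneg_pos)
  have "hnorm1 u < hnorm1 u + e / (norm a + 1)" using \<open>e > 0\<close> pos by simp
  then obtain r x y where f: "factors 1 1 (\<lambda>_ _. u) r x y"
    and less: "sup_norm 1 r x * sup_norm r 1 y < hnorm1 u + e / (norm a + 1)"
    using hnorm_lessD[OF u'] by blast
  have "left_act a u - tprod r (\<lambda>i k. a * x i k) y 0 0 \<in> null"
    using null_act[OF a, of "u - tprod r x y 0 0"] f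
    by (simp add: factors_def left_act_diff tprod_def left_act_sum)
  then have "factors 1 1 (\<lambda>_ _. left_act a u) r (\<lambda>i k. a * x i k) y"
    using f a by (auto simp: factors_def mat_in_def X_mult)
  then have "hnorm1 (left_act a u) \<le> sup_norm 1 r (\<lambda>i k. a * x i k) * sup_norm r 1 y"
    using a u by (intro hnorm_le_factors) (simp_all add: mat_in_def left_act_in_reps)
  also have "\<dots> \<le> norm a * sup_norm 1 r x * sup_norm r 1 y"
    by (intro mult_right_mono sup_norm_times) simp
  also have "\<dots> \<le> norm a * (hnorm1 u + e / (norm a + 1))"
    using less by (simp add: mult.assoc mult_left_mono)
  also have "\<dots> \<le> norm a * hnorm1 u + e"
    using \<open>e > 0\<close> pos by (simp add: distrib_left pos_divide_le_eq algebra_simps)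
  finally show "hnorm1 (left_act a u) \<le> norm a * hnorm1 u + e" .
qed

text \<open>Formal scaling changes coefficients, while acting by a constant function changes
  generators; they agree only modulo bilinearity. Hence the bound for scaling follows from the one
  for the action.\<close>

lemma scale_act_null: "u \<in> reps \<Longrightarrow> pm_scale c u - left_act (const_bcontfun c) u \<in> null"
proof (induction rule: reps_induct)
  case (single x y z)
  then show ?case
    using null_minus[OF null_scale[OF null_scale_left[OF single, of c], of z]]
    by (simp add: pm_scale_diff mult.commute)
next
  case (add u v)
  then show ?case
    using null_add by (simp add: pm_scale_add left_act_add add_diff_add)
qed (simp add: null_0)

lemma hnorm1_scale: "u \<in> reps \<Longrightarrow> hnorm1 (pm_scale c u) \<le> cmod c * hnorm1 u"
proof -
  assume u: "u \<in> reps"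
  have "hnorm1 (pm_scale c u) = hnorm1 (left_act (const_bcontfun c) u)"
    using u by (intro hnorm_eq_null) (auto simp: mat_in_def scale_in_reps left_act_in_reps const_in
        scale_act_null)
  also have "\<dots> \<le> norm (const_bcontfun c :: 'w \<Rightarrow>\<^sub>C complex) * hnorm1 u"
    using u by (intro hnorm1_act const_in)
  also have "\<dots> \<le> cmod c * hnorm1 u"
    using u by (intro mult_right_mono norm_const_bcontfun hnorm_nonneg) (auto simp: mat_in_def)
  finally show ?thesis .
qed

text \<open>Multiplication turns any factorisation of \<open>U\<close> into the ordinary product of
  the same two matrices, which \<open>sup_norm_mult\<close> estimates.\<close>

lemma sup_norm_mult_map:
  assumes U: "mat_in reps p q U"
  shows "sup_norm p q (\<lambda>i j. mult_map (U i j)) \<le> hnorm p q U"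
proof (rule hnorm_greatest[OF U])
  fix r x y assume f: "factors p q U r x y"
  have "mult_map (U i j) = (\<Sum>k<r. x i k * y k j)" if "i < p" "j < q" for i j
  proof -
    have "mult_map (U i j - tprod r x y i j) = 0"
      using f that by (intro mult_map_null) (simp add: factors_def)
    then show ?thesis by (simp add: mult_map_diff tprod_def mult_map_sum)
  qed
  then have "sup_norm p q (\<lambda>i j. mult_map (U i j)) = sup_norm p q (\<lambda>i j. \<Sum>k<r. x i k * y k j)"
    by (intro sup_norm_cong)
  then show "sup_norm p q (\<lambda>i j. mult_map (U i j)) \<le> sup_norm p r x * sup_norm r q y"
    by (simp add: sup_norm_mult)
qed

lemma vnorm_TM: "vnorm TM (cls u) = hnorm1 u"
  by (simp add: vnorm_def hnorm_def)

lemma seminormed_TM: "seminormed_presented A TM reps pm_scale left_act cls"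
proof -
  interpret presented A TM reps pm_scale left_act cls by (rule presented_TM)
  show ?thesis
  proof
    show "mnorm TM p q M = mnorm TM p q M'" if "\<And>i j. i < p \<Longrightarrow> j < q \<Longrightarrow> M i j = M' i j" for p q M M'
      using that by (simp add: mnorm_TM haagerup_norm_def)
    show "mnorm TM p q (\<lambda>i j. cls (M i j + M' i j))
        \<le> mnorm TM p q (\<lambda>i j. cls (M i j)) + mnorm TM p q (\<lambda>i j. cls (M' i j))"
      if "mat_in reps p q M" "mat_in reps p q M'" for p q M M'
      using hnorm_add[OF that] by (simp add: hnorm_def)
    show "mnorm TM p q (\<lambda>i j. cls (M i j)) \<le> (\<Sum>i<p. \<Sum>j<q. vnorm TM (cls (M i j)))"
      if "mat_in reps p q M" for p q M
      using hnorm_le_sum[OF that] by (simp add: vnorm_TM) (simp add: hnorm_def)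
    show "vnorm TM (cls 0) = 0" by (simp only: vnorm_TM hnorm1_0)
    show "vnorm TM (cls (pm_scale c u)) \<le> cmod c * vnorm TM (cls u)" if "u \<in> reps" for c u
      using that by (simp only: vnorm_TM hnorm1_scale)
    show "\<exists>C. \<forall>u\<in>reps. vnorm TM (cls (left_act a u)) \<le> C * vnorm TM (cls u)" if "a \<in> A" for a
      using that hnorm1_act unfolding vnorm_TM by blast
  qed
qed

end

section \<open>The module Haagerup tensor product\<close>

context two_modules
begin

interpretation TM: seminormed_presented A TM reps pm_scale left_act cls
  by (rule seminormed_TM)

abbreviation "HM \<equiv> haagerup (fun_module X) (fun_module Y) ::
  ('w \<Rightarrow>\<^sub>C complex, (nat \<Rightarrow> 'w tens set) set) op_module"

interpretation HM: presented A HM TM.Cauchy_reps "\<lambda>c s n. pm_scale c (s n)"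
  "\<lambda>a s n. left_act a (s n)" TM.lim_class
  unfolding haagerup_def by (rule TM.presented_completion)

section \<open>The multiplication map on the completed tensor product\<close>

definition mult_lim :: "(nat \<Rightarrow> 'w tens) \<Rightarrow> 'w \<Rightarrow>\<^sub>C complex" where
  "mult_lim s = lim (\<lambda>n. mult_map (s n))"

lemma norm_mult_map: "u \<in> reps \<Longrightarrow> norm (mult_map u) \<le> hnorm1 u"
  using sup_norm_mult_map[of 1 1 "\<lambda>_ _. u"] sup_norm_1_1[of "\<lambda>_ _. mult_map u"]
  by (simp add: mat_in_def)

lemma mult_lim_tendsto:
  assumes s: "s \<in> TM.Cauchy_reps"
  shows "(\<lambda>n. mult_map (s n)) \<longlonglongrightarrow> mult_lim s"
proof -
  have "Cauchy (\<lambda>n. mult_map (s n))"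
  proof (rule metric_CauchyI)
    fix e :: real assume "e > 0"
    then obtain N where N: "\<And>m n. m \<ge> N \<Longrightarrow> n \<ge> N \<Longrightarrow> hnorm1 (s m - s n) < e"
      using s unfolding TM.Cauchy_reps_def vnorm_TM by blast
    have "dist (mult_map (s m)) (mult_map (s n)) < e" if "m \<ge> N" "n \<ge> N" for m n
      using norm_mult_map[of "s m - s n"] N[OF that] s
      by (simp add: dist_norm mult_map_diff TM.Cauchy_reps_in diff_in_reps)
    then show "\<exists>N. \<forall>m\<ge>N. \<forall>n\<ge>N. dist (mult_map (s m)) (mult_map (s n)) < e" by blast
  qed
  then show ?thesis
    unfolding mult_lim_def
    using Cauchy_bcontfun_convergent convergent_LIMSEQ_iff by blast
qed

lemma mult_lim_eqI: "(\<lambda>n. mult_map (s n)) \<longlonglongrightarrow> g \<Longrightarrow> mult_lim s = g"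
  unfolding mult_lim_def by (rule limI)

lemma mult_lim_add:
  "s \<in> TM.Cauchy_reps \<Longrightarrow> t \<in> TM.Cauchy_reps \<Longrightarrow> mult_lim (s + t) = mult_lim s + mult_lim t"
  by (rule mult_lim_eqI) (auto simp: mult_map_add intro: tendsto_add mult_lim_tendsto)

lemma mult_lim_diff:
  "s \<in> TM.Cauchy_reps \<Longrightarrow> t \<in> TM.Cauchy_reps \<Longrightarrow> mult_lim (s - t) = mult_lim s - mult_lim t"
  by (rule mult_lim_eqI) (auto simp: mult_map_diff intro: tendsto_diff mult_lim_tendsto)

lemma mult_lim_scale:
  "s \<in> TM.Cauchy_reps \<Longrightarrow> mult_lim (\<lambda>n. pm_scale c (s n)) = const_bcontfun c * mult_lim s"
  by (rule mult_lim_eqI)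
    (auto simp: mult_map_scale TM.Cauchy_reps_in intro: tendsto_times_bcontfun mult_lim_tendsto)

lemma mult_lim_act:
  "s \<in> TM.Cauchy_reps \<Longrightarrow> mult_lim (\<lambda>n. left_act a (s n)) = a * mult_lim s"
  by (rule mult_lim_eqI)
    (auto simp: mult_map_act TM.Cauchy_reps_in intro: tendsto_times_bcontfun mult_lim_tendsto)

lemma mult_lim_const: "mult_lim (\<lambda>_. u) = mult_map u"
  by (rule mult_lim_eqI) simp

lemma mnorm_HM_tendsto:
  assumes "mat_in TM.Cauchy_reps p q M"
  shows "(\<lambda>n. hnorm p q (\<lambda>i j. M i j n)) \<longlonglongrightarrow> mnorm HM p q (\<lambda>i j. TM.lim_class (M i j))"
  using TM.mnorm_completion_tendsto[OF assms] by (simp add: hnorm_def haagerup_def)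

lemma vnorm_HM_tendsto:
  assumes "s \<in> TM.Cauchy_reps"
  shows "(\<lambda>n. hnorm1 (s n)) \<longlonglongrightarrow> vnorm HM (TM.lim_class s)"
  unfolding vnorm_def using assms by (intro mnorm_HM_tendsto) (simp add: mat_in_def)

text \<open>Complete contractivity survives the completion, because the entrywise errors of the
  approximating terms sum to a null sequence.\<close>

lemma sup_norm_mult_lim:
  assumes M: "mat_in TM.Cauchy_reps p q M"
  shows "sup_norm p q (\<lambda>i j. mult_lim (M i j)) \<le> mnorm HM p q (\<lambda>i j. TM.lim_class (M i j))"
proof (rule LIMSEQ_le_const)
  have "(\<lambda>n. \<Sum>i<p. \<Sum>j<q. norm (mult_lim (M i j) - mult_map (M i j n)))
      \<longlonglongrightarrow> (\<Sum>i<p. \<Sum>j<q. norm (mult_lim (M i j) - mult_lim (M i j)))"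
    using M by (intro tendsto_sum tendsto_norm tendsto_diff tendsto_const mult_lim_tendsto)
      (auto simp: mat_in_def)
  then show "(\<lambda>n. hnorm p q (\<lambda>i j. M i j n)
      + (\<Sum>i<p. \<Sum>j<q. norm (mult_lim (M i j) - mult_map (M i j n))))
      \<longlonglongrightarrow> mnorm HM p q (\<lambda>i j. TM.lim_class (M i j))"
    using tendsto_add[OF mnorm_HM_tendsto[OF M]] by fastforce
  have "sup_norm p q (\<lambda>i j. mult_lim (M i j)) \<le> hnorm p q (\<lambda>i j. M i j n)
      + (\<Sum>i<p. \<Sum>j<q. norm (mult_lim (M i j) - mult_map (M i j n)))" for n
  proof -
    have "sup_norm p q (\<lambda>i j. mult_lim (M i j))
        \<le> sup_norm p q (\<lambda>i j. mult_map (M i j n))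
          + sup_norm p q (\<lambda>i j. mult_lim (M i j) - mult_map (M i j n))"
      using sup_norm_add[of p q "\<lambda>i j. mult_map (M i j n)"
          "\<lambda>i j. mult_lim (M i j) - mult_map (M i j n)"] by simp
    moreover have "sup_norm p q (\<lambda>i j. mult_map (M i j n)) \<le> hnorm p q (\<lambda>i j. M i j n)"
      using M by (intro sup_norm_mult_map) (auto simp: mat_in_def TM.Cauchy_reps_in)
    ultimately show ?thesis
      using sup_norm_le_sum[of p q "\<lambda>i j. mult_lim (M i j) - mult_map (M i j n)"] by linarith
  qed
  then show "\<exists>N. \<forall>n\<ge>N. sup_norm p q (\<lambda>i j. mult_lim (M i j)) \<le> hnorm p q (\<lambda>i j. M i j n)
      + (\<Sum>i<p. \<Sum>j<q. norm (mult_lim (M i j) - mult_map (M i j n)))" by blast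
qed

lemma norm_mult_lim:
  "s \<in> TM.Cauchy_reps \<Longrightarrow> norm (mult_lim s) \<le> vnorm HM (TM.lim_class s)"
  using sup_norm_mult_lim[of 1 1 "\<lambda>_ _. s"] sup_norm_1_1[of "\<lambda>_ _. mult_lim s"]
  by (simp add: mat_in_def vnorm_def)

lemma mult_lim_cong:
  assumes s: "s \<in> TM.Cauchy_reps" and t: "t \<in> TM.Cauchy_reps"
    and eq: "TM.lim_class s = TM.lim_class t"
  shows "mult_lim s = mult_lim t"
proof -
  have "(\<lambda>n. mult_map (s n) - mult_map (t n)) \<longlonglongrightarrow> 0"
  proof (rule Lim_null_comparison)
    show "(\<lambda>n. hnorm1 (s n - t n)) \<longlonglongrightarrow> 0"
      using eq unfolding TM.lim_class_eq_iff[OF s t] vnorm_TM .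
    show "\<forall>\<^sub>F n in sequentially. norm (mult_map (s n) - mult_map (t n)) \<le> hnorm1 (s n - t n)"
      unfolding mult_map_diff[symmetric] using s t
      by (intro always_eventually allI norm_mult_map diff_in_reps TM.Cauchy_reps_in)
  qed
  moreover have "(\<lambda>n. mult_map (s n) - mult_map (t n)) \<longlonglongrightarrow> mult_lim s - mult_lim t"
    using s t by (intro tendsto_diff mult_lim_tendsto)
  ultimately show ?thesis
    using LIMSEQ_unique by fastforce
qed

text \<open>This is the kernel of multiplication on classes, defined before it is known to be the
  closed span by which the module tensor product is formed.\<close>

definition kernel :: "(nat \<Rightarrow> 'w tens set) set set" where
  "kernel = TM.lim_class ` {s \<in> TM.Cauchy_reps. mult_lim s = 0}"

lemma kernel_iff:
  assumes s: "s \<in> TM.Cauchy_reps"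
  shows "TM.lim_class s \<in> kernel \<longleftrightarrow> mult_lim s = 0"
proof
  assume "TM.lim_class s \<in> kernel"
  then obtain t where t: "t \<in> TM.Cauchy_reps" "mult_lim t = 0" "TM.lim_class s = TM.lim_class t"
    unfolding kernel_def by blast
  then show "mult_lim s = 0"
    using mult_lim_cong[OF s t(1,3)] by simp
qed (use s in \<open>simp add: kernel_def\<close>)

lemma kernel_subspace: "lin_subspace HM kernel"
  unfolding lin_subspace_def
proof (intro conjI ballI allI)
  show "kernel \<subseteq> pts HM"
    by (auto simp: kernel_def HM.pts_eq)
  show "vzero HM \<in> kernel"
    using mult_lim_const[of 0] HM.zero_in
    by (simp add: HM.zero_eq kernel_iff zero_fun_def)
  show "vplus HM u v \<in> kernel" if "u \<in> kernel" "v \<in> kernel" for u v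
    using that HM.plus_in by (auto simp: kernel_def HM.plus_eq mult_lim_add intro!: imageI)
  show "vscale HM c v \<in> kernel" if "v \<in> kernel" for c v
    using that TM.Cauchy_reps_scale by (auto simp: kernel_def HM.scale_eq mult_lim_scale intro!: imageI)
qed

lemma kernel_closed: "closed_in HM kernel"
  unfolding closed_in_def
proof (intro ballI impI)
  fix v assume "v \<in> pts HM" and near: "\<forall>e>0. \<exists>u\<in>kernel. vnorm HM (vminus HM v u) < e"
  then obtain s where s: "s \<in> TM.Cauchy_reps" "v = TM.lim_class s" by (auto simp: HM.pts_eq)
  have "norm (mult_lim s) < e" if e: "e > 0" for e
  proof -
    obtain t where t: "t \<in> TM.Cauchy_reps" "mult_lim t = 0"
      "vnorm HM (vminus HM v (TM.lim_class t)) < e"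
      using near[rule_format, OF e] by (auto simp: kernel_def)
    then show ?thesis
      using norm_mult_lim[OF HM.diff_in[OF s(1) t(1)]] s by (simp add: HM.vminus_eq mult_lim_diff)
  qed
  then have "mult_lim s = 0" by (metis less_irrefl zero_less_norm_iff)
  with s show "v \<in> kernel" by (simp add: kernel_iff)
qed

section \<open>The closed span of the balanced relations\<close>

lemma elem_tensor_eq: "elem_tensor (fun_module X) (fun_module Y) x y = TM.lim_class (\<lambda>_. pure x y)"
  by (simp add: elem_tensor_def TM.lim_class_def)

abbreviation "balanced \<equiv> {vminus HM
    (elem_tensor (fun_module X) (fun_module Y) (vact (fun_module X) a x) y)
    (elem_tensor (fun_module X) (fun_module Y) x (vact (fun_module Y) a y))
  | a x y. a \<in> A \<and> x \<in> pts (fun_module X) \<and> y \<in> pts (fun_module Y)}"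

lemma balanced_eq:
  assumes "a \<in> A" "x \<in> X" "y \<in> Y"
  shows "vminus HM (elem_tensor (fun_module X) (fun_module Y) (a * x) y)
      (elem_tensor (fun_module X) (fun_module Y) x (a * y))
    = TM.lim_class (\<lambda>_. pure (a * x) y - pure x (a * y))"
  using assms unfolding elem_tensor_eq
  by (subst HM.vminus_eq)
    (auto intro!: TM.Cauchy_reps_const single_in_reps X_mult Y_mult simp: fun_diff_def)

text \<open>Late terms of a sequence representing a kernel element have small products. By
  \<open>ker\<close> such a term is close to an element of any additive set containing the
  relations, and by the Cauchy property so is the whole class.\<close>

lemma closed_span_balanced:
  assumes ker: "\<And>W u e. W \<subseteq> reps \<Longrightarrow> 0 \<in> W \<Longrightarrow> (\<And>u v. u \<in> W \<Longrightarrow> v \<in> W \<Longrightarrow> u + v \<in> W) \<Longrightarrow>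
      (\<And>a x y. a \<in> A \<Longrightarrow> x \<in> X \<Longrightarrow> y \<in> Y \<Longrightarrow> pure (a * x) y - pure x (a * y) \<in> W) \<Longrightarrow>
      u \<in> reps \<Longrightarrow> e > 0 \<Longrightarrow> \<exists>w\<in>W. hnorm1 (u - w) \<le> norm (mult_map u) + e"
  shows "closed_lin_span HM balanced = kernel"
proof
  have "balanced \<subseteq> kernel"
  proof clarify
    fix a x y assume "a \<in> A" "x \<in> pts (fun_module X)" "y \<in> pts (fun_module Y)"
    then have axy: "a \<in> A" "x \<in> X" "y \<in> Y" by simp_all
    have "(\<lambda>_. pure (a * x) y - pure x (a * y)) \<in> TM.Cauchy_reps"
      using axy by (intro TM.Cauchy_reps_const diff_in_reps single_in_reps X_mult Y_mult)
    then show "vminus HM (elem_tensor (fun_module X) (fun_module Y) (vact (fun_module X) a x) y)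
        (elem_tensor (fun_module X) (fun_module Y) x (vact (fun_module Y) a y)) \<in> kernel"
      using axy by (simp add: balanced_eq kernel_iff mult_lim_const mult_map_diff ac_simps)
  qed
  then show "closed_lin_span HM balanced \<subseteq> kernel"
    unfolding closed_lin_span_def using kernel_subspace kernel_closed by blast
  show "kernel \<subseteq> closed_lin_span HM balanced"
    unfolding closed_lin_span_def
  proof (intro Inter_greatest subsetI)
    fix W v assume "W \<in> {W. lin_subspace HM W \<and> closed_in HM W \<and> balanced \<subseteq> W}" and "v \<in> kernel"
    then have sub: "lin_subspace HM W" and cl: "closed_in HM W" and bal: "balanced \<subseteq> W" by auto
    obtain s where s: "s \<in> TM.Cauchy_reps" "mult_lim s = 0" and v: "v = TM.lim_class s"
      using \<open>v \<in> kernel\<close> by (auto simp: kernel_def)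
    \<comment> \<open>Constant sequences pull \<open>W\<close> back to representatives, where
      \<open>ker\<close> applies.\<close>
    let ?W = "{w \<in> reps. TM.lim_class (\<lambda>_. w) \<in> W}"
    have "\<exists>u\<in>W. vnorm HM (vminus HM v u) < e" if "e > 0" for e
    proof -
      have e4: "e / 4 > 0" using that by simp
      obtain N where N: "\<And>m n. m \<ge> N \<Longrightarrow> n \<ge> N \<Longrightarrow> hnorm1 (s m - s n) < e / 4"
        using s(1) e4 unfolding TM.Cauchy_reps_def vnorm_TM by blast
      have "(\<lambda>n. mult_map (s n)) \<longlonglongrightarrow> 0"
        using mult_lim_tendsto[OF s(1)] s(2) by simp
      then obtain N' where N': "\<And>n. n \<ge> N' \<Longrightarrow> norm (mult_map (s n)) < e / 4"
        using LIMSEQ_D[OF _ e4] by fastforce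
      define n where "n = max N N'"
      have "\<exists>w\<in>?W. hnorm1 (s n - w) \<le> norm (mult_map (s n)) + e / 4"
      proof (rule ker)
        show "0 \<in> ?W"
          using HM.lin_subspace_0[OF sub] by (simp add: zero_in_reps zero_fun_def)
        show "u + v \<in> ?W" if "u \<in> ?W" "v \<in> ?W" for u v
          using HM.lin_subspace_add[OF sub TM.Cauchy_reps_const TM.Cauchy_reps_const, of u v] that
          by (simp add: add_in_reps plus_fun_def)
        show "pure (a * x) y - pure x (a * y) \<in> ?W" if "a \<in> A" "x \<in> X" "y \<in> Y" for a x y
        proof -
          have "vminus HM (elem_tensor (fun_module X) (fun_module Y) (a * x) y)
            (elem_tensor (fun_module X) (fun_module Y) x (a * y)) \<in> balanced"
            using that by fastforce
          then show ?thesis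
            using that bal balanced_eq[OF that]
            by (auto intro: diff_in_reps single_in_reps X_mult Y_mult)
        qed
      qed (use s e4 TM.Cauchy_reps_in in auto)
      then obtain w where w: "w \<in> reps" "TM.lim_class (\<lambda>_. w) \<in> W"
        "hnorm1 (s n - w) \<le> norm (mult_map (s n)) + e / 4" by auto
      have sw: "s - (\<lambda>_. w) \<in> TM.Cauchy_reps"
        by (intro HM.diff_in s TM.Cauchy_reps_const w)
      \<comment> \<open>The Cauchy tail, the norm of the product and the error in \<open>ker\<close>
        contribute a quarter of \<open>e\<close> each.\<close>
      have "vnorm HM (TM.lim_class (s - (\<lambda>_. w))) \<le> 3 * e / 4"
      proof (rule LIMSEQ_le_const2[OF vnorm_HM_tendsto[OF sw]], intro exI allI impI)
        fix m assume "m \<ge> n"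
        then have "hnorm1 (s m - s n) < e / 4"
          by (intro N) (auto simp: n_def)
        moreover have "hnorm1 (s m - w) \<le> hnorm1 (s m - s n) + hnorm1 (s n - w)"
          using hnorm_add[of 1 1 "\<lambda>_ _. s m - s n" "\<lambda>_ _. s n - w"] s w
          by (simp add: mat_in_def diff_in_reps TM.Cauchy_reps_in)
        ultimately show "hnorm1 ((s - (\<lambda>_. w)) m) \<le> 3 * e / 4"
          using w(3) N'[of n] by (simp add: n_def)
      qed
      also have "\<dots> < e" using that by simp
      finally show ?thesis
        using w s v TM.Cauchy_reps_const[OF w(1)] by (auto simp: HM.vminus_eq intro!: bexI[of _ "TM.lim_class (\<lambda>_. w)"])
    qed
    then show "v \<in> W"
      using cl s v unfolding closed_in_def HM.pts_eq by blast
  qed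
qed

text \<open>Lifting the residual again costs only about its own norm. The residuals are halved at
  each step, so the corrections form a geometric series and the error vanishes in the limit.\<close>

lemma exact_lift:
  assumes Z_diff: "\<And>g h. g \<in> Z \<Longrightarrow> h \<in> Z \<Longrightarrow> g - h \<in> Z"
    and mult_Z: "\<And>u. u \<in> reps \<Longrightarrow> mult_map u \<in> Z"
    and lift: "\<And>G e. mat_in Z n n G \<Longrightarrow> e > 0 \<Longrightarrow> \<exists>U. mat_in reps n n U
      \<and> hnorm n n U \<le> sup_norm n n G + e \<and> sup_norm n n (\<lambda>i j. G i j - mult_map (U i j)) \<le> e"
    and G: "mat_in Z n n G" and e: "e > 0"
  shows "\<exists>t. mat_in TM.Cauchy_reps n n t \<and> (\<forall>i<n. \<forall>j<n. mult_lim (t i j) = G i j)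
    \<and> mnorm HM n n (\<lambda>i j. TM.lim_class (t i j)) \<le> sup_norm n n G + e"
proof -
  \<comment> \<open>The first lift exceeds the norm of \<open>G\<close> by at most \<open>d\<close>,
    and correction \<open>k\<close> costs at most \<open>2 * d / 2 ^ k\<close>, hence
    \<open>4 * d\<close> altogether. The total excess is \<open>5 * d\<close>; the partial sums give
    the term \<open>5 - 4 / 2 ^ k\<close> below.\<close>
  define d where "d = e / 5"
  have d: "d > 0" using e by (simp add: d_def)
  let ?P = "\<lambda>k S. mat_in reps n n S \<and> sup_norm n n (\<lambda>i j. G i j - mult_map (S i j)) \<le> d / 2 ^ k
    \<and> hnorm n n S \<le> sup_norm n n G + d * (5 - 4 / 2 ^ k)"
  let ?Q = "\<lambda>k S S'. \<forall>i<n. \<forall>j<n. hnorm1 (S' i j - S i j) \<le> 2 * d / 2 ^ k"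
  have "\<exists>f. \<forall>k. ?P k (f k) \<and> ?Q k (f k) (f (Suc k))"
  proof (rule dependent_nat_choice)
    show "\<exists>S. ?P 0 S" using lift[OF G d] by (auto simp: conj_commute)
    fix S k assume P: "?P k S"
    then have S: "mat_in reps n n S" by simp
    have "mat_in Z n n (\<lambda>i j. G i j - mult_map (S i j))"
      using G S unfolding mat_in_def by (intro allI impI Z_diff mult_Z) blast+
    moreover have "d / 2 ^ Suc k > 0" using d by simp
    ultimately obtain U where U: "mat_in reps n n U"
      "hnorm n n U \<le> sup_norm n n (\<lambda>i j. G i j - mult_map (S i j)) + d / 2 ^ Suc k"
      "sup_norm n n (\<lambda>i j. G i j - mult_map (S i j) - mult_map (U i j)) \<le> d / 2 ^ Suc k"
      using lift by blast
    have "d / 2 ^ k + d / 2 ^ Suc k \<le> 2 * d / 2 ^ k"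
      using d by (simp add: field_simps)
    with U(2) P have U2: "hnorm n n U \<le> 2 * d / 2 ^ k" by linarith
    have "?P (Suc k) (\<lambda>i j. S i j + U i j)"
    proof (intro conjI)
      show "mat_in reps n n (\<lambda>i j. S i j + U i j)"
        using S U(1) by (auto simp: mat_in_def add_in_reps)
      show "sup_norm n n (\<lambda>i j. G i j - mult_map (S i j + U i j)) \<le> d / 2 ^ Suc k"
        using U(3) by (simp add: mult_map_add diff_diff_eq)
      have "2 * d / 2 ^ k + d * (5 - 4 / 2 ^ k) = d * (5 - 4 / 2 ^ Suc k)"
        by (simp add: field_simps)
      then show "hnorm n n (\<lambda>i j. S i j + U i j) \<le> sup_norm n n G + d * (5 - 4 / 2 ^ Suc k)"
        using hnorm_add[OF S U(1)] U2 P by linarith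
    qed
    moreover have "?Q k S (\<lambda>i j. S i j + U i j)"
      using hnorm_entry[OF U(1)] U2 by (auto intro: order_trans)
    ultimately show "\<exists>S'. ?P (Suc k) S' \<and> ?Q k S S'" by blast
  qed
  then obtain f where P: "\<And>k. ?P k (f k)" and Q: "\<And>k. ?Q k (f k) (f (Suc k))" by blast
  have null: "(\<lambda>k. d / 2 ^ k) \<longlonglongrightarrow> 0" by (rule LIMSEQ_divide_realpow_zero) simp
  define t where "t i j k = f k i j" for i j k
  have t: "mat_in TM.Cauchy_reps n n t"
    unfolding mat_in_def
  proof (intro allI impI)
    fix i j assume "i < n" "j < n"
    then show "t i j \<in> TM.Cauchy_reps"
      using P Q by (intro TM.Cauchy_reps_geometric[of _ "2 * d"])
        (auto simp: t_def mat_in_def vnorm_TM)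
  qed
  moreover have "mult_lim (t i j) = G i j" if "i < n" "j < n" for i j
  proof (rule mult_lim_eqI)
    have "norm (mult_map (t i j k) - G i j) \<le> d / 2 ^ k" for k
    proof -
      have "norm (G i j - mult_map (f k i j)) \<le> sup_norm n n (\<lambda>i j. G i j - mult_map (f k i j))"
        using that by (rule norm_le_sup_norm)
      then show ?thesis using P[of k] by (simp add: t_def norm_minus_commute)
    qed
    then have "(\<lambda>k. mult_map (t i j k) - G i j) \<longlonglongrightarrow> 0"
      by (intro Lim_null_comparison[OF _ null]) simp
    then show "(\<lambda>k. mult_map (t i j k)) \<longlonglongrightarrow> G i j" by (simp add: LIM_zero_iff)
  qed
  moreover have "mnorm HM n n (\<lambda>i j. TM.lim_class (t i j)) \<le> sup_norm n n G + e"
  proof (rule LIMSEQ_le_const2[OF mnorm_HM_tendsto[OF t]], intro exI allI impI)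
    fix k
    have "d * (5 - 4 / 2 ^ k) \<le> e"
      using d by (simp add: d_def right_diff_distrib)
    then show "hnorm n n (\<lambda>i j. t i j k) \<le> sup_norm n n G + e"
      using P[of k] by (simp add: t_def)
  qed
  ultimately show ?thesis by blast
qed

text \<open>The isomorphism is reduced to \<open>lift\<close> and \<open>ker\<close>, both
  statements about finite tensors. The kernel description makes multiplication injective on cosets,
  and exact lifts of single functions make it surjective.\<close>

theorem module_haagerup_iso:
  assumes Z: "closed Z" and Z_diff: "\<And>g h. g \<in> Z \<Longrightarrow> h \<in> Z \<Longrightarrow> g - h \<in> Z"
    and mult_Z: "\<And>u. u \<in> reps \<Longrightarrow> mult_map u \<in> Z"
    and lift: "\<And>n G e. mat_in Z n n G \<Longrightarrow> e > 0 \<Longrightarrow> \<exists>U. mat_in reps n n U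
      \<and> hnorm n n U \<le> sup_norm n n G + e \<and> sup_norm n n (\<lambda>i j. G i j - mult_map (U i j)) \<le> e"
    and ker: "\<And>W u e. W \<subseteq> reps \<Longrightarrow> 0 \<in> W \<Longrightarrow> (\<And>u v. u \<in> W \<Longrightarrow> v \<in> W \<Longrightarrow> u + v \<in> W) \<Longrightarrow>
      (\<And>a x y. a \<in> A \<Longrightarrow> x \<in> X \<Longrightarrow> y \<in> Y \<Longrightarrow> pure (a * x) y - pure x (a * y) \<in> W) \<Longrightarrow>
      u \<in> reps \<Longrightarrow> e > 0 \<Longrightarrow> \<exists>w\<in>W. hnorm1 (u - w) \<le> norm (mult_map u) + e"
  shows "completely_isometric_iso A (module_haagerup A (fun_module X) (fun_module Y)) (fun_module Z)"
proof -
  let ?Q = "quot_module HM kernel"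
  let ?c = "\<lambda>s. vcoset HM kernel (TM.lim_class s)"
  have eq: "module_haagerup A (fun_module X) (fun_module Y) = ?Q"
    unfolding module_haagerup_def by (subst closed_span_balanced) (use ker in auto)
  interpret Q: presented A ?Q TM.Cauchy_reps "\<lambda>c s n. pm_scale c (s n)" "\<lambda>a s n. left_act a (s n)" ?c
    by (rule HM.presented_quot[OF kernel_subspace])
      (simp add: kernel_iff TM.Cauchy_reps_act mult_lim_act)
  have exact: "\<exists>t. mat_in TM.Cauchy_reps n n t \<and> (\<forall>i<n. \<forall>j<n. mult_lim (t i j) = G i j)
      \<and> mnorm HM n n (\<lambda>i j. TM.lim_class (t i j)) \<le> sup_norm n n G + e"
    if "mat_in Z n n G" "e > 0" for n G e
    by (intro exact_lift[where Z = Z] Z_diff mult_Z lift that)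
  have in_Z: "mult_lim s \<in> Z" if "s \<in> TM.Cauchy_reps" for s
    using closed_sequentially[OF Z _ mult_lim_tendsto[OF that]] that mult_Z TM.Cauchy_reps_in by blast
  have "completely_isometric_iso A ?Q (fun_module Z)"
  proof (rule Q.completely_isometric_isoI[where E = mult_lim])
    show "?c s = ?c t \<longleftrightarrow> mult_lim s = mult_lim t" if "s \<in> TM.Cauchy_reps" "t \<in> TM.Cauchy_reps" for s t
      using that by (simp add: HM.vcoset_eq_iff[OF kernel_subspace] kernel_iff HM.diff_in mult_lim_diff)
    show "mult_lim ` TM.Cauchy_reps = pts (fun_module Z)"
    proof (intro equalityI subsetI)
      fix g assume "g \<in> pts (fun_module Z)"
      then have "mat_in Z 1 1 (\<lambda>_ _. g)" by (simp add: mat_in_def)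
      then obtain t where "mat_in TM.Cauchy_reps 1 1 t" "\<forall>i<1. \<forall>j<1. mult_lim (t i j) = g"
        using exact[of 1 "\<lambda>_ _. g" 1] by auto
      then show "g \<in> mult_lim ` TM.Cauchy_reps" by (auto simp: mat_in_def)
    qed (auto simp: in_Z)
    show "mnorm (fun_module Z) n n (\<lambda>i j. mult_lim (M i j)) = mnorm ?Q n n (\<lambda>i j. ?c (M i j))"
      if M: "mat_in TM.Cauchy_reps n n M" for n M
    proof -
      let ?S = "{mnorm HM n n m | m. \<forall>i<n. \<forall>j<n. m i j \<in> ?c (M i j)}"
      let ?g = "sup_norm n n (\<lambda>i j. mult_lim (M i j))"
      \<comment> \<open>A coset consists of all classes with a fixed product, so the quotient norm
        is an infimum over exact lifts.\<close>
      have mem: "m \<in> ?c s \<longleftrightarrow> (\<exists>t\<in>TM.Cauchy_reps. m = TM.lim_class t \<and> mult_lim t = mult_lim s)"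
        if "s \<in> TM.Cauchy_reps" for m s
        using that by (auto simp: HM.vcoset_eq kernel_iff HM.diff_in mult_lim_diff)
      have ge: "?g \<le> x" if "x \<in> ?S" for x
      proof -
        obtain m where x: "x = mnorm HM n n m" and m: "\<forall>i<n. \<forall>j<n. m i j \<in> ?c (M i j)"
          using \<open>x \<in> ?S\<close> by blast
        have "\<forall>i j. \<exists>t. i < n \<longrightarrow> j < n \<longrightarrow>
            t \<in> TM.Cauchy_reps \<and> m i j = TM.lim_class t \<and> mult_lim t = mult_lim (M i j)"
          using m M mem unfolding mat_in_def by meson
        then have "\<exists>t. \<forall>i j. i < n \<longrightarrow> j < n \<longrightarrow>
            t i j \<in> TM.Cauchy_reps \<and> m i j = TM.lim_class (t i j) \<and> mult_lim (t i j) = mult_lim (M i j)"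
          by (simp only: choice_iff)
        then obtain t where t: "\<forall>i j. i < n \<longrightarrow> j < n \<longrightarrow>
            t i j \<in> TM.Cauchy_reps \<and> m i j = TM.lim_class (t i j) \<and> mult_lim (t i j) = mult_lim (M i j)" ..
        have "?g = sup_norm n n (\<lambda>i j. mult_lim (t i j))"
          using t by (intro sup_norm_cong) simp
        also have "\<dots> \<le> mnorm HM n n (\<lambda>i j. TM.lim_class (t i j))"
          using t by (intro sup_norm_mult_lim) (simp add: mat_in_def)
        also have "\<dots> = x"
          unfolding x haagerup_def using t by (intro TM.mnorm_completion_local) simp
        finally show ?thesis .
      qed
      \<comment> \<open>The classes of an exact lift lie in the prescribed cosets, so their norm
        competes in the infimum.\<close>
      have le: "\<exists>x\<in>?S. x \<le> ?g + e" if "e > 0" for e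
      proof -
        have "mat_in Z n n (\<lambda>i j. mult_lim (M i j))"
          using M by (auto simp: mat_in_def in_Z)
        from exact[OF this that] obtain t where t: "mat_in TM.Cauchy_reps n n t"
          "\<forall>i<n. \<forall>j<n. mult_lim (t i j) = mult_lim (M i j)"
          "mnorm HM n n (\<lambda>i j. TM.lim_class (t i j)) \<le> ?g + e" by blast
        have "\<forall>i<n. \<forall>j<n. TM.lim_class (t i j) \<in> ?c (M i j)"
        proof (intro allI impI)
          fix i j assume ij: "i < n" "j < n"
          then have "M i j \<in> TM.Cauchy_reps" "t i j \<in> TM.Cauchy_reps"
            using M t(1) by (simp_all add: mat_in_def)
          then show "TM.lim_class (t i j) \<in> ?c (M i j)"
            using t(2) ij by (subst mem) auto
        qed
        then show ?thesis
          using t(3) by (intro bexI[of _ "mnorm HM n n (\<lambda>i j. TM.lim_class (t i j))"] CollectI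
              exI[of _ "\<lambda>i j. TM.lim_class (t i j)"] conjI refl)
      qed
      have "?g = Inf ?S"
      proof (rule antisym)
        have "?S \<noteq> {}" using le[of 1] by auto
        then show "?g \<le> Inf ?S" using ge by (rule cInf_greatest)
        have bdd: "bdd_below ?S" using ge by (rule bdd_belowI)
        show "Inf ?S \<le> ?g"
        proof (rule field_le_epsilon)
          fix e :: real assume "e > 0"
          then obtain x where "x \<in> ?S" "x \<le> ?g + e" using le by blast
          then show "Inf ?S \<le> ?g + e" using cInf_lower[OF _ bdd] order_trans by blast
        qed
      qed
      then show ?thesis by (simp add: quot_module_def)
    qed
    show "mnorm ?Q p q M = mnorm ?Q p q M'" if "\<And>i j. i < p \<Longrightarrow> j < q \<Longrightarrow> M i j = M' i j" for p q M M'
    proof -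
      have "(\<forall>i<p. \<forall>j<q. m i j \<in> M i j) \<longleftrightarrow> (\<forall>i<p. \<forall>j<q. m i j \<in> M' i j)" for m
        using that by auto
      then show ?thesis by (simp add: quot_module_def)
    qed
  qed (auto simp: mult_lim_add mult_lim_scale mult_lim_act intro: sup_norm_cong)
  then show ?thesis by (simp add: eq)
qed

end

context two_modules
begin

section \<open>Estimates for sums of elementary tensors\<close>

lemma hnorm1_add: "u \<in> reps \<Longrightarrow> v \<in> reps \<Longrightarrow> hnorm1 (u + v) \<le> hnorm1 u + hnorm1 v"
  using hnorm_add[of 1 1 "\<lambda>_ _. u" "\<lambda>_ _. v"] by (simp add: mat_in_def)

lemma hnorm1_null: "u \<in> null \<Longrightarrow> hnorm1 u = 0"
  using hnorm_eq_null[of 1 1 "\<lambda>_ _. u" "\<lambda>_ _. 0"] hnorm1_0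
  by (simp add: mat_in_def null_reps zero_in_reps)

lemma hnorm1_pure:
  assumes "x \<in> X" "y \<in> Y"
  shows "hnorm1 (pure x y) \<le> norm x * norm y"
proof -
  have "hnorm1 (pure x y) \<le> sup_norm 1 1 (\<lambda>_ _. x) * sup_norm 1 1 (\<lambda>_ _. y)"
    using assms
    by (intro hnorm_le_factors) (simp_all add: mat_in_def single_in_reps factors_def tprod_def null_0)
  then show ?thesis by (simp only: sup_norm_1_1)
qed

lemma hnorm1_add_null:
  assumes u: "u \<in> reps" and v: "v \<in> null"
  shows "hnorm1 (u + v) = hnorm1 u"
  using assms by (intro hnorm_eq_null) (simp_all add: mat_in_def add_in_reps null_reps)

lemma sum_in_X: "(\<And>k. k \<in> K \<Longrightarrow> x k \<in> X) \<Longrightarrow> (\<Sum>k\<in>K. x k) \<in> X"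
  by (induction K rule: infinite_finite_induct) (auto intro: X_0 X_add)

lemma null_sum_left:
  assumes y: "y \<in> Y" and "finite K" and "\<And>k. k \<in> K \<Longrightarrow> x k \<in> X"
  shows "pure (\<Sum>k\<in>K. x k) y - (\<Sum>k\<in>K. pure (x k) y) \<in> null"
  using assms(2,3)
proof (induction K)
  case empty
  then show ?case by (simp add: null_zero_left y)
next
  case (insert a K)
  have "pure (x a + (\<Sum>k\<in>K. x k)) y - pure (x a) y - pure (\<Sum>k\<in>K. x k) y \<in> null"
    using insert.prems y by (intro null_add_left sum_in_X) auto
  from null_add[OF this insert.IH] insert show ?case by (simp add: diff_diff_eq add_diff_eq)
qed

text \<open>The elementary tensors \<open>x\<^sub>l \<otimes> k\<^sub>l g\<^sub>i\<^sub>j\<close>, summed over \<open>l\<close>, are the entries of the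
  product of the row of blocks \<open>x\<^sub>l I\<close> and the column of blocks \<open>k\<^sub>l g\<close>. The index of the
  inner sum encodes the pair of the block and the position within it.\<close>

lemma hnorm_block_le:
  fixes f :: "'w \<Rightarrow>\<^sub>C complex"
  assumes x: "\<And>l. l < L \<Longrightarrow> x l \<in> X" and k: "\<And>l. l < L \<Longrightarrow> k l \<in> A"
    and g: "mat_in Y n n g"
    and x_norm: "\<And>w. l2norm L (\<lambda>l. x l w) \<le> 1"
    and k_norm: "\<And>w. l2norm L (\<lambda>l. k l w) \<le> cmod (f w)"
  shows "hnorm n n (\<lambda>i j. \<Sum>l<L. pure (x l) (k l * g i j)) \<le> sup_norm n n (\<lambda>i j. f * g i j)"
proof -
  let ?x = "\<lambda>i m. if m mod n = i then x (m div n) else 0"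
  let ?y = "\<lambda>m j. k (m div n) * g (m mod n) j"
  have dm: "m div n < L" "m mod n < n" if "m < L * n" for m
    using that by (auto simp: less_mult_imp_div_less) (metis less_nat_zero_code mod_less_divisor mult_0_right neq0_conv)
  have "(\<Sum>l<L. pure (x l) (k l * g i j)) - tprod (L * n) ?x ?y i j \<in> null" if ij: "i < n" "j < n" for i j
  proof -
    \<comment> \<open>Where \<open>i'\<close> differs from \<open>i\<close>, the matrix product
      contains a tensor with zero left factor and the given sum contains nothing; these differences
      are null.\<close>
    let ?d = "\<lambda>l i'. (if i' = i then pure (x l) (k l * g i' j) else 0)
      - pure (if i' = i then x l else 0) (k l * g i' j)"
    have "(\<Sum>i'<n. if i' = i then pure (x l) (k l * g i' j) else 0) = pure (x l) (k l * g i j)" for l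
      using ij by simp
    then have "(\<Sum>l<L. pure (x l) (k l * g i j)) - tprod (L * n) ?x ?y i j = (\<Sum>l<L. \<Sum>i'<n. ?d l i')"
      using sum_lessThan_mult[of "\<lambda>l i'. pure (if i' = i then x l else 0) (k l * g i' j)" n L]
      by (simp add: tprod_def sum_subtractf)
    also have "\<dots> \<in> null"
      using k g ij by (intro null_sum)
        (auto simp: null_0 mat_in_def intro!: null_minus null_zero_left Y_mult)
    finally show ?thesis .
  qed
  then have fac: "factors n n (\<lambda>i j. \<Sum>l<L. pure (x l) (k l * g i j)) (L * n) ?x ?y"
    using x k g dm by (auto simp: factors_def mat_in_def X_0 Y_mult)
  have "sup_norm n (L * n) ?x \<le> 1"
  proof (rule sup_norm_le)
    fix w and z :: "nat \<Rightarrow> complex"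
    let ?z = "\<lambda>l i. z (l * n + i)"
    have row: "eval_vec (L * n) ?x w z i = (\<Sum>l<L. x l w * ?z l i)" if "i < n" for i
    proof -
      have "eval_vec (L * n) ?x w z i
          = (\<Sum>m<L * n. (if m mod n = i then x (m div n) w else 0) * ?z (m div n) (m mod n))"
        by (intro sum.cong) auto
      also have "\<dots> = (\<Sum>l<L. \<Sum>i'<n. (if i' = i then x l w else 0) * ?z l i')"
        by (rule sum_lessThan_mult[of "\<lambda>l i'. (if i' = i then x l w else 0) * ?z l i'"])
      also have "\<dots> = (\<Sum>l<L. x l w * ?z l i)"
        using that by (simp add: if_distrib[of "\<lambda>c. c * _"] cong: if_cong)
      finally show ?thesis .
    qed
    \<comment> \<open>Component \<open>i\<close> of the output involves only component
      \<open>i\<close> of each block of \<open>z\<close>, so Cauchy-Schwarz over the blocks and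
      \<open>x_norm\<close> apply to each \<open>i\<close> separately.\<close>
    have "(l2norm n (eval_vec (L * n) ?x w z))\<^sup>2 \<le> (\<Sum>i<n. \<Sum>l<L. (cmod (?z l i))\<^sup>2)"
      unfolding l2norm_power2
    proof (rule sum_mono)
      fix i assume "i \<in> {..<n}"
      then have "cmod (eval_vec (L * n) ?x w z i) \<le> l2norm L (\<lambda>l. x l w) * l2norm L (\<lambda>l. ?z l i)"
        using cmod_sum_mult_le[where q = L and a = "\<lambda>l. x l w" and z = "\<lambda>l. ?z l i"] by (simp only: row lessThan_iff)
      also have "\<dots> \<le> 1 * l2norm L (\<lambda>l. ?z l i)"
        by (intro mult_right_mono x_norm) simp
      finally have "(cmod (eval_vec (L * n) ?x w z i))\<^sup>2 \<le> (l2norm L (\<lambda>l. ?z l i))\<^sup>2"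
        by (intro power_mono) auto
      then show "(cmod (eval_vec (L * n) ?x w z i))\<^sup>2 \<le> (\<Sum>l<L. (cmod (?z l i))\<^sup>2)"
        by (simp only: l2norm_power2)
    qed
    also have "\<dots> = (\<Sum>m<L * n. (cmod (?z (m div n) (m mod n)))\<^sup>2)"
      by (subst sum.swap) (rule sum_lessThan_mult[symmetric])
    also have "\<dots> = (l2norm (L * n) z)\<^sup>2"
      by (simp add: l2norm_power2)
    finally have "l2norm n (eval_vec (L * n) ?x w z) \<le> l2norm (L * n) z"
      by (rule power2_le_imp_le) simp
    then show "l2norm n (eval_vec (L * n) ?x w z) \<le> 1 * l2norm (L * n) z"
      by (simp only: mult_1)
  qed simp
  moreover have "sup_norm (L * n) n ?y \<le> sup_norm n n (\<lambda>i j. f * g i j)"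
  proof (rule sup_norm_le)
    fix w and z :: "nat \<Rightarrow> complex"
    let ?v = "eval_vec n g w z"
    have "eval_vec n ?y w z m = k (m div n) w * ?v (m mod n)" for m
      by (simp add: sum_distrib_left mult.assoc)
    then have "(l2norm (L * n) (eval_vec n ?y w z))\<^sup>2
        = (\<Sum>m<L * n. (cmod (k (m div n) w))\<^sup>2 * (cmod (?v (m mod n)))\<^sup>2)"
      unfolding l2norm_power2 by (simp only: norm_mult power_mult_distrib)
    also have "\<dots> = (\<Sum>l<L. \<Sum>i<n. (cmod (k l w))\<^sup>2 * (cmod (?v i))\<^sup>2)"
      by (rule sum_lessThan_mult[of "\<lambda>l i. (cmod (k l w))\<^sup>2 * (cmod (?v i))\<^sup>2"])
    \<comment> \<open>The column sends \<open>z\<close> to the Kronecker product of the values of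
      \<open>k\<close> with \<open>?v\<close>, whose norm is the product of the two norms;
      \<open>k_norm\<close> then replaces the first factor by the size of \<open>f\<close>.\<close>
    also have "\<dots> = (l2norm L (\<lambda>l. k l w))\<^sup>2 * (l2norm n ?v)\<^sup>2"
      by (simp only: l2norm_power2 sum_product)
    also have "\<dots> \<le> (cmod (f w))\<^sup>2 * (l2norm n ?v)\<^sup>2"
      by (intro mult_right_mono power_mono k_norm) auto
    also have "\<dots> = (l2norm n (\<lambda>i. f w * ?v i))\<^sup>2"
      by (simp only: l2norm_scale power_mult_distrib)
    also have "(\<lambda>i. f w * ?v i) = eval_vec n (\<lambda>i j. f * g i j) w z"
      by (simp add: sum_distrib_left mult.assoc)
    also have "(l2norm n (eval_vec n (\<lambda>i j. f * g i j) w z))\<^sup>2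
        \<le> (sup_norm n n (\<lambda>i j. f * g i j) * l2norm n z)\<^sup>2"
      by (intro power_mono sup_norm_apply) simp
    finally show "l2norm (L * n) (eval_vec n ?y w z) \<le> sup_norm n n (\<lambda>i j. f * g i j) * l2norm n z"
      by (rule power2_le_imp_le) simp
  qed simp
  ultimately have "sup_norm n (L * n) ?x * sup_norm (L * n) n ?y
      \<le> 1 * sup_norm n n (\<lambda>i j. f * g i j)"
    by (intro mult_mono) auto
  moreover have "mat_in reps n n (\<lambda>i j. \<Sum>l<L. pure (x l) (k l * g i j))"
    using x k g by (auto simp: mat_in_def intro!: sum_in_reps single_in_reps Y_mult)
  ultimately show ?thesis
    using hnorm_le_factors[OF _ fac] by fastforce
qed

end

section \<open>Closures of principal submodules\<close>

abbreviation closed_principal ::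
  "('w::topological_space \<Rightarrow>\<^sub>C complex) set \<Rightarrow> ('w \<Rightarrow>\<^sub>C complex) \<Rightarrow> ('w \<Rightarrow>\<^sub>C complex) set" where
  "closed_principal A f \<equiv> closure ((\<lambda>a. a * f) ` A)"

lemma principal_approx:
  assumes "x \<in> closed_principal A f" and "e > 0"
  obtains a where "a \<in> A" and "norm (x - a * f) < e"
  using assms by (auto simp: closure_approachable dist_norm norm_minus_commute)

text \<open>\<open>approximate_unit\<close> extracts what the module statement needs of the two
  sequences: for each tolerance one pair of tuples suffices, with the limit on compact sets turned
  into a norm estimate.\<close>

locale principal_modules =
  fixes A :: "('w::topological_space \<Rightarrow>\<^sub>C complex) set" and f1 f2 :: "'w \<Rightarrow>\<^sub>C complex"
  assumes const_A: "const_bcontfun c \<in> A"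
    and add_A: "a \<in> A \<Longrightarrow> b \<in> A \<Longrightarrow> a + b \<in> A"
    and mult_A: "a \<in> A \<Longrightarrow> b \<in> A \<Longrightarrow> a * b \<in> A"
    and approximate_unit: "e > 0 \<Longrightarrow> \<exists>L h k. (\<forall>l<L. h l \<in> A \<and> k l \<in> A)
      \<and> (\<forall>w. l2norm L (\<lambda>l. apply_bcontfun (h l * f1) w) \<le> 1)
      \<and> (\<forall>w. l2norm L (\<lambda>l. apply_bcontfun (k l) w) \<le> cmod (apply_bcontfun f1 w))
      \<and> norm (f1 - (\<Sum>l<L. k l * (h l * f1))) \<le> e"
begin

lemma zero_A: "0 \<in> A"
  using const_A[of 0] by simp

lemma one_A: "1 \<in> A"
  using const_A[of 1] by simp

lemma minus_A: "a \<in> A \<Longrightarrow> - a \<in> A"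
  using mult_A[OF const_A[of "-1"], of a] by simp

lemma principal_memI: "a \<in> A \<Longrightarrow> a * f \<in> closed_principal A f"
  by (rule subsetD[OF closure_subset]) simp

lemma principal_0: "0 \<in> closed_principal A f"
  using principal_memI[OF zero_A, of f] by simp

lemma principal_self: "f \<in> closed_principal A f"
  using principal_memI[OF one_A, of f] by simp

lemma principal_add:
  assumes "x \<in> closed_principal A f" "y \<in> closed_principal A f"
  shows "x + y \<in> closed_principal A f"
proof -
  have 1: "a * f + y \<in> closed_principal A f" if a: "a \<in> A" for a
  proof -
    obtain s where s: "\<And>n. s n \<in> (\<lambda>a. a * f) ` A" "s \<longlonglongrightarrow> y"
      using assms(2) unfolding closure_sequential by blast
    have "a * f + s n \<in> closed_principal A f" for n
    proof -
      obtain b where "b \<in> A" "s n = b * f" using s(1)[of n] by auto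
      then show ?thesis
        using principal_memI[OF add_A[OF a], of b f] by (simp add: distrib_right)
    qed
    then show ?thesis
      by (rule closed_sequentially[OF closed_closure _ tendsto_add[OF tendsto_const s(2)]])
  qed
  obtain s where s: "\<And>n. s n \<in> (\<lambda>a. a * f) ` A" "s \<longlonglongrightarrow> x"
    using assms(1) unfolding closure_sequential by blast
  have "s n + y \<in> closed_principal A f" for n
    using s(1)[of n] 1 by auto
  then show ?thesis
    by (rule closed_sequentially[OF closed_closure _ tendsto_add[OF s(2) tendsto_const]])
qed

lemma principal_mult:
  assumes a: "a \<in> A" and x: "x \<in> closed_principal A f"
  shows "a * x \<in> closed_principal A f"
proof -
  obtain s where s: "\<And>n. s n \<in> (\<lambda>a. a * f) ` A" "s \<longlonglongrightarrow> x"
    using x unfolding closure_sequential by blast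
  have "a * s n \<in> closed_principal A f" for n
    using s(1)[of n] a by (auto simp: mult_A principal_memI simp flip: mult.assoc)
  then show ?thesis
    by (rule closed_sequentially[OF closed_closure _ tendsto_times_bcontfun[OF s(2)]])
qed

text \<open>Multiplication by a fixed function is continuous, so the two closures can be handled one
  factor at a time.\<close>

lemma principal_times:
  assumes x: "x \<in> closed_principal A f" and y: "y \<in> closed_principal A g"
  shows "x * y \<in> closed_principal A (f * g)"
proof -
  have 1: "a * f * y \<in> closed_principal A (f * g)" if a: "a \<in> A" for a
  proof -
    obtain s where s: "\<And>n. s n \<in> (\<lambda>a. a * g) ` A" "s \<longlonglongrightarrow> y"
      using y unfolding closure_sequential by blast
    have "a * f * s n \<in> closed_principal A (f * g)" for n
    proof -
      obtain b where "b \<in> A" "s n = b * g" using s(1)[of n] by auto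
      then show ?thesis
        using principal_memI[OF mult_A[OF a], of b "f * g"] by (simp add: ac_simps)
    qed
    then show ?thesis
      by (rule closed_sequentially[OF closed_closure _ tendsto_times_bcontfun[OF s(2)]])
  qed
  obtain s where s: "\<And>n. s n \<in> (\<lambda>a. a * f) ` A" "s \<longlonglongrightarrow> x"
    using x unfolding closure_sequential by blast
  have "y * s n \<in> closed_principal A (f * g)" for n
    using s(1)[of n] 1 by (auto simp: ac_simps)
  then have "y * x \<in> closed_principal A (f * g)"
    by (rule closed_sequentially[OF closed_closure _ tendsto_times_bcontfun[OF s(2)]])
  then show ?thesis by (simp add: mult.commute)
qed

sublocale two_modules A "closed_principal A f1" "closed_principal A f2"
  by unfold_locales (auto intro: const_A principal_0 principal_add principal_mult)

lemma principal_diff: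
  assumes "x \<in> closed_principal A f" "y \<in> closed_principal A f"
  shows "x - y \<in> closed_principal A f"
  using principal_add[OF assms(1) principal_mult[OF minus_A[OF one_A] assms(2)]] by simp

lemma mult_map_principal: "u \<in> reps \<Longrightarrow> mult_map u \<in> closed_principal A (f1 * f2)"
  by (induction rule: reps_induct)
    (auto simp: mult_map_add intro: principal_0 principal_add principal_mult principal_times const_A)

lemma lift_approx:
  assumes G: "mat_in (closed_principal A (f1 * f2)) n n G" and e: "e > 0"
  shows "\<exists>U. mat_in reps n n U \<and> hnorm n n U \<le> sup_norm n n G + e
    \<and> sup_norm n n (\<lambda>i j. G i j - mult_map (U i j)) \<le> e"
proof -
  define m where "m = real n * real n + 1"
  have m: "m > 0" unfolding m_def by (simp add: add_nonneg_pos)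
  \<comment> \<open>Half of \<open>e\<close> pays for replacing \<open>G\<close> by multiples of
    \<open>f1 * f2\<close>. The other half, through \<open>d'\<close> below, pays for replacing
    \<open>f1\<close> by \<open>?q\<close>.\<close>
  define d where "d = e / (2 * m)"
  have d: "d > 0" unfolding d_def using e m by simp
  have "\<forall>i j. \<exists>c. i < n \<longrightarrow> j < n \<longrightarrow> c \<in> A \<and> norm (G i j - c * (f1 * f2)) < d"
    using principal_approx[OF _ d] G unfolding mat_in_def by metis
  then obtain c where c: "\<And>i j. i < n \<Longrightarrow> j < n \<Longrightarrow> c i j \<in> A"
    and cG: "\<And>i j. i < n \<Longrightarrow> j < n \<Longrightarrow> norm (G i j - c i j * (f1 * f2)) < d"
    by metis
  let ?g = "\<lambda>i j. c i j * f2"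
  let ?P = "\<lambda>i j. f1 * ?g i j"
  have g: "mat_in (closed_principal A f2) n n ?g"
    using c by (simp add: mat_in_def principal_memI)
  have GP: "sup_norm n n (\<lambda>i j. G i j - ?P i j) \<le> e / 2"
  proof -
    have "sup_norm n n (\<lambda>i j. G i j - ?P i j) \<le> (\<Sum>i<n. \<Sum>j<n. norm (G i j - ?P i j))"
      by (rule sup_norm_le_sum)
    also have "\<dots> \<le> (\<Sum>i<n. \<Sum>j<n. d)"
      using cG by (intro sum_mono) (simp add: ac_simps less_imp_le)
    also have "\<dots> \<le> m * d" using d by (simp add: m_def algebra_simps)
    also have "\<dots> = e / 2" using m by (simp add: d_def)
    finally show ?thesis .
  qed
  define M where "M = sup_norm n n ?g"
  have M: "M \<ge> 0" by (simp add: M_def)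
  define d' where "d' = e / (2 * (M + 1))"
  have d': "d' > 0" "d' * M \<le> e / 2"
    using M e by (simp_all add: d'_def divide_simps)
  obtain L h k where hk: "\<And>l. l < L \<Longrightarrow> h l \<in> A" "\<And>l. l < L \<Longrightarrow> k l \<in> A"
    and h_norm: "\<And>w. l2norm L (\<lambda>l. apply_bcontfun (h l * f1) w) \<le> 1"
    and k_norm: "\<And>w. l2norm L (\<lambda>l. k l w) \<le> cmod (f1 w)"
    and q: "norm (f1 - (\<Sum>l<L. k l * (h l * f1))) \<le> d'"
    using approximate_unit[OF d'(1)] by blast
  let ?q = "\<Sum>l<L. k l * (h l * f1)"
  let ?U = "\<lambda>i j. \<Sum>l<L. pure (h l * f1) (k l * ?g i j)"
  \<comment> \<open>The block estimate with \<open>f = f1\<close> bounds the lift by the norm of the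
    product itself, not by separate norms of its factors.\<close>
  have "hnorm n n ?U \<le> sup_norm n n ?P"
    using hk g h_norm k_norm by (intro hnorm_block_le) (auto intro: principal_memI)
  also have "\<dots> \<le> sup_norm n n G + sup_norm n n (\<lambda>i j. ?P i j - G i j)"
    using sup_norm_add[of n n G "\<lambda>i j. ?P i j - G i j"] by simp
  also have "sup_norm n n (\<lambda>i j. ?P i j - G i j) \<le> sup_norm n n (\<lambda>i j. G i j - ?P i j)"
    using sup_norm_const_times[of n n "-1" "\<lambda>i j. G i j - ?P i j"]
    by simp
  finally have U1: "hnorm n n ?U \<le> sup_norm n n G + e" using GP e by linarith
  have "mult_map (?U i j) = ?q * ?g i j" for i j
    unfolding mult_map_sum sum_distrib_right by (intro sum.cong) (simp_all add: ac_simps)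
  then have "sup_norm n n (\<lambda>i j. ?P i j - mult_map (?U i j)) = sup_norm n n (\<lambda>i j. (f1 - ?q) * ?g i j)"
    by (simp add: left_diff_distrib)
  also have "\<dots> \<le> norm (f1 - ?q) * M"
    unfolding M_def by (rule sup_norm_times)
  also have "\<dots> \<le> d' * M"
    using q M by (rule mult_right_mono)
  finally have "sup_norm n n (\<lambda>i j. ?P i j - mult_map (?U i j)) \<le> e / 2" using d' by simp
  then have "sup_norm n n (\<lambda>i j. G i j - mult_map (?U i j)) \<le> e"
    using sup_norm_add[of n n "\<lambda>i j. G i j - ?P i j" "\<lambda>i j. ?P i j - mult_map (?U i j)"] GP by simp
  moreover have "mat_in reps n n ?U"
    using hk c by (auto simp: mat_in_def intro!: sum_in_reps single_in_reps principal_memI principal_mult)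
  ultimately show ?thesis using U1 by blast
qed

text \<open>Modulo the relations, \<open>u\<close> is close to a single tensor
  \<open>pure f1 (c * f2)\<close>. The approximate unit then spreads \<open>f1\<close> into a sum
  whose Haagerup norm is controlled by its product, and that product is close to
  \<open>mult_map u\<close>.\<close>

lemma kernel_approx:
  assumes W: "W \<subseteq> reps" "0 \<in> W" and W_add: "\<And>u v. u \<in> W \<Longrightarrow> v \<in> W \<Longrightarrow> u + v \<in> W"
    and W_bal: "\<And>a x y. a \<in> A \<Longrightarrow> x \<in> closed_principal A f1 \<Longrightarrow> y \<in> closed_principal A f2 \<Longrightarrow>
      pure (a * x) y - pure x (a * y) \<in> W"
    and u: "u \<in> reps" and e: "e > 0"
  shows "\<exists>w\<in>W. hnorm1 (u - w) \<le> norm (mult_map u) + e"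
proof -
  have W_reps: "w \<in> reps" if "w \<in> W" for w using W that by blast
  have f1: "f1 \<in> closed_principal A f1" by (rule principal_self)
  have cf2: "c * f2 \<in> closed_principal A f2" if "c \<in> A" for c using that by (rule principal_memI)
  \<comment> \<open>The clause \<open>mult_map w = 0\<close> is kept so that subtracting
    \<open>w\<close> leaves the product of \<open>u\<close> unchanged in the final
    comparison.\<close>
  have reduce: "\<exists>c\<in>A. \<exists>w\<in>W. mult_map w = 0 \<and> hnorm1 (u - w - pure f1 (c * f2)) \<le> d" if "d > 0" for d
    using u that
  proof (induction arbitrary: d rule: reps_induct)
    case zero
    have "hnorm1 (- pure f1 (0 * f2)) = 0"
      using null_minus[OF null_zero_right[OF f1]] by (intro hnorm1_null) simp
    then show ?case
      using zero W(2) zero_A by (intro bexI[of _ 0]) auto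
  next
    case (single x y z)
    define x' where "x' = const_bcontfun z * x"
    have x': "x' \<in> closed_principal A f1" unfolding x'_def using single by (intro principal_mult const_A)
    define e1 where "e1 = d / (2 * (norm y + 1))"
    have e1: "e1 > 0" "e1 * norm y \<le> d / 2"
      using \<open>d > 0\<close> by (simp_all add: e1_def divide_simps add_nonneg_pos)
    obtain a where a: "a \<in> A" "norm (x' - a * f1) < e1"
      using principal_approx[OF x' e1(1)] by blast
    \<comment> \<open>The tolerance for \<open>y\<close> depends on \<open>a\<close>, so
      \<open>x'\<close> has to be approximated before \<open>y\<close>.\<close>
    define e2 where "e2 = d / (2 * (norm (a * f1) + 1))"
    have e2: "e2 > 0" "norm (a * f1) * e2 \<le> d / 2"
      using \<open>d > 0\<close> by (simp_all add: e2_def divide_simps add_nonneg_pos)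
    obtain b where b: "b \<in> A" "norm (y - b * f2) < e2"
      using principal_approx[OF single(2) e2(1)] by blast
    have af1: "a * f1 \<in> closed_principal A f1" using a by (intro principal_memI)
    have bf2: "b * f2 \<in> closed_principal A f2" using b by (intro principal_memI)
    \<comment> \<open>Moving \<open>a\<close> across the tensor sign leaves \<open>f1\<close> alone
      on the left.\<close>
    let ?w = "pure (a * f1) (b * f2) - pure f1 (a * (b * f2))"
    have "mult_map ?w = 0" by (simp add: mult_map_diff ac_simps)
    moreover have "?w \<in> W" using W_bal[OF a(1) f1 bf2] .
    moreover have "hnorm1 (Poly_Mapping.single (x, y) z - ?w - pure f1 ((a * b) * f2)) \<le> d"
    proof -
      have dx: "x' - a * f1 \<in> closed_principal A f1" and dy: "y - b * f2 \<in> closed_principal A f2"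
        using x' af1 single(2) bf2 by (auto intro: principal_diff)
      have n: "Poly_Mapping.single (x, y) z - pure x' y \<in> null"
        "pure x' y - pure (x' - a * f1) y - pure (a * f1) y \<in> null"
        "pure (a * f1) y - pure (a * f1) (y - b * f2) - pure (a * f1) (b * f2) \<in> null"
        using null_minus[OF null_scale_left[OF single(1,2), of z]]
          null_add_left[OF dx af1 single(2)] null_add_right[OF af1 dy bf2]
        by (simp_all add: x'_def)
      let ?n = "(Poly_Mapping.single (x, y) z - pure x' y)
        + (pure x' y - pure (x' - a * f1) y - pure (a * f1) y)
        + (pure (a * f1) y - pure (a * f1) (y - b * f2) - pure (a * f1) (b * f2))"
      have "?n \<in> null" using n by (intro null_add)
      have "Poly_Mapping.single (x, y) z - ?w - pure f1 ((a * b) * f2)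
          = (pure (x' - a * f1) y + pure (a * f1) (y - b * f2)) + ?n"
        by (simp add: mult.assoc)
      then have "hnorm1 (Poly_Mapping.single (x, y) z - ?w - pure f1 ((a * b) * f2))
          = hnorm1 (pure (x' - a * f1) y + pure (a * f1) (y - b * f2))"
        using hnorm1_add_null[OF _ \<open>?n \<in> null\<close>] single(2) dx af1 dy
        by (simp only: add_in_reps single_in_reps)
      also have "\<dots> \<le> hnorm1 (pure (x' - a * f1) y) + hnorm1 (pure (a * f1) (y - b * f2))"
        using single(2) dx af1 dy by (intro hnorm1_add single_in_reps)
      also have "\<dots> \<le> (norm (x' - a * f1) * norm y + norm (a * f1) * norm (y - b * f2))"
        using single(2) dx af1 dy by (intro add_mono hnorm1_pure order_refl)
      also have "\<dots> \<le> (e1 * norm y + norm (a * f1) * e2)"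
        using a b by (intro add_mono mult_right_mono mult_left_mono) auto
      also have "\<dots> \<le> d" using e1 e2 by simp
      finally show ?thesis .
    qed
    ultimately show ?case using mult_A[OF a(1) b(1)] by blast
  next
    case (add u v)
    have d2: "d / 2 > 0" using add.prems by simp
    obtain c w where c: "c \<in> A" "w \<in> W" "mult_map w = 0" "hnorm1 (u - w - pure f1 (c * f2)) \<le> d / 2"
      using add.IH(1)[OF d2] by blast
    obtain c' w' where c': "c' \<in> A" "w' \<in> W" "mult_map w' = 0"
      "hnorm1 (v - w' - pure f1 (c' * f2)) \<le> d / 2"
      using add.IH(2)[OF d2] by blast
    have n: "- (pure f1 (c * f2 + c' * f2) - pure f1 (c * f2) - pure f1 (c' * f2)) \<in> null"
      using f1 cf2 c c' by (intro null_minus null_add_right)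
    have "u + v - (w + w') - pure f1 ((c + c') * f2)
        = ((u - w - pure f1 (c * f2)) + (v - w' - pure f1 (c' * f2)))
          + - (pure f1 (c * f2 + c' * f2) - pure f1 (c * f2) - pure f1 (c' * f2))"
      by (simp add: distrib_right algebra_simps)
    moreover have uw: "u - w - pure f1 (c * f2) \<in> reps" "v - w' - pure f1 (c' * f2) \<in> reps"
      using add.hyps c c' f1 cf2 by (intro diff_in_reps single_in_reps; simp add: W_reps)+
    ultimately have "hnorm1 (u + v - (w + w') - pure f1 ((c + c') * f2))
        = hnorm1 ((u - w - pure f1 (c * f2)) + (v - w' - pure f1 (c' * f2)))"
      using hnorm1_add_null[OF add_in_reps n] by (simp only: )
    also have "\<dots> \<le> hnorm1 (u - w - pure f1 (c * f2)) + hnorm1 (v - w' - pure f1 (c' * f2))"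
      using uw by (rule hnorm1_add)
    also have "\<dots> \<le> d" using c c' by simp
    finally have "hnorm1 (u + v - (w + w') - pure f1 ((c + c') * f2)) \<le> d" .
    moreover have "mult_map (w + w') = 0" using c c' by (simp add: mult_map_add)
    ultimately show ?case using W_add[OF c(2) c'(2)] add_A[OF c(1) c'(1)] by blast
  qed
  have e3: "e / 3 > 0" using e by simp
  obtain c w where c: "c \<in> A" and w: "w \<in> W" "mult_map w = 0"
    and uw: "hnorm1 (u - w - pure f1 (c * f2)) \<le> e / 3"
    using reduce[OF e3] by blast
  let ?g = "c * f2"
  have g: "?g \<in> closed_principal A f2" using c by (rule cf2)
  define d where "d = e / (3 * (norm ?g + 1))"
  have d: "d > 0" "d * norm ?g \<le> e / 3"
    using e by (simp_all add: d_def divide_simps add_nonneg_pos)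
  obtain L h k where hk: "\<And>l. l < L \<Longrightarrow> h l \<in> A" "\<And>l. l < L \<Longrightarrow> k l \<in> A"
    and h_norm: "\<And>w. l2norm L (\<lambda>l. apply_bcontfun (h l * f1) w) \<le> 1"
    and k_norm: "\<And>w. l2norm L (\<lambda>l. k l w) \<le> cmod (f1 w)"
    and q: "norm (f1 - (\<Sum>l<L. k l * (h l * f1))) \<le> d"
    using approximate_unit[OF d(1)] by blast
  let ?q = "\<Sum>l<L. k l * (h l * f1)"
  have khf: "k l * (h l * f1) \<in> closed_principal A f1" and hf: "h l * f1 \<in> closed_principal A f1" if "l < L" for l
    using hk[OF that] by (auto intro: principal_mult principal_memI)
  have qX: "?q \<in> closed_principal A f1"
    using khf by (intro sum_in_X) simp
  let ?U = "\<Sum>l<L. pure (h l * f1) (k l * ?g)"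
  \<comment> \<open>These relations move every \<open>k l\<close> to the right and produce the form
    to which the block estimate applies.\<close>
  let ?w' = "\<Sum>l<L. pure (k l * (h l * f1)) ?g - pure (h l * f1) (k l * ?g)"
  have w': "?w' \<in> W"
    using W_bal[OF hk(2) hf g] by (induction L) (auto intro: W W_add)
  have U: "hnorm1 ?U \<le> norm (f1 * ?g)"
    using hnorm_block_le[of L "\<lambda>l. h l * f1" k 1 "\<lambda>_ _. ?g" f1] hf hk(2) g h_norm k_norm
      sup_norm_1_1[of "\<lambda>_ _. f1 * ?g"] by (simp add: mat_in_def)
  have U_reps: "?U \<in> reps"
    using hf hk g by (intro sum_in_reps single_in_reps) (auto intro: principal_mult)
  have fq: "f1 - ?q \<in> closed_principal A f1" using f1 qX by (rule principal_diff)
  have n1: "pure f1 ?g - pure (f1 - ?q) ?g - pure ?q ?g \<in> null"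
    using null_add_left[OF fq qX g] by simp
  have n2: "pure ?q ?g - (\<Sum>l<L. pure (k l * (h l * f1)) ?g) \<in> null"
    using khf g by (intro null_sum_left) auto
  let ?n = "(pure f1 ?g - pure (f1 - ?q) ?g - pure ?q ?g)
    + (pure ?q ?g - (\<Sum>l<L. pure (k l * (h l * f1)) ?g))"
  have n: "?n \<in> null" using n1 n2 by (rule null_add)
  have rest: "u - w - pure f1 ?g \<in> reps"
    using u w g f1 by (intro diff_in_reps single_in_reps; simp add: W_reps)
  \<comment> \<open>Contractivity of multiplication bounds the product of the remainder by its
    tensor norm, so the two products differ by at most \<open>e / 3\<close>.\<close>
  have "norm (f1 * ?g) = norm (mult_map u - mult_map (u - w - pure f1 ?g))"
    using w by (simp add: mult_map_diff)
  also have "\<dots> \<le> norm (mult_map u) + norm (mult_map (u - w - pure f1 ?g))"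
    by (rule norm_triangle_ineq4)
  also have "\<dots> \<le> norm (mult_map u) + e / 3"
    using norm_mult_map[OF rest] uw by linarith
  finally have fg: "norm (f1 * ?g) \<le> norm (mult_map u) + e / 3" .
  have "hnorm1 (pure (f1 - ?q) ?g) \<le> norm (f1 - ?q) * norm ?g"
    using fq g by (rule hnorm1_pure)
  also have "\<dots> \<le> d * norm ?g" using q by (intro mult_right_mono) auto
  finally have small: "hnorm1 (pure (f1 - ?q) ?g) \<le> e / 3" using d by simp
  have "u - (w + ?w') = ((u - w - pure f1 ?g) + (pure (f1 - ?q) ?g + ?U)) + ?n"
    by (simp add: sum_subtractf)
  moreover have fqU: "pure (f1 - ?q) ?g + ?U \<in> reps"
    using fq g U_reps by (intro add_in_reps single_in_reps)
  ultimately have "hnorm1 (u - (w + ?w'))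
      = hnorm1 ((u - w - pure f1 ?g) + (pure (f1 - ?q) ?g + ?U))"
    using hnorm1_add_null[OF add_in_reps[OF rest fqU] n] by (simp only: )
  also have "\<dots> \<le> hnorm1 (u - w - pure f1 ?g) + (hnorm1 (pure (f1 - ?q) ?g) + hnorm1 ?U)"
    using hnorm1_add[OF rest fqU] hnorm1_add[OF single_in_reps[OF fq g, of 1] U_reps] by linarith
  \<comment> \<open>One third of \<open>e\<close> each comes from the reduction, from replacing
    \<open>f1\<close> by \<open>?q\<close>, and from comparing the two products.\<close>
  also have "\<dots> \<le> norm (mult_map u) + e"
    using uw small U fg by linarith
  finally have "hnorm1 (u - (w + ?w')) \<le> norm (mult_map u) + e" .
  then show ?thesis using W_add[OF w(1) w'] by blast
qed

theorem module_haagerup_principal_iso: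
  "completely_isometric_iso A (module_haagerup A (principal_closure A f1) (principal_closure A f2))
    (principal_closure A (f1 * f2))"
  unfolding principal_closure_def
  by (rule module_haagerup_iso)
    (rule closed_closure principal_diff mult_map_principal lift_approx kernel_approx; assumption)+

end

section \<open>The semigroup \<open>\<R>(\<Omega>)\<close>\<close>

lemma tuple_norm_power2: "(tuple_norm H w)\<^sup>2 = (\<Sum>i<length H. (cmod ((H ! i) w))\<^sup>2)"
  unfolding tuple_norm_def by (rule l2norm_power2)

lemma tuple_norm_nonneg: "0 \<le> tuple_norm H w"
  by (simp add: tuple_norm_def)

lemma cmod_tuple_dot_le:
  "length H = length K \<Longrightarrow> cmod (tuple_dot H K w) \<le> tuple_norm H w * tuple_norm K w"
  unfolding tuple_dot_def tuple_norm_def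
  using cmod_sum_mult_le[where q = "length H" and a = "\<lambda>i. (H ! i) w" and z = "\<lambda>i. (K ! i) w"]
  by simp

text \<open>At \<open>h = 0\<close> both sides hold, so the convention for the inverse of zero is
  absorbed into a real inequality.\<close>

lemma ereal_le_inverse_iff:
  assumes "0 \<le> h"
  shows "ereal f \<le> inverse (ereal h) \<longleftrightarrow> f * h \<le> 1"
proof (cases "h = 0")
  case False
  with assms show ?thesis by (simp add: field_simps)
qed simp

text \<open>The conditions in \<open>R_at\<close> in real arithmetic, with the set \<open>E\<close>
  recovered as the zero set of \<open>f\<close>.\<close>

definition R_witness ::
  "('w::topological_space \<Rightarrow>\<^sub>C complex) set \<Rightarrow> ('w \<Rightarrow>\<^sub>C complex) \<Rightarrow>
    (nat \<Rightarrow> ('w \<Rightarrow>\<^sub>C complex) list) \<Rightarrow> (nat \<Rightarrow> ('w \<Rightarrow>\<^sub>C complex) list) \<Rightarrow> bool" where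
  "R_witness A f H K \<longleftrightarrow>
     (\<forall>n. is_tuple A (H n) \<and> is_tuple A (K n) \<and> length (H n) = length (K n))
   \<and> (\<forall>n w. f w \<in> \<real> \<and> tuple_norm (K n) w \<le> Re (f w) \<and> Re (f w) * tuple_norm (H n) w \<le> 1)
   \<and> (\<forall>C. compact C \<and> C \<subseteq> {w. f w \<noteq> 0} \<longrightarrow>
        uniform_limit C (\<lambda>n. tuple_dot (H n) (K n)) (\<lambda>_. 1) sequentially)"

lemma R_at_iff: "f \<in> R_at A E \<longleftrightarrow> {w. f w = 0} = E \<and> (\<exists>H K. R_witness A f H K)"
proof -
  have inv: "ereal (Re (f w)) \<le> inverse (ereal (tuple_norm H w)) \<longleftrightarrow> Re (f w) * tuple_norm H w \<le> 1" for w H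
    by (rule ereal_le_inverse_iff) (rule tuple_norm_nonneg)
  have compl: "- {w. f w = 0} = {w. f w \<noteq> 0}" by auto
  show ?thesis
  proof (cases "{w. f w = 0} = E")
    case True
    then show ?thesis
      by (simp only: R_at_def R_witness_def mem_Collect_eq inv flip: True) (simp only: compl)
  qed (simp add: R_at_def)
qed

lemma R_witnessD:
  assumes "R_witness A f H K"
  shows "is_tuple A (H n)" "is_tuple A (K n)" "length (H n) = length (K n)"
    "f w \<in> \<real>" "tuple_norm (K n) w \<le> Re (f w)" "Re (f w) * tuple_norm (H n) w \<le> 1"
  using assms unfolding R_witness_def by auto

lemma R_witness_lim:
  "R_witness A f H K \<Longrightarrow> compact C \<Longrightarrow> C \<subseteq> {w. f w \<noteq> 0} \<Longrightarrow>
    uniform_limit C (\<lambda>n. tuple_dot (H n) (K n)) (\<lambda>_. 1) sequentially"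
  by (simp add: R_witness_def)

text \<open>Nonnegativity follows since \<open>f\<close> dominates the norms of the tuples
  \<open>K n\<close>.\<close>

lemma R_witness_pos:
  assumes "R_witness A f H K"
  shows "f w = complex_of_real (Re (f w))" "0 \<le> Re (f w)"
  using R_witnessD[OF assms] tuple_norm_nonneg order_trans by (auto simp: of_real_Re) blast

lemma R_witness_norm: "R_witness A f H K \<Longrightarrow> cmod (f w) = Re (f w)"
  using R_witness_pos[of A f H K w] by (metis abs_of_nonneg norm_of_real)

lemma R_witness_dot_le:
  assumes "R_witness A f H K"
  shows "cmod (tuple_dot (H n) (K n) w) \<le> 1"
proof -
  have "cmod (tuple_dot (H n) (K n) w) \<le> tuple_norm (H n) w * tuple_norm (K n) w"
    by (intro cmod_tuple_dot_le R_witnessD[OF assms])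
  also have "\<dots> \<le> tuple_norm (H n) w * Re (f w)"
    by (intro mult_left_mono tuple_norm_nonneg R_witnessD[OF assms])
  also have "\<dots> \<le> 1"
    using R_witnessD(6)[OF assms] by (simp add: mult.commute)
  finally show ?thesis .
qed

text \<open>The given limit is uniform only on compact sets away from the zeros of \<open>f\<close>.
  Elsewhere the factor \<open>f\<close> itself is small and the other factor is at most 2.\<close>

lemma R_witness_approx:
  fixes f :: "'w::topological_space \<Rightarrow>\<^sub>C complex"
  assumes cpt: "compact (UNIV :: 'w set)" and f: "R_witness A f H K" and e: "e > 0"
  shows "\<exists>n. \<forall>w. cmod (f w) * cmod (1 - tuple_dot (H n) (K n) w) \<le> e"
proof -
  \<comment> \<open>The threshold \<open>e / 2\<close> compensates the bound 2 outside
    \<open>C\<close>. Compactness of \<open>C\<close> comes from compactness of the whole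
    space.\<close>
  define C where "C = {w. e / 2 \<le> Re (f w)}"
  have "continuous_on UNIV (\<lambda>w. Re (f w))"
    by (intro continuous_on_Re continuous_on_apply_bcontfun)
  then have "closed C"
    unfolding C_def by (intro closed_Collect_le continuous_on_const)
  then have "compact C"
    using compact_Int_closed[OF cpt] by simp
  moreover have "C \<subseteq> {w. f w \<noteq> 0}"
    using e by (auto simp: C_def)
  ultimately have lim: "uniform_limit C (\<lambda>n. tuple_dot (H n) (K n)) (\<lambda>_. 1) sequentially"
    by (rule R_witness_lim[OF f])
  define d where "d = e / (norm f + 1)"
  have pos: "norm f + 1 > 0" by (simp add: add_nonneg_pos)
  then have d: "d > 0" using e by (simp add: d_def)
  then have "\<forall>\<^sub>F n in sequentially. \<forall>w\<in>C. dist (tuple_dot (H n) (K n) w) 1 < d"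
    using lim by (simp add: uniform_limit_iff)
  then obtain n where n: "\<And>w. w \<in> C \<Longrightarrow> dist (tuple_dot (H n) (K n) w) 1 < d"
    by (auto simp: eventually_sequentially)
  have "cmod (f w) * cmod (1 - tuple_dot (H n) (K n) w) \<le> e" for w
  proof (cases "w \<in> C")
    case True
    then have "cmod (1 - tuple_dot (H n) (K n) w) \<le> d"
      using n by (simp add: dist_norm norm_minus_commute less_imp_le)
    then have "cmod (f w) * cmod (1 - tuple_dot (H n) (K n) w) \<le> (norm f + 1) * d"
      using norm_bounded[of f w] by (intro mult_mono) auto
    then show ?thesis using pos by (simp add: d_def)
  next
    case False
    then have "cmod (f w) \<le> e / 2"
      using R_witness_norm[OF f] by (simp add: C_def)
    moreover have "cmod (1 - tuple_dot (H n) (K n) w) \<le> 2"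
      using norm_triangle_ineq4[of 1 "tuple_dot (H n) (K n) w"] R_witness_dot_le[OF f, of n w] by simp
    ultimately have "cmod (f w) * cmod (1 - tuple_dot (H n) (K n) w) \<le> e / 2 * 2"
      by (intro mult_mono) (use e in auto)
    then show ?thesis by simp
  qed
  then show ?thesis by blast
qed

lemma principal_modules_R_all:
  fixes A :: "('w::topological_space \<Rightarrow>\<^sub>C complex) set"
  assumes cpt: "compact (UNIV :: 'w set)" and A: "uniform_algebra A" and f1: "f1 \<in> R_all A"
  shows "principal_modules A f1"
proof
  show "const_bcontfun c \<in> A" for c
    using A by (simp add: uniform_algebra_def)
  show "a + b \<in> A" "a * b \<in> A" if "a \<in> A" "b \<in> A" for a b
    using A that by (simp_all add: uniform_algebra_def)
  fix e :: real assume e: "e > 0"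
  obtain H K where f: "R_witness A f1 H K"
    using f1 by (auto simp: R_all_def R_at_iff)
  obtain n where n: "\<And>w. cmod (f1 w) * cmod (1 - tuple_dot (H n) (K n) w) \<le> e"
    using R_witness_approx[OF cpt f e] by blast
  let ?L = "length (H n)" and ?h = "\<lambda>l. H n ! l" and ?k = "\<lambda>l. K n ! l"
  have sub: "set (H n) \<subseteq> A" "set (K n) \<subseteq> A"
    using R_witnessD(1,2)[OF f, of n] by (simp_all add: is_tuple_def)
  have "\<forall>l<?L. ?h l \<in> A \<and> ?k l \<in> A"
  proof (intro allI impI conjI)
    fix l assume l: "l < ?L"
    then show "?h l \<in> A" by (rule subsetD[OF sub(1) nth_mem])
    from l have "l < length (K n)" by (simp only: R_witnessD(3)[OF f])
    then show "?k l \<in> A" by (rule subsetD[OF sub(2) nth_mem])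
  qed
  moreover have "l2norm ?L (\<lambda>l. apply_bcontfun (?h l * f1) w) \<le> 1" for w
  proof -
    have "l2norm ?L (\<lambda>l. apply_bcontfun (?h l * f1) w) = cmod (f1 w) * tuple_norm (H n) w"
      unfolding tuple_norm_def using l2norm_scale[where c = "f1 w" and n = ?L and x = "\<lambda>l. ?h l w"]
      by (simp add: mult.commute)
    also have "\<dots> = Re (f1 w) * tuple_norm (H n) w"
      using R_witness_norm[OF f] by simp
    also have "\<dots> \<le> 1" by (rule R_witnessD[OF f])
    finally show ?thesis .
  qed
  moreover have "l2norm ?L (\<lambda>l. ?k l w) \<le> cmod (f1 w)" for w
    using R_witnessD(3,5)[OF f, of n] R_witness_norm[OF f, of w] by (simp add: tuple_norm_def)
  moreover have "norm (f1 - (\<Sum>l<?L. ?k l * (?h l * f1))) \<le> e"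
  proof (rule norm_bound)
    fix w
    have "apply_bcontfun (\<Sum>l<m. ?k l * (?h l * f1)) w = (\<Sum>l<m. ?h l w * ?k l w) * f1 w" for m
      by (induction m) (simp_all add: algebra_simps)
    then have "apply_bcontfun (f1 - (\<Sum>l<?L. ?k l * (?h l * f1))) w
        = f1 w * (1 - tuple_dot (H n) (K n) w)"
      by (simp add: tuple_dot_def algebra_simps)
    then show "cmod (apply_bcontfun (f1 - (\<Sum>l<?L. ?k l * (?h l * f1))) w) \<le> e"
      using n[of w] by (simp add: norm_mult)
  qed
  ultimately show "\<exists>L h k. (\<forall>l<L. h l \<in> A \<and> k l \<in> A)
      \<and> (\<forall>w. l2norm L (\<lambda>l. apply_bcontfun (h l * f1) w) \<le> 1)
      \<and> (\<forall>w. l2norm L (\<lambda>l. apply_bcontfun (k l) w) \<le> cmod (apply_bcontfun f1 w))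
      \<and> norm (f1 - (\<Sum>l<L. k l * (h l * f1))) \<le> e"
    by (intro exI[of _ ?L] exI[of _ ?h] exI[of _ ?k]) blast
qed

section \<open>Kronecker products of tuples and closure under multiplication\<close>

definition tuple_prod ::
  "('w::topological_space \<Rightarrow>\<^sub>C complex) list \<Rightarrow> ('w \<Rightarrow>\<^sub>C complex) list \<Rightarrow> ('w \<Rightarrow>\<^sub>C complex) list" where
  "tuple_prod H H' = map (\<lambda>k. H ! (k div length H') * H' ! (k mod length H')) [0..<length H * length H']"

lemma length_tuple_prod [simp]: "length (tuple_prod H H') = length H * length H'"
  by (simp add: tuple_prod_def)

lemma nth_tuple_prod:
  "k < length H * length H' \<Longrightarrow> tuple_prod H H' ! k = H ! (k div length H') * H' ! (k mod length H')"
  by (simp add: tuple_prod_def)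

lemma is_tuple_prod:
  assumes A: "\<And>a b. a \<in> A \<Longrightarrow> b \<in> A \<Longrightarrow> a * b \<in> A" and H: "is_tuple A H" and H': "is_tuple A H'"
  shows "is_tuple A (tuple_prod H H')"
proof -
  have pos: "length H' > 0" using H' by (simp add: is_tuple_def)
  have "H ! (k div length H') * H' ! (k mod length H') \<in> A" if "k < length H * length H'" for k
    using that pos H H' by (intro A) (auto simp: is_tuple_def subset_iff less_mult_imp_div_less)
  then show ?thesis
    using H H' by (auto simp: is_tuple_def tuple_prod_def)
qed

text \<open>The Euclidean norm is multiplicative on Kronecker products, which lets the inequalities
  in (i) for two functions be multiplied.\<close>

lemma tuple_norm_prod: "tuple_norm (tuple_prod H H') w = tuple_norm H w * tuple_norm H' w"
proof -
  have "(tuple_norm (tuple_prod H H') w)\<^sup>2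
      = (\<Sum>k<length H * length H'. (cmod ((H ! (k div length H')) w))\<^sup>2 * (cmod ((H' ! (k mod length H')) w))\<^sup>2)"
    unfolding tuple_norm_power2 length_tuple_prod
    by (intro sum.cong) (simp_all add: nth_tuple_prod norm_mult power_mult_distrib)
  also have "\<dots> = (\<Sum>i<length H. \<Sum>j<length H'. (cmod ((H ! i) w))\<^sup>2 * (cmod ((H' ! j) w))\<^sup>2)"
    by (rule sum_lessThan_mult[of "\<lambda>i j. (cmod ((H ! i) w))\<^sup>2 * (cmod ((H' ! j) w))\<^sup>2"])
  also have "\<dots> = (tuple_norm H w * tuple_norm H' w)\<^sup>2"
    by (simp only: power_mult_distrib tuple_norm_power2 sum_product)
  finally show ?thesis
    by (rule power2_eq_imp_eq) (simp_all add: tuple_norm_nonneg)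
qed

lemma tuple_dot_prod:
  assumes "length H = length K" and "length H' = length K'"
  shows "tuple_dot (tuple_prod H H') (tuple_prod K K') w = tuple_dot H K w * tuple_dot H' K' w"
proof -
  have "tuple_dot (tuple_prod H H') (tuple_prod K K') w
      = (\<Sum>k<length H * length H'. (\<lambda>i j. ((H ! i) w * (K ! i) w) * ((H' ! j) w * (K' ! j) w))
          (k div length H') (k mod length H'))"
    unfolding tuple_dot_def length_tuple_prod using assms
    by (intro sum.cong) (simp_all add: nth_tuple_prod)
  also have "\<dots> = (\<Sum>i<length H. \<Sum>j<length H'. ((H ! i) w * (K ! i) w) * ((H' ! j) w * (K' ! j) w))"
    by (rule sum_lessThan_mult)
  also have "\<dots> = tuple_dot H K w * tuple_dot H' K' w"
    by (simp only: tuple_dot_def sum_product)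
  finally show ?thesis .
qed

lemma R_at_times:
  assumes A: "uniform_algebra A" and f: "f \<in> R_at A E" and g: "g \<in> R_at A E'"
  shows "f * g \<in> R_at A (E \<union> E')"
proof -
  obtain H K H' K' where fw: "R_witness A f H K" and gw: "R_witness A g H' K'"
    and E: "E = {w. f w = 0}" "E' = {w. g w = 0}"
    using f g unfolding R_at_iff by blast
  let ?H = "\<lambda>n. tuple_prod (H n) (H' n)" and ?K = "\<lambda>n. tuple_prod (K n) (K' n)"
  have len: "length (H n) = length (K n)" "length (H' n) = length (K' n)" for n
    using R_witnessD(3)[OF fw] R_witnessD(3)[OF gw] by auto
  have mult_A: "a * b \<in> A" if "a \<in> A" "b \<in> A" for a b
    using A that by (simp add: uniform_algebra_def)
  have "R_witness A (f * g) ?H ?K"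
    unfolding R_witness_def
  proof (intro conjI allI impI)
    fix n w
    show "is_tuple A (?H n)" "is_tuple A (?K n)"
      by (intro is_tuple_prod mult_A R_witnessD[OF fw] R_witnessD[OF gw]; assumption)+
    show "length (?H n) = length (?K n)" by (simp add: len)
    have fg: "(f * g) w = complex_of_real (Re (f w) * Re (g w))"
      using R_witness_pos(1)[OF fw, of w] R_witness_pos(1)[OF gw, of w]
      by (metis apply_bcontfun_times of_real_mult)
    then show "(f * g) w \<in> \<real>" by (metis Reals_of_real)
    have Re: "Re ((f * g) w) = Re (f w) * Re (g w)" by (simp only: fg Re_complex_of_real)
    show "tuple_norm (?K n) w \<le> Re ((f * g) w)"
      unfolding Re tuple_norm_prod
      by (intro mult_mono R_witnessD[OF fw] R_witnessD[OF gw] R_witness_pos[OF fw] tuple_norm_nonneg)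
    have "(Re (f w) * tuple_norm (H n) w) * (Re (g w) * tuple_norm (H' n) w) \<le> 1 * 1"
      by (intro mult_mono R_witnessD[OF fw] R_witnessD[OF gw] mult_nonneg_nonneg
          R_witness_pos[OF gw] tuple_norm_nonneg) simp
    then show "Re ((f * g) w) * tuple_norm (?H n) w \<le> 1"
      unfolding Re tuple_norm_prod by (simp add: ac_simps)
  next
    fix C assume "compact C \<and> C \<subseteq> {w. (f * g) w \<noteq> 0}"
    \<comment> \<open>A compact set avoiding the zeros of the product avoids those of both factors,
      so both limits are available on it.\<close>
    then have lim: "uniform_limit C (\<lambda>n. tuple_dot (H n) (K n)) (\<lambda>_. 1) sequentially"
      "uniform_limit C (\<lambda>n. tuple_dot (H' n) (K' n)) (\<lambda>_. 1) sequentially"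
      by (auto intro: R_witness_lim[OF fw] R_witness_lim[OF gw])
    have "uniform_limit C (\<lambda>n w. tuple_dot (H n) (K n) w * tuple_dot (H' n) (K' n) w)
        (\<lambda>w. 1 * 1) sequentially"
      \<comment> \<open>Multiplying uniform limits requires bounded limit functions; here both are
        the constant 1.\<close>
      using lim by (intro uniform_lim_mult) (simp_all add: image_constant_conv)
    then show "uniform_limit C (\<lambda>n. tuple_dot (?H n) (?K n)) (\<lambda>_. 1) sequentially"
      by (simp add: tuple_dot_prod len cong: uniform_limit_cong')
  qed
  moreover have "{w. (f * g) w = 0} = E \<union> E'" by (auto simp: E)
  ultimately show ?thesis unfolding R_at_iff by blast
qed

lemma R_all_times:
  assumes A: "uniform_algebra A" and "f \<in> R_all A" "g \<in> R_all A"
  shows "f * g \<in> R_all A"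
proof -
  obtain E E' where "closed E" "f \<in> R_at A E" "closed E'" "g \<in> R_at A E'"
    using assms(2,3) by (auto simp: R_all_def)
  then show ?thesis
    unfolding R_all_def using R_at_times[OF A] closed_Un by blast
qed

lemma one_in_R_at:
  assumes "uniform_algebra A" shows "1 \<in> R_at A {}"
proof -
  have "1 \<in> A"
    using assms const_bcontfun_1 unfolding uniform_algebra_def by metis
  moreover have "tuple_dot [1] [1] = (\<lambda>_::'a. 1)"
    by (simp add: tuple_dot_def fun_eq_iff)
  ultimately have "R_witness A 1 (\<lambda>_. [1]) (\<lambda>_. [1])"
    by (simp add: R_witness_def is_tuple_def tuple_norm_def uniform_limit_const)
  then show ?thesis unfolding R_at_iff by auto
qed

theorem proposition8p16:
  fixes A :: "('w::t2_space \<Rightarrow>\<^sub>C complex) set"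
  assumes "compact (UNIV :: 'w set)" and "uniform_algebra A"
  shows "monoid \<lparr>carrier = R_all A, mult = (*), one = 1\<rparr>
    \<and> (\<forall>f1 f2. f1 \<in> R_all A \<and> (\<forall>w. apply_bcontfun f2 w \<in> \<real> \<and> 0 \<le> Re (apply_bcontfun f2 w)) \<longrightarrow>
         completely_isometric_iso A
           (module_haagerup A (principal_closure A f1) (principal_closure A f2))
           (principal_closure A (f1 * f2)))
    \<and> (\<forall>E1 E2 f1 f2. closed E1 \<and> closed E2 \<and> f1 \<in> R_at A E1 \<and> f2 \<in> R_at A E2 \<longrightarrow>
         f1 * f2 \<in> R_at A (E1 \<union> E2))"
proof (intro conjI allI impI)
  show "monoid \<lparr>carrier = R_all A, mult = (*), one = 1\<rparr>"
  proof
    fix f g assume "f \<in> carrier \<lparr>carrier = R_all A, mult = (*), one = 1\<rparr>"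
      "g \<in> carrier \<lparr>carrier = R_all A, mult = (*), one = 1\<rparr>"
    then show "f \<otimes>\<^bsub>\<lparr>carrier = R_all A, mult = (*), one = 1\<rparr>\<^esub> g
        \<in> carrier \<lparr>carrier = R_all A, mult = (*), one = 1\<rparr>"
      using R_all_times[OF assms(2)] by simp
  next
    show "\<one>\<^bsub>\<lparr>carrier = R_all A, mult = (*), one = 1\<rparr>\<^esub>
        \<in> carrier \<lparr>carrier = R_all A, mult = (*), one = 1\<rparr>"
      using one_in_R_at[OF assms(2)] by (auto simp: R_all_def)
  qed (simp_all add: mult.assoc)
next
  fix f1 f2 :: "'w \<Rightarrow>\<^sub>C complex"
  assume "f1 \<in> R_all A \<and> (\<forall>w. apply_bcontfun f2 w \<in> \<real> \<and> 0 \<le> Re (apply_bcontfun f2 w))"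
  then interpret principal_modules A f1 f2
    using principal_modules_R_all[OF assms] by blast
  show "completely_isometric_iso A
      (module_haagerup A (principal_closure A f1) (principal_closure A f2))
      (principal_closure A (f1 * f2))"
    by (rule module_haagerup_principal_iso)
next
  fix E1 E2 :: "'w set" and f1 f2
  assume "closed E1 \<and> closed E2 \<and> f1 \<in> R_at A E1 \<and> f2 \<in> R_at A E2"
  then show "f1 * f2 \<in> R_at A (E1 \<union> E2)"
    using R_at_times[OF assms(2)] by blast
qed

end
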